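(* Fix $\chi\in\mathcal{O}$ and let $\phi\in\Omega(\chi)$. The following holds. (a) If $\chi\in\mathcal{O}_1$, then $\dim\operatorname{Ext}^1(L_1^\phi,L_1^\chi)=1$ if $\phi\in\{\bar\chi,-\chi\}$, and $0$ otherwise. (b) If $\chi\in\mathcal{O}_2$ and $\alpha_1\ne0$, then $\dim\operatorname{Ext}^1(L_{2,h}^\phi,L_{2,h}^\chi)=2$ if $\phi\in\{-\bar\chi,-\chi\}$, and $0$ otherwise. (c) If $\chi\in\mathcal{O}_2$ and $\alpha_2\neq0$, then $\dim\operatorname{Ext}^1(L_{2,v}^\phi,L_{2,v}^\chi)=2$ if $\phi\in\{-\bar\chi,\bar\chi\}$, and $0$ otherwise. (d) If $\chi\in\mathcal{O}_4$ and $D(\chi)\ne0$, then $\dim\operatorname{Ext}^1(L_4^\phi(e),L_4^\chi(d))=0$. (e) If $\chi\in\mathcal{O}_4$ and $D(\chi)=0$, then $\dim\operatorname{Ext}^1(L_4^\phi(e),L_4^\chi(d))=1$. Here $\operatorname{Ext}^1=\operatorname{Ext}^1_{H_\lambda}$, and in (d), (e) $d$ and $e$ are any solutions of $\alpha_1^2\alpha_2x^2-\alpha_3x+\alpha_2=0$.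
   Context: $\Bbbk$ is an algebraically closed field of characteristic zero, $N,M\ge2$ are integers, $\lambda=(\lambda_1,\lambda_2,\lambda_3)\in\Bbbk^3$, $\Gamma=\langle g_1,g_2: g_1g_2=g_2g_1,\ g_1^{2N}=g_2^{2M}=1\rangle$. $H_\lambda$ is the algebra generated by $\Gamma$ and $a_1,a_2$ with relations $g_1a_1=-a_1g_1$, $g_1a_2=-a_2g_1$, $g_2a_1=a_1g_2$, $g_2a_2=-a_2g_2$, $a_1^2=\lambda_1(1-g_1^2)$, $a_2^2=\lambda_2(1-g_2^2)$, $a_1a_2a_1a_2+a_2a_1a_2a_1=\lambda_3(1-g_1^2g_2^2)-2\lambda_1\lambda_2(1+g_2^2)(1-g_1^2)$. $\mathcal{O}=\mathbb{G}_{2N}\times\mathbb{G}_{2M}$ ($\mathbb{G}_n$ = $n$th roots of 1 in $\Bbbk$). For $\chi=(\chi_1,\chi_2)\in\mathcal{O}$: a vector $v$ is of type $\chi$ if $g_iv=\chi_iv$; $\bar\chi=(-\chi_1,\chi_2)$, $-\chi=(-\chi_1,-\chi_2)$, $-\bar\chi=(\chi_1,-\chi_2)$, $\Omega(\chi)=\{\chi,\bar\chi,-\bar\chi,-\chi\}$; $\alpha_1=\lambda_1(1-\chi_1^2)$, $\alpha_2=\lambda_2(1-\chi_2^2)$, $\alpha_3=\lambda_3(1-\chi_1^2\chi_2^2)-2\lambda_1\lambda_2(1+\chi_2^2)(1-\chi_1^2)$ (constant on $\Omega(\chi)$); $D(\chi)=\alpha_3^2-4\alpha_1^2\alpha_2^2$.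 $\mathcal{O}_1=\{\chi:\alpha_1=\alpha_2=\alpha_3=0\}$; $\mathcal{O}_2=\{\chi:\alpha_3=0$ and exactly one of $\alpha_1,\alpha_2$ is nonzero$\}$; $\mathcal{O}_4=\mathcal{O}\setminus(\mathcal{O}_1\sqcup\mathcal{O}_2)$. Simple modules: $L_1^\chi=\Bbbk v$ ($\chi\in\mathcal{O}_1$), $v$ of type $\chi$, $a_1v=a_2v=0$. $L_{2,h}^\chi$ ($\chi\in\mathcal{O}_2$, $\alpha_1\ne0$): basis $v,w$ of types $\chi,\bar\chi$, $a_1v=w$, $a_1w=\alpha_1v$, $a_2=0$. $L_{2,v}^\chi$ ($\chi\in\mathcal{O}_2$, $\alpha_2\neq0$): basis $v,w$ of types $\chi,-\chi$, $a_2v=w$, $a_2w=\alpha_2v$, $a_1=0$. $L_4^\chi(d)$ ($\chi\in\mathcal{O}_4$, $\alpha_1^2\alpha_2d^2-\alpha_3d+\alpha_2=0$, $c=\alpha_3-\alpha_1^2\alpha_2d$): basis $v_1,\dots,v_4$ of types $\chi,\bar\chi,-\bar\chi,-\chi$, $a_1v_1=v_2$, $a_1v_2=\alpha_1v_1$, $a_1v_3=v_4$, $a_1v_4=\alpha_1v_3$, $a_2v_1=dv_4$, $a_2v_4=cv_1$, $a_2v_2=v_3$, $a_2v_3=\alpha_2v_2$. *)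

theory Defs
  imports
    "HOL-Library.Poly_Mapping"
    "HOL-Algebra.QuotRing"
    "Jordan_Normal_Form.VS_Connect"
begin

section \<open>Left modules over a (not necessarily commutative) ring\<close>

text \<open>HOL-Algebra's locale \<open>module\<close> has a commutative base ring. Its record type of modules, and
  the set \<^const>\<open>LinearCombinations.module_hom\<close> of linear maps, are reused here.\<close>

locale left_module = R?: ring R + M?: abelian_group M
  for R :: "('r, 'c) ring_scheme" and M :: "('r, 'm, 'd) module_scheme" (structure) +
  assumes smult_closed:
      "\<lbrakk>a \<in> carrier R; x \<in> carrier M\<rbrakk> \<Longrightarrow> a \<odot>\<^bsub>M\<^esub> x \<in> carrier M"
    and smult_l_distr:
      "\<lbrakk>a \<in> carrier R; b \<in> carrier R; x \<in> carrier M\<rbrakk>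
        \<Longrightarrow> (a \<oplus>\<^bsub>R\<^esub> b) \<odot>\<^bsub>M\<^esub> x = a \<odot>\<^bsub>M\<^esub> x \<oplus>\<^bsub>M\<^esub> b \<odot>\<^bsub>M\<^esub> x"
    and smult_r_distr:
      "\<lbrakk>a \<in> carrier R; x \<in> carrier M; y \<in> carrier M\<rbrakk>
        \<Longrightarrow> a \<odot>\<^bsub>M\<^esub> (x \<oplus>\<^bsub>M\<^esub> y) = a \<odot>\<^bsub>M\<^esub> x \<oplus>\<^bsub>M\<^esub> a \<odot>\<^bsub>M\<^esub> y"
    and smult_assoc:
      "\<lbrakk>a \<in> carrier R; b \<in> carrier R; x \<in> carrier M\<rbrakk>
        \<Longrightarrow> (a \<otimes>\<^bsub>R\<^esub> b) \<odot>\<^bsub>M\<^esub> x = a \<odot>\<^bsub>M\<^esub> (b \<odot>\<^bsub>M\<^esub> x)"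
    and smult_one:
      "x \<in> carrier M \<Longrightarrow> \<one>\<^bsub>R\<^esub> \<odot>\<^bsub>M\<^esub> x = x"

text \<open>The free left module on a set \<open>S\<close>: finitely supported functions on \<open>S\<close>.\<close>

definition free_module :: "('r, 'c) ring_scheme \<Rightarrow> 's set \<Rightarrow> ('r, 's \<Rightarrow> 'r) module" where
  "free_module R S =
    \<lparr>carrier = {f \<in> S \<rightarrow>\<^sub>E carrier R. finite {s \<in> S. f s \<noteq> \<zero>\<^bsub>R\<^esub>}},
     mult = undefined, one = undefined,
     zero = (\<lambda>s\<in>S. \<zero>\<^bsub>R\<^esub>),
     add = (\<lambda>f g. \<lambda>s\<in>S. f s \<oplus>\<^bsub>R\<^esub> g s),
     smult = (\<lambda>r f. \<lambda>s\<in>S. r \<otimes>\<^bsub>R\<^esub> f s)\<rparr>"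

text \<open>For \<open>S \<subseteq> carrier M\<close>, the map \<open>free_module R S \<rightarrow> M\<close> sending the basis element of \<open>s \<in> S\<close> to \<open>s\<close>,
  and its kernel.\<close>

definition free_map ::
    "('r, 'c) ring_scheme \<Rightarrow> ('r, 'm, 'd) module_scheme \<Rightarrow> 'm set \<Rightarrow> ('m \<Rightarrow> 'r) \<Rightarrow> 'm" where
  "free_map R M S f = (\<Oplus>\<^bsub>M\<^esub> s \<in> {s \<in> S. f s \<noteq> \<zero>\<^bsub>R\<^esub>}. f s \<odot>\<^bsub>M\<^esub> s)"

definition free_map_ker ::
    "('r, 'c) ring_scheme \<Rightarrow> ('r, 'm, 'd) module_scheme \<Rightarrow> 'm set \<Rightarrow> ('m \<Rightarrow> 'r) set" where
  "free_map_ker R M S = {f \<in> carrier (free_module R S). free_map R M S f = \<zero>\<^bsub>M\<^esub>}"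


section \<open>\<open>Ext\<^sup>1\<close> over an algebra\<close>

text \<open>An algebra over a field \<open>'k\<close> is given by a ring \<open>R\<close> together with its structure map
  \<open>\<eta> :: 'k \<Rightarrow> 'r\<close> (with central image). The field itself is \<^term>\<open>class_ring :: 'k::field ring\<close>.\<close>

definition restrict_scalars ::
    "('k \<Rightarrow> 'r) \<Rightarrow> ('r, 'm, 'c) module_scheme \<Rightarrow> ('k, 'm) module" where
  "restrict_scalars \<eta> M =
    \<lparr>carrier = carrier M, mult = mult M, one = one M, zero = zero M, add = add M,
     smult = (\<lambda>c x. \<eta> c \<odot>\<^bsub>M\<^esub> x)\<rparr>"

text \<open>The space \<open>Hom\<^sub>R(M,N)\<close>. Homomorphisms are taken extensional, so that each of them is
  represented by exactly one function.\<close>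

definition hom_space ::
    "('r, 'c) ring_scheme \<Rightarrow> ('k \<Rightarrow> 'r) \<Rightarrow> ('r, 'm, 'd) module_scheme \<Rightarrow> ('r, 'n, 'e) module_scheme
      \<Rightarrow> ('k, 'm \<Rightarrow> 'n) module" where
  "hom_space R \<eta> M N =
    \<lparr>carrier = LinearCombinations.module_hom R M N \<inter> extensional (carrier M),
     mult = undefined, one = undefined,
     zero = (\<lambda>x\<in>carrier M. \<zero>\<^bsub>N\<^esub>),
     add = (\<lambda>f g. \<lambda>x\<in>carrier M. f x \<oplus>\<^bsub>N\<^esub> g x),
     smult = (\<lambda>c f. \<lambda>x\<in>carrier M. \<eta> c \<odot>\<^bsub>N\<^esub> f x)\<rparr>"

definition quotient_space ::
    "('k, 'v, 'c) module_scheme \<Rightarrow> 'v set \<Rightarrow> ('k, 'v set) module" where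
  "quotient_space V W =
    \<lparr>carrier = a_rcosets\<^bsub>V\<^esub> W,
     mult = undefined, one = undefined,
     zero = W,
     add = (\<lambda>X Y. X <+>\<^bsub>V\<^esub> Y),
     smult = (\<lambda>c X. \<Union>x\<in>X. W +>\<^bsub>V\<^esub> (c \<odot>\<^bsub>V\<^esub> x))\<rparr>"

text \<open>\<open>Ext\<^sup>1\<^sub>R(M,N)\<close> as the first cohomology of \<open>Hom\<^sub>R(F\<^sub>\<bullet>,N)\<close>, where
  \<open>F\<^sub>2 \<rightarrow> F\<^sub>1 \<rightarrow> F\<^sub>0 \<rightarrow> M \<rightarrow> 0\<close> is the beginning of the standard free resolution: \<open>F\<^sub>0\<close> is free on the
  set \<open>M\<close>, and every following \<open>F\<^sub>i\<close> is free on the kernel of the preceding map.\<close>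

definition ext1 ::
    "('r, 'c) ring_scheme \<Rightarrow> ('k \<Rightarrow> 'r) \<Rightarrow> ('r, 'm, 'd) module_scheme \<Rightarrow> ('r, 'n, 'e) module_scheme
      \<Rightarrow> ('k, ((('m \<Rightarrow> 'r) \<Rightarrow> 'r) \<Rightarrow> 'n) set) module" where
  "ext1 R \<eta> M N =
    (let F0 = free_module R (carrier M);
         K0 = free_map_ker R M (carrier M);
         F1 = free_module R K0;
         d1 = free_map R F0 K0;
         K1 = free_map_ker R F0 K0;
         F2 = free_module R K1;
         d2 = free_map R F1 K1;
         cocycles = {f \<in> carrier (hom_space R \<eta> F1 N). \<forall>x\<in>carrier F2. f (d2 x) = \<zero>\<^bsub>N\<^esub>};
         coboundaries = (\<lambda>g. \<lambda>x\<in>carrier F1. g (d1 x)) ` carrier (hom_space R \<eta> F0 N)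
     in quotient_space (hom_space R \<eta> F1 N \<lparr>carrier := cocycles\<rparr>) coboundaries)"

text \<open>\<^const>\<open>vectorspace.dim\<close> is a least cardinality of a finite generating set, hence only
  meaningful for finite-dimensional spaces.\<close>

definition has_dim :: "('k::field, 'v, 'c) module_scheme \<Rightarrow> nat \<Rightarrow> bool" where
  "has_dim V n \<longleftrightarrow> vectorspace class_ring V \<and> vectorspace.fin_dim class_ring V
     \<and> vectorspace.dim class_ring V = n"


section \<open>The algebra \<open>H\<^sub>\<lambda>\<close>\<close>

datatype 'a free_mon = Free_Mon "'a list"

instantiation free_mon :: (type) monoid_add
begin

definition zero_free_mon :: "'a free_mon" where "0 = Free_Mon []"

fun plus_free_mon :: "'a free_mon \<Rightarrow> 'a free_mon \<Rightarrow> 'a free_mon" where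
  "Free_Mon u + Free_Mon v = Free_Mon (u @ v)"

instance
proof
  fix a b c :: "'a free_mon"
  show "a + b + c = a + (b + c)" by (cases a; cases b; cases c) simp
  show "0 + a = a" by (cases a) (simp add: zero_free_mon_def)
  show "a + 0 = a" by (cases a) (simp add: zero_free_mon_def)
qed

end

datatype gen = G1 | G2 | A1 | A2

text \<open>The free associative algebra on the four generators is the monoid algebra of the free monoid
  (written additively); its product is the convolution product of \<^typ>\<open>'a \<Rightarrow>\<^sub>0 'b\<close>. The group
  \<open>\<Gamma>\<close> enters through its own presentation.\<close>

type_synonym 'k free_alg = "gen free_mon \<Rightarrow>\<^sub>0 'k"

definition var :: "gen \<Rightarrow> 'k::field free_alg" where
  "var x = Poly_Mapping.single (Free_Mon [x]) 1"

definition scal :: "'k \<Rightarrow> 'k::field free_alg" where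
  "scal c = Poly_Mapping.single 0 c"

fun H_rels :: "nat \<Rightarrow> nat \<Rightarrow> 'k::field \<times> 'k \<times> 'k \<Rightarrow> 'k free_alg set" where
  "H_rels N M (l1, l2, l3) =
    (let g1 = var G1; g2 = var G2; a1 = var A1; a2 = var A2 in
      {g1 * g2 - g2 * g1,
       g1 ^ (2 * N) - 1,
       g2 ^ (2 * M) - 1,
       g1 * a1 - (- (a1 * g1)),
       g1 * a2 - (- (a2 * g1)),
       g2 * a1 - a1 * g2,
       g2 * a2 - (- (a2 * g2)),
       a1 ^ 2 - scal l1 * (1 - g1 ^ 2),
       a2 ^ 2 - scal l2 * (1 - g2 ^ 2),
       (a1 * a2 * a1 * a2 + a2 * a1 * a2 * a1)
         - (scal l3 * (1 - g1 ^ 2 * g2 ^ 2)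
            - scal (2 * l1 * l2) * (1 + g2 ^ 2) * (1 - g1 ^ 2))})"

text \<open>\<^const>\<open>genideal\<close> is the generated two-sided ideal.\<close>

definition H_ideal :: "nat \<Rightarrow> nat \<Rightarrow> 'k::field \<times> 'k \<times> 'k \<Rightarrow> 'k free_alg set" where
  "H_ideal N M lam = Idl\<^bsub>class_ring\<^esub> (H_rels N M lam)"

definition H_alg :: "nat \<Rightarrow> nat \<Rightarrow> 'k::field \<times> 'k \<times> 'k \<Rightarrow> 'k free_alg set ring" where
  "H_alg N M lam = class_ring Quot (H_ideal N M lam)"

definition H_class :: "nat \<Rightarrow> nat \<Rightarrow> 'k::field \<times> 'k \<times> 'k \<Rightarrow> 'k free_alg \<Rightarrow> 'k free_alg set" where
  "H_class N M lam x = H_ideal N M lam +>\<^bsub>class_ring\<^esub> x"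

definition H_gen :: "nat \<Rightarrow> nat \<Rightarrow> 'k::field \<times> 'k \<times> 'k \<Rightarrow> gen \<Rightarrow> 'k free_alg set" where
  "H_gen N M lam x = H_class N M lam (var x)"

definition H_const :: "nat \<Rightarrow> nat \<Rightarrow> 'k::field \<times> 'k \<times> 'k \<Rightarrow> 'k \<Rightarrow> 'k free_alg set" where
  "H_const N M lam c = H_class N M lam (scal c)"

definition H_ext1 ::
    "nat \<Rightarrow> nat \<Rightarrow> 'k::field \<times> 'k \<times> 'k \<Rightarrow> ('k free_alg set, 'v) module
      \<Rightarrow> ('k free_alg set, 'w) module
      \<Rightarrow> ('k, ((('v \<Rightarrow> 'k free_alg set) \<Rightarrow> 'k free_alg set) \<Rightarrow> 'w) set) module" where
  "H_ext1 N M lam V W = ext1 (H_alg N M lam) (H_const N M lam) V W"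


section \<open>Characters\<close>

definition chars :: "nat \<Rightarrow> nat \<Rightarrow> ('k::field \<times> 'k) set" where
  "chars N M = {x. x ^ (2 * N) = 1} \<times> {x. x ^ (2 * M) = 1}"

fun chi_bar :: "'k::field \<times> 'k \<Rightarrow> 'k \<times> 'k" where
  "chi_bar (x1, x2) = (- x1, x2)"

fun chi_neg :: "'k::field \<times> 'k \<Rightarrow> 'k \<times> 'k" where
  "chi_neg (x1, x2) = (- x1, - x2)"

definition Omega :: "'k::field \<times> 'k \<Rightarrow> ('k \<times> 'k) set" where
  "Omega \<chi> = {\<chi>, chi_bar \<chi>, chi_neg (chi_bar \<chi>), chi_neg \<chi>}"

fun alpha1 :: "'k::field \<times> 'k \<times> 'k \<Rightarrow> 'k \<times> 'k \<Rightarrow> 'k" where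
  "alpha1 (l1, l2, l3) (x1, x2) = l1 * (1 - x1\<^sup>2)"

fun alpha2 :: "'k::field \<times> 'k \<times> 'k \<Rightarrow> 'k \<times> 'k \<Rightarrow> 'k" where
  "alpha2 (l1, l2, l3) (x1, x2) = l2 * (1 - x2\<^sup>2)"

fun alpha3 :: "'k::field \<times> 'k \<times> 'k \<Rightarrow> 'k \<times> 'k \<Rightarrow> 'k" where
  "alpha3 (l1, l2, l3) (x1, x2) =
    l3 * (1 - x1\<^sup>2 * x2\<^sup>2) - 2 * l1 * l2 * (1 + x2\<^sup>2) * (1 - x1\<^sup>2)"

definition Disc :: "'k::field \<times> 'k \<times> 'k \<Rightarrow> 'k \<times> 'k \<Rightarrow> 'k" where
  "Disc lam \<chi> = (alpha3 lam \<chi>)\<^sup>2 - 4 * (alpha1 lam \<chi>)\<^sup>2 * (alpha2 lam \<chi>)\<^sup>2"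

definition chars1 :: "nat \<Rightarrow> nat \<Rightarrow> 'k::field \<times> 'k \<times> 'k \<Rightarrow> ('k \<times> 'k) set" where
  "chars1 N M lam =
    {\<chi> \<in> chars N M. alpha1 lam \<chi> = 0 \<and> alpha2 lam \<chi> = 0 \<and> alpha3 lam \<chi> = 0}"

definition chars2 :: "nat \<Rightarrow> nat \<Rightarrow> 'k::field \<times> 'k \<times> 'k \<Rightarrow> ('k \<times> 'k) set" where
  "chars2 N M lam =
    {\<chi> \<in> chars N M. alpha3 lam \<chi> = 0 \<and> (alpha1 lam \<chi> \<noteq> 0) \<noteq> (alpha2 lam \<chi> \<noteq> 0)}"

definition chars4 :: "nat \<Rightarrow> nat \<Rightarrow> 'k::field \<times> 'k \<times> 'k \<Rightarrow> ('k \<times> 'k) set" where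
  "chars4 N M lam = chars N M - (chars1 N M lam \<union> chars2 N M lam)"

definition L4_root :: "'k::field \<times> 'k \<times> 'k \<Rightarrow> 'k \<times> 'k \<Rightarrow> 'k \<Rightarrow> bool" where
  "L4_root lam \<chi> x \<longleftrightarrow>
    (alpha1 lam \<chi>)\<^sup>2 * alpha2 lam \<chi> * x\<^sup>2 - alpha3 lam \<chi> * x + alpha2 lam \<chi> = 0"


section \<open>The simple modules\<close>

text \<open>The module \<open>L\<close> is described, up to isomorphism, by a basis and the action of the generators
  on it: \<open>is_L \<dots> V\<close> says that \<open>V\<close> is an \<open>H\<^sub>\<lambda>\<close>-module having such a basis.\<close>

definition is_H_basis ::
    "nat \<Rightarrow> nat \<Rightarrow> 'k::field \<times> 'k \<times> 'k \<Rightarrow> ('k free_alg set, 'v) module \<Rightarrow> 'v list \<Rightarrow> bool" where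
  "is_H_basis N M lam V vs \<longleftrightarrow>
    distinct vs \<and> vectorspace.basis class_ring (restrict_scalars (H_const N M lam) V) (set vs)"

definition is_type ::
    "nat \<Rightarrow> nat \<Rightarrow> 'k::field \<times> 'k \<times> 'k \<Rightarrow> ('k free_alg set, 'v) module \<Rightarrow> 'k \<times> 'k \<Rightarrow> 'v \<Rightarrow> bool" where
  "is_type N M lam V \<chi> v \<longleftrightarrow> v \<in> carrier V \<and>
    H_gen N M lam G1 \<odot>\<^bsub>V\<^esub> v = H_const N M lam (fst \<chi>) \<odot>\<^bsub>V\<^esub> v \<and>
    H_gen N M lam G2 \<odot>\<^bsub>V\<^esub> v = H_const N M lam (snd \<chi>) \<odot>\<^bsub>V\<^esub> v"

definition is_L1 ::
    "nat \<Rightarrow> nat \<Rightarrow> 'k::field \<times> 'k \<times> 'k \<Rightarrow> 'k \<times> 'k \<Rightarrow> ('k free_alg set, 'v) module \<Rightarrow> bool" where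
  "is_L1 N M lam \<chi> V \<longleftrightarrow> left_module (H_alg N M lam) V \<and>
    (\<exists>v. is_H_basis N M lam V [v] \<and> is_type N M lam V \<chi> v \<and>
      H_gen N M lam A1 \<odot>\<^bsub>V\<^esub> v = \<zero>\<^bsub>V\<^esub> \<and>
      H_gen N M lam A2 \<odot>\<^bsub>V\<^esub> v = \<zero>\<^bsub>V\<^esub>)"

definition is_L2h ::
    "nat \<Rightarrow> nat \<Rightarrow> 'k::field \<times> 'k \<times> 'k \<Rightarrow> 'k \<times> 'k \<Rightarrow> ('k free_alg set, 'v) module \<Rightarrow> bool" where
  "is_L2h N M lam \<chi> V \<longleftrightarrow> left_module (H_alg N M lam) V \<and>
    (\<exists>v w. is_H_basis N M lam V [v, w] \<and>
      is_type N M lam V \<chi> v \<and> is_type N M lam V (chi_bar \<chi>) w \<and>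
      H_gen N M lam A1 \<odot>\<^bsub>V\<^esub> v = w \<and>
      H_gen N M lam A1 \<odot>\<^bsub>V\<^esub> w = H_const N M lam (alpha1 lam \<chi>) \<odot>\<^bsub>V\<^esub> v \<and>
      (\<forall>x\<in>carrier V. H_gen N M lam A2 \<odot>\<^bsub>V\<^esub> x = \<zero>\<^bsub>V\<^esub>))"

definition is_L2v ::
    "nat \<Rightarrow> nat \<Rightarrow> 'k::field \<times> 'k \<times> 'k \<Rightarrow> 'k \<times> 'k \<Rightarrow> ('k free_alg set, 'v) module \<Rightarrow> bool" where
  "is_L2v N M lam \<chi> V \<longleftrightarrow> left_module (H_alg N M lam) V \<and>
    (\<exists>v w. is_H_basis N M lam V [v, w] \<and>
      is_type N M lam V \<chi> v \<and> is_type N M lam V (chi_neg \<chi>) w \<and>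
      H_gen N M lam A2 \<odot>\<^bsub>V\<^esub> v = w \<and>
      H_gen N M lam A2 \<odot>\<^bsub>V\<^esub> w = H_const N M lam (alpha2 lam \<chi>) \<odot>\<^bsub>V\<^esub> v \<and>
      (\<forall>x\<in>carrier V. H_gen N M lam A1 \<odot>\<^bsub>V\<^esub> x = \<zero>\<^bsub>V\<^esub>))"

definition is_L4 ::
    "nat \<Rightarrow> nat \<Rightarrow> 'k::field \<times> 'k \<times> 'k \<Rightarrow> 'k \<times> 'k \<Rightarrow> 'k \<Rightarrow> ('k free_alg set, 'v) module \<Rightarrow> bool" where
  "is_L4 N M lam \<chi> d V \<longleftrightarrow> left_module (H_alg N M lam) V \<and>
    (let a1 = (\<lambda>x. H_gen N M lam A1 \<odot>\<^bsub>V\<^esub> x);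
         a2 = (\<lambda>x. H_gen N M lam A2 \<odot>\<^bsub>V\<^esub> x);
         sc = (\<lambda>t x. H_const N M lam t \<odot>\<^bsub>V\<^esub> x);
         \<alpha>1 = alpha1 lam \<chi>; \<alpha>2 = alpha2 lam \<chi>; \<alpha>3 = alpha3 lam \<chi>;
         c = \<alpha>3 - \<alpha>1\<^sup>2 * \<alpha>2 * d
     in \<exists>v1 v2 v3 v4. is_H_basis N M lam V [v1, v2, v3, v4] \<and>
      is_type N M lam V \<chi> v1 \<and> is_type N M lam V (chi_bar \<chi>) v2 \<and>
      is_type N M lam V (chi_neg (chi_bar \<chi>)) v3 \<and> is_type N M lam V (chi_neg \<chi>) v4 \<and>
      a1 v1 = v2 \<and> a1 v2 = sc \<alpha>1 v1 \<and> a1 v3 = v4 \<and> a1 v4 = sc \<alpha>1 v3 \<and>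
      a2 v1 = sc d v4 \<and> a2 v4 = sc c v1 \<and> a2 v2 = v3 \<and> a2 v3 = sc \<alpha>2 v2)"

end

theory Submission
  imports Defs "HOL-Library.Product_Plus"
begin

text \<open>A cocycle on the standard resolution of \<open>V\<close> is a homomorphism to \<open>W\<close> on the kernel of
  \<open>F\<^sub>0 \<rightarrow> V\<close>. Comparing it with a linear section of \<open>F\<^sub>0 \<rightarrow> V\<close> turns \<open>Ext\<^sup>1(V, W)\<close> into the space of
  off-diagonal blocks \<open>D\<close> for which \<open>(B, D; 0, A)\<close> satisfies the defining relations, modulo the
  inner ones \<open>D = T A - B T\<close>, where \<open>A\<close> and \<open>B\<close> are the actions of the generators on \<open>V\<close> and \<open>W\<close>.

  Since \<open>\<Gamma>\<close> is finite and the characteristic is zero, a generating vector \<open>v\<close> of \<open>V\<close> of type \<open>\<phi>\<close> lifts to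
  a vector \<open>u\<close> of type \<open>\<phi>\<close> in the extension, which splits if and only if \<open>u\<close> can be chosen to satisfy the
  relations of \<open>v\<close>. For one- and two-dimensional \<open>V\<close> the obstructions are the vectors of \<open>W\<close> to
  which the lifted basis vectors are sent by those \<open>a\<^sub>i\<close> that vanish on \<open>V\<close>; their types decide
  whether they are zero. The module \<open>L\<^sub>4\<^sup>\<phi>(e)\<close> is generated by \<open>v\<close> with the single relation \<open>P v = 0\<close>
  for \<open>P = a\<^sub>2 - e a\<^sub>1 a\<^sub>2 a\<^sub>1\<close>, and \<open>P\<^sup>2 = 0\<close> on vectors of type \<open>\<plusminus>\<phi>\<close>. So \<open>Ext\<^sup>1\<close> is the homology of \<open>P\<close> on the one-dimensional spaces of
  type \<open>\<plusminus>\<phi>\<close> of \<open>W\<close>: it is zero if \<open>P \<noteq> 0\<close> there, which is the case \<open>D(\<chi>) \<noteq> 0\<close>, and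
  one-dimensional if \<open>P = 0\<close>.\<close>

text \<open>\<open>P^2 = 0\<close> comes from the quartic relation: on vectors of type
  \<plusminus>\<phi> the operator \<open>P^2\<close> is the scalar
  \<open>alpha2 - e * alpha3 + e^2 * alpha1^2 * alpha2\<close>, and \<open>e\<close> is a root of
  exactly this quadratic. In the basis of \<open>W\<close> the operator \<open>P\<close> has four
  entries, one for each ordered pair of opposite types. When \<open>d = e\<close>, the entry from
  -\<chi> to \<chi> is up to sign the derivative of the quadratic at \<open>d\<close>, and its
  square is the discriminant. This is how \<open>Disc\<close> decides between the two cases.

  The obstacle is that \<open>V\<close> and \<open>W\<close> live on arbitrary carriers and
  \<open>ext1\<close> on functions over functions on them, where no matrix can be written down. Both
  modules are therefore modelled on powers of the field with explicit operators. A cocycle is turned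
  into matrices by measuring how far a linear section is from being \<open>H\<close>-linear. This
  defect obeys a Leibniz rule, so its values on the four generators determine it. In the other
  direction, a block satisfying the relations makes pairs \<open>(w, v)\<close> into an
  \<open>H\<close>-module, and freeness of \<open>F\<^sub>0\<close> gives a map into it that
  restricts to the wanted cocycle.\<close>

hide_const (open) Modules.module_hom
hide_fact (open) Modules.module_hom_def

section \<open>Dimension of a quotient space\<close>

text \<open>The bijection also supplies the vector space axioms: each is pulled back to
  \<open>carrier_vec n\<close>, so \<open>Q\<close>, a bare record of cosets in the application,
  need not be known to be a vector space beforehand.\<close>

lemma has_dim_if_coordinates:
  fixes Q :: "('k::field, 'v, 'c) module_scheme"
  assumes bij: "bij_betw T (carrier_vec n) (carrier Q)"
    and add: "\<And>x y. \<lbrakk>x \<in> carrier_vec n; y \<in> carrier_vec n\<rbrakk> \<Longrightarrow> T (x + y) = T x \<oplus>\<^bsub>Q\<^esub> T y"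
    and smult: "\<And>c x. x \<in> carrier_vec n \<Longrightarrow> T (c \<cdot>\<^sub>v x) = c \<odot>\<^bsub>Q\<^esub> T x"
    and zero: "T (0\<^sub>v n) = \<zero>\<^bsub>Q\<^esub>"
  shows "has_dim Q n"
proof -
  interpret U: vec_space "TYPE('k)" n .
  have Tcl: "T x \<in> carrier Q" if "x \<in> carrier_vec n" for x
    using bij that by (auto simp: bij_betw_def)
  have surj: "\<exists>x\<in>carrier_vec n. v = T x" if "v \<in> carrier Q" for v
    using bij that by (auto simp: bij_betw_def)
  have vs: "vectorspace class_ring Q"
  proof (rule vs_criteria)
    show "field (class_ring :: 'k ring)" by (rule class_field)
    show "\<zero>\<^bsub>Q\<^esub> \<in> carrier Q" using Tcl[of "0\<^sub>v n"] zero by simp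
    show "\<forall>v w. v \<in> carrier Q \<and> w \<in> carrier Q \<longrightarrow> v \<oplus>\<^bsub>Q\<^esub> w \<in> carrier Q"
    proof clarify
      fix v w assume "v \<in> carrier Q" "w \<in> carrier Q"
      then obtain x y where "x \<in> carrier_vec n" "y \<in> carrier_vec n" "v = T x" "w = T y"
        using surj by metis
      then show "v \<oplus>\<^bsub>Q\<^esub> w \<in> carrier Q" using Tcl[of "x + y"] by (simp add: add)
    qed
    show "\<forall>v\<in>carrier Q. \<exists>neg_v\<in>carrier Q. v \<oplus>\<^bsub>Q\<^esub> neg_v = \<zero>\<^bsub>Q\<^esub>"
    proof
      fix v assume "v \<in> carrier Q"
      then obtain x where x: "x \<in> carrier_vec n" "v = T x" using surj by metis
      have "v \<oplus>\<^bsub>Q\<^esub> T (- x) = \<zero>\<^bsub>Q\<^esub>"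
        using x add[of x "- x"] zero by simp
      then show "\<exists>neg_v\<in>carrier Q. v \<oplus>\<^bsub>Q\<^esub> neg_v = \<zero>\<^bsub>Q\<^esub>"
        using Tcl[of "- x"] x by auto
    qed
    show "\<forall>c v. c \<in> carrier class_ring \<and> v \<in> carrier Q \<longrightarrow> c \<odot>\<^bsub>Q\<^esub> v \<in> carrier Q"
      using surj smult Tcl by (metis smult_carrier_vec)
    show "\<forall>v w. v \<in> carrier Q \<and> w \<in> carrier Q \<longrightarrow> v \<oplus>\<^bsub>Q\<^esub> w = w \<oplus>\<^bsub>Q\<^esub> v"
      using surj add by (metis comm_add_vec)
    show "\<forall>v w x. v \<in> carrier Q \<and> w \<in> carrier Q \<and> x \<in> carrier Q \<longrightarrow>
      v \<oplus>\<^bsub>Q\<^esub> w \<oplus>\<^bsub>Q\<^esub> x = v \<oplus>\<^bsub>Q\<^esub> (w \<oplus>\<^bsub>Q\<^esub> x)"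
      using surj add by (smt (verit) assoc_add_vec add_carrier_vec)
    show "\<forall>v\<in>carrier Q. v \<oplus>\<^bsub>Q\<^esub> \<zero>\<^bsub>Q\<^esub> = v"
      using surj add zero by (metis right_zero_vec zero_carrier_vec)
    show "\<forall>a b v. a \<in> carrier class_ring \<and> b \<in> carrier class_ring \<and> v \<in> carrier Q \<longrightarrow>
      (a \<otimes>\<^bsub>class_ring\<^esub> b) \<odot>\<^bsub>Q\<^esub> v = a \<odot>\<^bsub>Q\<^esub> (b \<odot>\<^bsub>Q\<^esub> v)"
      using surj smult by (simp, metis smult_carrier_vec smult_smult_assoc)
    show "\<forall>v\<in>carrier Q. \<one>\<^bsub>class_ring\<^esub> \<odot>\<^bsub>Q\<^esub> v = v"
      using surj smult by (simp, metis one_smult_vec)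
    show "\<forall>a b v. a \<in> carrier class_ring \<and> b \<in> carrier class_ring \<and> v \<in> carrier Q \<longrightarrow>
      (a \<oplus>\<^bsub>class_ring\<^esub> b) \<odot>\<^bsub>Q\<^esub> v = a \<odot>\<^bsub>Q\<^esub> v \<oplus>\<^bsub>Q\<^esub> b \<odot>\<^bsub>Q\<^esub> v"
      using surj smult add by (simp, metis smult_carrier_vec add_smult_distrib_vec)
    show "\<forall>a v w. a \<in> carrier class_ring \<and> v \<in> carrier Q \<and> w \<in> carrier Q \<longrightarrow>
      a \<odot>\<^bsub>Q\<^esub> (v \<oplus>\<^bsub>Q\<^esub> w) = a \<odot>\<^bsub>Q\<^esub> v \<oplus>\<^bsub>Q\<^esub> a \<odot>\<^bsub>Q\<^esub> w"
    proof clarify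
      fix a :: 'k and v w assume "v \<in> carrier Q" "w \<in> carrier Q"
      then obtain x y where xy: "x \<in> carrier_vec n" "y \<in> carrier_vec n" "v = T x" "w = T y"
        using surj by metis
      then show "a \<odot>\<^bsub>Q\<^esub> (v \<oplus>\<^bsub>Q\<^esub> w) = a \<odot>\<^bsub>Q\<^esub> v \<oplus>\<^bsub>Q\<^esub> a \<odot>\<^bsub>Q\<^esub> w"
        by (simp flip: add smult add: smult_add_distrib_vec[of _ n])
    qed
  qed
  interpret Q: vectorspace class_ring Q by (rule vs)
  have lin: "linear_map class_ring (module_vec TYPE('k) n) Q T"
    unfolding linear_map_def mod_hom_def mod_hom_axioms_def module_hom_def
    using vs U.vectorspace_axioms Q.module_axioms U.module_axioms
    by (auto simp: Tcl add smult module_vec_simps)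
  interpret linear_map class_ring "module_vec TYPE('k) n" Q T by (rule lin)
  have im: "T ` carrier (module_vec TYPE('k) n) = carrier Q"
    and inj: "inj_on T (carrier (module_vec TYPE('k) n))"
    using bij by (auto simp: bij_betw_def module_vec_simps)
  have "Q.fin_dim" by (rule rank_nullity_main(2)[OF U.fin_dim im])
  moreover have "Q.dim = n" using dim_eq[OF U.fin_dim inj im] U.dim_is_n by simp
  ultimately show ?thesis unfolding has_dim_def using vs by simp
qed

text \<open>First isomorphism theorem: the cosets of the kernel \<open>W\<close> are the fibres of
  \<open>\<Phi>\<close>, so fibres are the inverse of the induced isomorphism. All laws for scalars
  are read off in \<open>carrier_vec n\<close>.\<close>

lemma has_dim_quotient_space:
  fixes V :: "('k::field, 'v, 'c) module_scheme" and \<Phi> :: "'v \<Rightarrow> 'k vec"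
  assumes "abelian_group V"
    and scl: "\<And>c v. v \<in> carrier V \<Longrightarrow> c \<odot>\<^bsub>V\<^esub> v \<in> carrier V"
    and \<Phi>_add: "\<And>v w. \<lbrakk>v \<in> carrier V; w \<in> carrier V\<rbrakk> \<Longrightarrow> \<Phi> (v \<oplus>\<^bsub>V\<^esub> w) = \<Phi> v + \<Phi> w"
    and \<Phi>_smult: "\<And>c v. v \<in> carrier V \<Longrightarrow> \<Phi> (c \<odot>\<^bsub>V\<^esub> v) = c \<cdot>\<^sub>v \<Phi> v"
    and \<Phi>_onto: "\<Phi> ` carrier V = carrier_vec n"
    and W: "W = {v \<in> carrier V. \<Phi> v = 0\<^sub>v n}"
  shows "has_dim (quotient_space V W) n"
proof -
  interpret V: abelian_group V by fact
  have \<Phi>_cl: "\<Phi> v \<in> carrier_vec n" if "v \<in> carrier V" for v using \<Phi>_onto that by auto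
  have \<Phi>_0: "\<Phi> \<zero>\<^bsub>V\<^esub> = 0\<^sub>v n"
  proof -
    define z where "z = \<Phi> \<zero>\<^bsub>V\<^esub>"
    have z: "z \<in> carrier_vec n" and zz: "z + z = z"
      using \<Phi>_add[of "\<zero>\<^bsub>V\<^esub>" "\<zero>\<^bsub>V\<^esub>"] \<Phi>_cl[of "\<zero>\<^bsub>V\<^esub>"] by (simp_all add: z_def)
    have "z $ i = 0" if "i < n" for i
      using arg_cong[OF zz, of "\<lambda>v. v $ i"] z that
      by (metis add_cancel_left_left carrier_vecD index_add_vec(1))
    then show ?thesis using z by (auto simp: z_def intro!: eq_vecI)
  qed
  have \<Phi>_diff: "\<Phi> (u \<ominus>\<^bsub>V\<^esub> v) = \<Phi> u - \<Phi> v" if "u \<in> carrier V" "v \<in> carrier V" for u v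
  proof -
    have "\<Phi> (u \<ominus>\<^bsub>V\<^esub> v) + \<Phi> v = \<Phi> u"
      using that \<Phi>_add[of "u \<ominus>\<^bsub>V\<^esub> v" v] by (simp add: a_minus_def V.a_assoc V.l_neg)
    then show ?thesis
      using that \<Phi>_cl[of v] \<Phi>_cl[of "u \<ominus>\<^bsub>V\<^esub> v"]
      by (auto simp: V.minus_closed simp flip: \<open>_ + \<Phi> v = \<Phi> u\<close> intro!: eq_vecI)
  qed
  define T where "T x = {v \<in> carrier V. \<Phi> v = x}" for x
  have coset: "W +>\<^bsub>V\<^esub> v = T (\<Phi> v)" if v: "v \<in> carrier V" for v
  proof -
    have "W +>\<^bsub>V\<^esub> v \<subseteq> T (\<Phi> v)"
      using v \<Phi>_cl by (auto simp: W T_def a_r_coset_def' \<Phi>_add)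
    moreover have "u \<in> W +>\<^bsub>V\<^esub> v" if u: "u \<in> T (\<Phi> v)" for u
    proof -
      have "u \<ominus>\<^bsub>V\<^esub> v \<in> W"
        using u v \<Phi>_cl[OF v] by (auto simp: W T_def \<Phi>_diff V.minus_closed)
      moreover have "u = (u \<ominus>\<^bsub>V\<^esub> v) \<oplus>\<^bsub>V\<^esub> v"
        using u v by (auto simp: T_def a_minus_def V.a_assoc V.l_neg)
      ultimately show ?thesis by (auto simp: a_r_coset_def')
    qed
    ultimately show ?thesis by auto
  qed
  have ex: "\<exists>v\<in>carrier V. \<Phi> v = x" if "x \<in> carrier_vec n" for x using \<Phi>_onto that by (metis image_iff)
  have car: "carrier (quotient_space V W) = T ` carrier_vec n"
    unfolding quotient_space_def A_RCOSETS_def'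
    using coset ex \<Phi>_cl by auto force
  have inj: "inj_on T (carrier_vec n)"
    by (rule inj_onI) (use ex in \<open>force simp: T_def\<close>)
  show ?thesis
  proof (rule has_dim_if_coordinates[of T])
    show "bij_betw T (carrier_vec n) (carrier (quotient_space V W))"
      unfolding bij_betw_def using inj car by simp
    show "T (0\<^sub>v n) = \<zero>\<^bsub>quotient_space V W\<^esub>" by (simp add: quotient_space_def T_def W)
    fix x y :: "'k vec" assume x: "x \<in> carrier_vec n" and y: "y \<in> carrier_vec n"
    have "T x <+>\<^bsub>V\<^esub> T y = T (x + y)"
    proof
      show "T x <+>\<^bsub>V\<^esub> T y \<subseteq> T (x + y)" by (auto simp: T_def set_add_def' \<Phi>_add)
      show "T (x + y) \<subseteq> T x <+>\<^bsub>V\<^esub> T y"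
      proof
        fix u assume u: "u \<in> T (x + y)"
        obtain v where v: "v \<in> carrier V" "\<Phi> v = y" using ex y by auto
        have "\<Phi> u - \<Phi> v = x" using u v x y by (auto simp: T_def)
        then have "u \<ominus>\<^bsub>V\<^esub> v \<in> T x" using u v by (simp add: T_def \<Phi>_diff V.minus_closed)
        moreover have "u = (u \<ominus>\<^bsub>V\<^esub> v) \<oplus>\<^bsub>V\<^esub> v"
          using u v by (simp add: T_def a_minus_def V.a_assoc V.l_neg)
        ultimately show "u \<in> T x <+>\<^bsub>V\<^esub> T y" using v by (auto simp: set_add_def' T_def)
      qed
    qed
    then show "T (x + y) = T x \<oplus>\<^bsub>quotient_space V W\<^esub> T y" by (simp add: quotient_space_def)
  next
    fix c :: 'k and x :: "'k vec" assume x: "x \<in> carrier_vec n"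
    \<comment> \<open>All members of the union are one and the same fibre, and there is at least one
      because \<open>\<Phi>\<close> is onto.\<close>
    have "(\<Union>v\<in>T x. W +>\<^bsub>V\<^esub> (c \<odot>\<^bsub>V\<^esub> v)) = (\<Union>v\<in>T x. T (c \<cdot>\<^sub>v x))"
      by (rule SUP_cong) (auto simp: T_def coset[unfolded T_def] scl \<Phi>_smult)
    also have "\<dots> = T (c \<cdot>\<^sub>v x)" using ex[OF x] by (auto simp: T_def)
    finally show "T (c \<cdot>\<^sub>v x) = c \<odot>\<^bsub>quotient_space V W\<^esub> T x" by (simp add: quotient_space_def)
  qed
qed

section \<open>Free modules\<close>

context left_module
begin

lemma smult_l_null: "x \<in> carrier M \<Longrightarrow> \<zero>\<^bsub>R\<^esub> \<odot>\<^bsub>M\<^esub> x = \<zero>\<^bsub>M\<^esub>"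
  using smult_l_distr[of "\<zero>\<^bsub>R\<^esub>" "\<zero>\<^bsub>R\<^esub>" x] smult_closed[of "\<zero>\<^bsub>R\<^esub>" x]
  by (metis M.add.r_cancel_one' R.l_zero R.zero_closed)

lemma smult_r_null: "a \<in> carrier R \<Longrightarrow> a \<odot>\<^bsub>M\<^esub> \<zero>\<^bsub>M\<^esub> = \<zero>\<^bsub>M\<^esub>"
  using smult_r_distr[of a "\<zero>\<^bsub>M\<^esub>" "\<zero>\<^bsub>M\<^esub>"] smult_closed[of a "\<zero>\<^bsub>M\<^esub>"]
  by (metis M.add.r_cancel_one' M.l_zero M.zero_closed)

lemma smult_r_minus:
  assumes "a \<in> carrier R" "x \<in> carrier M"
  shows "a \<odot>\<^bsub>M\<^esub> (\<ominus>\<^bsub>M\<^esub> x) = \<ominus>\<^bsub>M\<^esub> (a \<odot>\<^bsub>M\<^esub> x)"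
proof (rule M.minus_equality[symmetric])
  have "a \<odot>\<^bsub>M\<^esub> (\<ominus>\<^bsub>M\<^esub> x) \<oplus>\<^bsub>M\<^esub> a \<odot>\<^bsub>M\<^esub> x = a \<odot>\<^bsub>M\<^esub> (\<ominus>\<^bsub>M\<^esub> x \<oplus>\<^bsub>M\<^esub> x)"
    using assms by (simp add: smult_r_distr)
  then show "a \<odot>\<^bsub>M\<^esub> (\<ominus>\<^bsub>M\<^esub> x) \<oplus>\<^bsub>M\<^esub> a \<odot>\<^bsub>M\<^esub> x = \<zero>\<^bsub>M\<^esub>"
    using assms by (simp add: M.l_neg smult_r_null)
qed (use assms in \<open>auto intro: smult_closed\<close>)

lemma smult_finsum:
  assumes "a \<in> carrier R" "f \<in> A \<rightarrow> carrier M"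
  shows "a \<odot>\<^bsub>M\<^esub> (\<Oplus>\<^bsub>M\<^esub>i\<in>A. f i) = (\<Oplus>\<^bsub>M\<^esub>i\<in>A. a \<odot>\<^bsub>M\<^esub> f i)"
  using assms(2)
proof (induct A rule: infinite_finite_induct)
  case (insert x A)
  then have "f x \<in> carrier M" "f \<in> A \<rightarrow> carrier M" by auto
  then show ?case using insert assms(1)
    by (simp add: smult_r_distr smult_closed Pi_iff)
qed (use assms(1) in \<open>simp_all add: smult_r_null\<close>)

end

context ring
begin

lemma free_module_simps:
  "carrier (free_module R S) = {f \<in> S \<rightarrow>\<^sub>E carrier R. finite {s \<in> S. f s \<noteq> \<zero>}}"
  "\<zero>\<^bsub>free_module R S\<^esub> = (\<lambda>s\<in>S. \<zero>)"
  "f \<oplus>\<^bsub>free_module R S\<^esub> g = (\<lambda>s\<in>S. f s \<oplus> g s)"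
  "r \<odot>\<^bsub>free_module R S\<^esub> f = (\<lambda>s\<in>S. r \<otimes> f s)"
  by (simp_all add: free_module_def)

lemma free_module_val: "\<lbrakk>f \<in> carrier (free_module R S); s \<in> S\<rbrakk> \<Longrightarrow> f s \<in> carrier R"
  by (auto simp: free_module_simps)

lemma left_module_free: "left_module R (free_module R S)"
proof -
  have add_cl: "f \<oplus>\<^bsub>free_module R S\<^esub> g \<in> carrier (free_module R S)"
    if "f \<in> carrier (free_module R S)" "g \<in> carrier (free_module R S)" for f g
  proof -
    have "finite ({s \<in> S. f s \<noteq> \<zero>} \<union> {s \<in> S. g s \<noteq> \<zero>})"
      using that by (auto simp: free_module_simps)
    then have "finite {s \<in> S. f s \<oplus> g s \<noteq> \<zero>}" by (rule rev_finite_subset) auto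
    then show ?thesis using that by (auto simp: free_module_simps cong: conj_cong)
  qed
  have neg: "\<exists>g\<in>carrier (free_module R S). g \<oplus>\<^bsub>free_module R S\<^esub> f = \<zero>\<^bsub>free_module R S\<^esub>"
    if "f \<in> carrier (free_module R S)" for f
  proof
    have "{s \<in> S. \<ominus> f s \<noteq> \<zero>} \<subseteq> {s \<in> S. f s \<noteq> \<zero>}" by auto
    then have "finite {s \<in> S. \<ominus> f s \<noteq> \<zero>}"
      using that by (auto simp: free_module_simps intro: rev_finite_subset)
    then show "(\<lambda>s\<in>S. \<ominus> f s) \<in> carrier (free_module R S)"
      using that by (auto simp: free_module_simps cong: conj_cong)
    show "(\<lambda>s\<in>S. \<ominus> f s) \<oplus>\<^bsub>free_module R S\<^esub> f = \<zero>\<^bsub>free_module R S\<^esub>"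
      using free_module_val[OF that] by (simp add: free_module_simps l_neg cong: restrict_cong)
  qed
  have smult_cl: "r \<odot>\<^bsub>free_module R S\<^esub> f \<in> carrier (free_module R S)"
    if "r \<in> carrier R" "f \<in> carrier (free_module R S)" for r f
  proof -
    have "{s \<in> S. r \<otimes> f s \<noteq> \<zero>} \<subseteq> {s \<in> S. f s \<noteq> \<zero>}" using that by auto
    then have "finite {s \<in> S. r \<otimes> f s \<noteq> \<zero>}"
      using that by (auto simp: free_module_simps intro: rev_finite_subset)
    then show ?thesis using that by (auto simp: free_module_simps cong: conj_cong)
  qed
  have "abelian_group (free_module R S)"
  proof (rule abelian_groupI)
    fix f g assume f: "f \<in> carrier (free_module R S)" and g: "g \<in> carrier (free_module R S)"
    show "f \<oplus>\<^bsub>free_module R S\<^esub> g = g \<oplus>\<^bsub>free_module R S\<^esub> f"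
      using free_module_val[OF f] free_module_val[OF g] by (simp add: free_module_simps a_comm cong: restrict_cong)
    fix h assume h: "h \<in> carrier (free_module R S)"
    show "f \<oplus>\<^bsub>free_module R S\<^esub> g \<oplus>\<^bsub>free_module R S\<^esub> h =
        f \<oplus>\<^bsub>free_module R S\<^esub> (g \<oplus>\<^bsub>free_module R S\<^esub> h)"
      using free_module_val[OF f] free_module_val[OF g] free_module_val[OF h] by (simp add: free_module_simps a_assoc cong: restrict_cong)
  next
    fix f assume f: "f \<in> carrier (free_module R S)"
    show "\<zero>\<^bsub>free_module R S\<^esub> \<oplus>\<^bsub>free_module R S\<^esub> f = f"
      using free_module_val[OF f] f by (intro extensionalityI[of _ S]) (auto simp: free_module_simps PiE_def)
  qed (use add_cl neg in \<open>auto simp: free_module_simps\<close>)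
  then show ?thesis
  proof (intro left_module.intro left_module_axioms.intro)
    fix x assume x: "x \<in> carrier (free_module R S)"
    show "\<one> \<odot>\<^bsub>free_module R S\<^esub> x = x"
      using free_module_val[OF x] x by (intro extensionalityI[of _ S]) (auto simp: free_module_simps PiE_def)
    fix a assume a: "a \<in> carrier R"
    {
      fix y assume y: "y \<in> carrier (free_module R S)"
      show "a \<odot>\<^bsub>free_module R S\<^esub> (x \<oplus>\<^bsub>free_module R S\<^esub> y) =
          a \<odot>\<^bsub>free_module R S\<^esub> x \<oplus>\<^bsub>free_module R S\<^esub> a \<odot>\<^bsub>free_module R S\<^esub> y"
        using a free_module_val[OF x] free_module_val[OF y] by (simp add: free_module_simps r_distr cong: restrict_cong)
    }
    fix b assume b: "b \<in> carrier R"
    show "(a \<oplus> b) \<odot>\<^bsub>free_module R S\<^esub> x = a \<odot>\<^bsub>free_module R S\<^esub> x \<oplus>\<^bsub>free_module R S\<^esub> b \<odot>\<^bsub>free_module R S\<^esub> x"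
      using a b free_module_val[OF x] by (simp add: free_module_simps l_distr cong: restrict_cong)
    show "(a \<otimes> b) \<odot>\<^bsub>free_module R S\<^esub> x = a \<odot>\<^bsub>free_module R S\<^esub> (b \<odot>\<^bsub>free_module R S\<^esub> x)"
      using a b free_module_val[OF x] by (simp add: free_module_simps m_assoc cong: restrict_cong)
  qed (use smult_cl ring_axioms in auto)
qed

definition free_unit :: "'s set \<Rightarrow> 's \<Rightarrow> 's \<Rightarrow> 'a" where
  "free_unit S s = (\<lambda>t\<in>S. if t = s then \<one> else \<zero>)"

lemma free_unit_closed: "s \<in> S \<Longrightarrow> free_unit S s \<in> carrier (free_module R S)"
  by (auto simp: free_unit_def free_module_simps cong: conj_cong intro: rev_finite_subset[of "{s}"])

end

text \<open>The universal property of the free module, for arbitrary values \<open>h\<close> on the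
  basis. \<open>free_map\<close> covers only the inclusion, but maps from \<open>F\<^sub>0\<close>
  into an extension are needed as well.\<close>

definition free_lift ::
    "('r, 'c) ring_scheme \<Rightarrow> ('r, 'm, 'd) module_scheme \<Rightarrow> 's set \<Rightarrow> ('s \<Rightarrow> 'm) \<Rightarrow> ('s \<Rightarrow> 'r) \<Rightarrow> 'm" where
  "free_lift R M S h f = (\<Oplus>\<^bsub>M\<^esub> s \<in> {s \<in> S. f s \<noteq> \<zero>\<^bsub>R\<^esub>}. f s \<odot>\<^bsub>M\<^esub> h s)"

lemma free_map_eq_free_lift: "free_map R M S = free_lift R M S (\<lambda>s. s)"
  by (simp add: free_map_def free_lift_def fun_eq_iff)

context left_module
begin

text \<open>The sum in \<open>free_lift\<close> runs over the support, which changes under addition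
  and scalar multiplication; linearity is proved over a common finite superset.\<close>

lemma free_lift_superset:
  assumes f: "f \<in> carrier (free_module R S)" and h: "h \<in> S \<rightarrow> carrier M"
    and A: "finite A" "A \<subseteq> S" "{s \<in> S. f s \<noteq> \<zero>\<^bsub>R\<^esub>} \<subseteq> A"
  shows "free_lift R M S h f = (\<Oplus>\<^bsub>M\<^esub>s\<in>A. f s \<odot>\<^bsub>M\<^esub> h s)"
  unfolding free_lift_def
proof (rule M.add.finprod_mono_neutral_cong_left)
  show "f i \<odot>\<^bsub>M\<^esub> h i = \<zero>\<^bsub>M\<^esub>" if "i \<in> A - {s \<in> S. f s \<noteq> \<zero>\<^bsub>R\<^esub>}" for i
    using that A h by (auto simp: smult_l_null Pi_iff)
  show "(\<lambda>s. f s \<odot>\<^bsub>M\<^esub> h s) \<in> A \<rightarrow> carrier M"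
    using A h R.free_module_val[OF f] by (auto intro!: smult_closed)
qed (use A in auto)

lemma free_lift_hom:
  assumes h: "h \<in> S \<rightarrow> carrier M"
  shows "free_lift R M S h \<in> module_hom R (free_module R S) M"
proof -
  have val: "f s \<odot>\<^bsub>M\<^esub> h s \<in> carrier M" if "f \<in> carrier (free_module R S)" "s \<in> S" for f s
    using that h R.free_module_val by (auto intro!: smult_closed)
  have cl: "free_lift R M S h f \<in> carrier M" if "f \<in> carrier (free_module R S)" for f
    unfolding free_lift_def using val[OF that] by (auto intro!: M.finsum_closed)
  have fin: "finite {s \<in> S. f s \<noteq> \<zero>\<^bsub>R\<^esub>}" if "f \<in> carrier (free_module R S)" for f
    using that by (simp add: R.free_module_simps)
  interpret F: left_module R "free_module R S" by (rule R.left_module_free)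
  show ?thesis unfolding module_hom_def
  proof (intro CollectI conjI allI impI; (elim conjE)?)
    show "free_lift R M S h \<in> carrier (free_module R S) \<rightarrow> carrier M" using cl by auto
    fix f g assume f: "f \<in> carrier (free_module R S)" and g: "g \<in> carrier (free_module R S)"
    define A where "A = {s \<in> S. f s \<noteq> \<zero>\<^bsub>R\<^esub>} \<union> {s \<in> S. g s \<noteq> \<zero>\<^bsub>R\<^esub>}"
    have A: "finite A" "A \<subseteq> S" "{s \<in> S. f s \<noteq> \<zero>\<^bsub>R\<^esub>} \<subseteq> A" "{s \<in> S. g s \<noteq> \<zero>\<^bsub>R\<^esub>} \<subseteq> A"
      "{s \<in> S. (f \<oplus>\<^bsub>free_module R S\<^esub> g) s \<noteq> \<zero>\<^bsub>R\<^esub>} \<subseteq> A"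
      using fin[OF f] fin[OF g] by (auto simp: A_def R.free_module_simps)
    have "free_lift R M S h (f \<oplus>\<^bsub>free_module R S\<^esub> g) =
        (\<Oplus>\<^bsub>M\<^esub>s\<in>A. (f \<oplus>\<^bsub>free_module R S\<^esub> g) s \<odot>\<^bsub>M\<^esub> h s)"
      by (rule free_lift_superset) (use A f g h in auto)
    also have "\<dots> = (\<Oplus>\<^bsub>M\<^esub>s\<in>A. f s \<odot>\<^bsub>M\<^esub> h s \<oplus>\<^bsub>M\<^esub> g s \<odot>\<^bsub>M\<^esub> h s)"
    proof (rule M.finsum_cong')
      fix s assume "s \<in> A"
      then have "s \<in> S" using A by auto
      then show "(f \<oplus>\<^bsub>free_module R S\<^esub> g) s \<odot>\<^bsub>M\<^esub> h s = f s \<odot>\<^bsub>M\<^esub> h s \<oplus>\<^bsub>M\<^esub> g s \<odot>\<^bsub>M\<^esub> h s"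
        using R.free_module_val[OF f] R.free_module_val[OF g] h
        by (auto simp: R.free_module_simps intro!: smult_l_distr)
    qed (use A f g val in auto)
    also have "\<dots> = (\<Oplus>\<^bsub>M\<^esub>s\<in>A. f s \<odot>\<^bsub>M\<^esub> h s) \<oplus>\<^bsub>M\<^esub> (\<Oplus>\<^bsub>M\<^esub>s\<in>A. g s \<odot>\<^bsub>M\<^esub> h s)"
      by (rule M.finsum_addf) (use A f g val in auto)
    also have "\<dots> = free_lift R M S h f \<oplus>\<^bsub>M\<^esub> free_lift R M S h g"
      using free_lift_superset[OF f h A(1,2,3)] free_lift_superset[OF g h A(1,2,4)] by simp
    finally show "free_lift R M S h (f \<oplus>\<^bsub>free_module R S\<^esub> g) = free_lift R M S h f \<oplus>\<^bsub>M\<^esub> free_lift R M S h g" .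
  next
    fix r f assume r: "r \<in> carrier R" and f: "f \<in> carrier (free_module R S)"
    define A where "A = {s \<in> S. f s \<noteq> \<zero>\<^bsub>R\<^esub>}"
    have A: "finite A" "A \<subseteq> S" "{s \<in> S. f s \<noteq> \<zero>\<^bsub>R\<^esub>} \<subseteq> A"
      "{s \<in> S. (r \<odot>\<^bsub>free_module R S\<^esub> f) s \<noteq> \<zero>\<^bsub>R\<^esub>} \<subseteq> A"
      using fin[OF f] r by (auto simp: A_def R.free_module_simps)
    have "free_lift R M S h (r \<odot>\<^bsub>free_module R S\<^esub> f) =
        (\<Oplus>\<^bsub>M\<^esub>s\<in>A. (r \<odot>\<^bsub>free_module R S\<^esub> f) s \<odot>\<^bsub>M\<^esub> h s)"
      by (rule free_lift_superset) (use A f r h F.smult_closed in auto)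
    also have "\<dots> = (\<Oplus>\<^bsub>M\<^esub>s\<in>A. r \<odot>\<^bsub>M\<^esub> (f s \<odot>\<^bsub>M\<^esub> h s))"
    proof (rule M.finsum_cong')
      fix s assume "s \<in> A"
      then have "s \<in> S" using A by auto
      then show "(r \<odot>\<^bsub>free_module R S\<^esub> f) s \<odot>\<^bsub>M\<^esub> h s = r \<odot>\<^bsub>M\<^esub> (f s \<odot>\<^bsub>M\<^esub> h s)"
        using R.free_module_val[OF f] r h
        by (auto simp: R.free_module_simps intro!: smult_assoc)
    qed (use A in \<open>auto intro: smult_closed[OF r] val[OF f]\<close>)
    also have "\<dots> = r \<odot>\<^bsub>M\<^esub> (\<Oplus>\<^bsub>M\<^esub>s\<in>A. f s \<odot>\<^bsub>M\<^esub> h s)"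
      by (rule smult_finsum[symmetric]) (use A f r val in auto)
    also have "\<dots> = r \<odot>\<^bsub>M\<^esub> free_lift R M S h f"
      using free_lift_superset[OF f h A(1,2,3)] by simp
    finally show "free_lift R M S h (r \<odot>\<^bsub>free_module R S\<^esub> f) = r \<odot>\<^bsub>M\<^esub> free_lift R M S h f" .
  qed
qed

lemma free_lift_unit:
  assumes h: "h \<in> S \<rightarrow> carrier M" and s: "s \<in> S"
  shows "free_lift R M S h (R.free_unit S s) = h s"
proof -
  have "h s \<in> carrier M" using h s by auto
  have "free_lift R M S h (R.free_unit S s) = (\<Oplus>\<^bsub>M\<^esub>t\<in>{s}. R.free_unit S s t \<odot>\<^bsub>M\<^esub> h t)"
    by (rule free_lift_superset) (use h s R.free_unit_closed in \<open>auto simp: R.free_unit_def\<close>)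
  also have "\<dots> = \<one>\<^bsub>R\<^esub> \<odot>\<^bsub>M\<^esub> h s"
    using \<open>h s \<in> carrier M\<close> smult_closed by (simp add: R.free_unit_def s)
  finally show ?thesis using \<open>h s \<in> carrier M\<close> smult_one by simp
qed

end

section \<open>\<open>Ext\<^sup>1\<close> through homomorphisms on the kernel\<close>

lemma (in abelian_group) minus_eq_zeroD:
  assumes "x \<ominus> y = \<zero>" "x \<in> carrier G" "y \<in> carrier G"
  shows "x = y"
  using assms minus_equality[of x "\<ominus> y"] by (simp add: a_minus_def)

locale left_module_hom = M: left_module R M + N: left_module R N
  for R :: "('r, 'c) ring_scheme" and M :: "('r, 'm, 'd) module_scheme" and N :: "('r, 'n, 'e) module_scheme" +
  fixes f assumes hom: "f \<in> module_hom R M N"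
begin

lemma closed: "x \<in> carrier M \<Longrightarrow> f x \<in> carrier N"
  using hom by (auto simp: module_hom_def)

lemma add: "\<lbrakk>x \<in> carrier M; y \<in> carrier M\<rbrakk> \<Longrightarrow> f (x \<oplus>\<^bsub>M\<^esub> y) = f x \<oplus>\<^bsub>N\<^esub> f y"
  using hom by (auto simp: module_hom_def)

lemma smult: "\<lbrakk>a \<in> carrier R; x \<in> carrier M\<rbrakk> \<Longrightarrow> f (a \<odot>\<^bsub>M\<^esub> x) = a \<odot>\<^bsub>N\<^esub> f x"
  using hom by (auto simp: module_hom_def)

lemma zero: "f \<zero>\<^bsub>M\<^esub> = \<zero>\<^bsub>N\<^esub>"
  using add[of "\<zero>\<^bsub>M\<^esub>" "\<zero>\<^bsub>M\<^esub>"] closed[of "\<zero>\<^bsub>M\<^esub>"] by (simp add: N.M.add.r_cancel_one')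

lemma neg: "x \<in> carrier M \<Longrightarrow> f (\<ominus>\<^bsub>M\<^esub> x) = \<ominus>\<^bsub>N\<^esub> f x"
  using add[of "\<ominus>\<^bsub>M\<^esub> x" x] closed
  by (intro N.M.minus_equality[symmetric]) (auto simp: M.M.l_neg zero)

lemma diff: "\<lbrakk>x \<in> carrier M; y \<in> carrier M\<rbrakk> \<Longrightarrow> f (x \<ominus>\<^bsub>M\<^esub> y) = f x \<ominus>\<^bsub>N\<^esub> f y"
  by (simp add: a_minus_def add neg)

lemma left_module_kernel:
  "left_module R (M\<lparr>carrier := {x \<in> carrier M. f x = \<zero>\<^bsub>N\<^esub>}\<rparr>)" (is "left_module R ?K")
proof -
  have "abelian_group ?K"
  proof (rule abelian_groupI)
    fix x assume x: "x \<in> carrier ?K"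
    then have "\<ominus>\<^bsub>M\<^esub> x \<in> carrier ?K" "\<ominus>\<^bsub>M\<^esub> x \<oplus>\<^bsub>M\<^esub> x = \<zero>\<^bsub>M\<^esub>" by (auto simp: neg M.M.l_neg)
    then show "\<exists>y\<in>carrier ?K. y \<oplus>\<^bsub>?K\<^esub> x = \<zero>\<^bsub>?K\<^esub>" by auto
  qed (auto simp: add zero M.M.a_assoc intro: M.M.a_comm)
  then show ?thesis
    by (intro left_module.intro left_module_axioms.intro)
      (auto simp: M.R.ring_axioms smult M.smult_closed M.smult_l_distr M.smult_r_distr
        M.smult_assoc M.smult_one N.smult_r_null)
qed

end

lemma (in left_module) free_map_hom:
  "S \<subseteq> carrier M \<Longrightarrow> free_map R M S \<in> module_hom R (free_module R S) M"
  unfolding free_map_eq_free_lift by (rule free_lift_hom) auto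

lemma (in left_module) free_map_unit:
  "\<lbrakk>S \<subseteq> carrier M; s \<in> S\<rbrakk> \<Longrightarrow> free_map R M S (R.free_unit S s) = s"
  unfolding free_map_eq_free_lift by (rule free_lift_unit) auto

text \<open>This is the easy half of exactness in the resolution: each differential lands in the
  kernel on which its source is free.\<close>

lemma (in left_module) free_map_in_submodule:
  assumes f: "f \<in> carrier (free_module R S)" and S: "S \<subseteq> carrier M"
    and zero: "\<zero>\<^bsub>M\<^esub> \<in> S" and add: "\<And>x y. \<lbrakk>x \<in> S; y \<in> S\<rbrakk> \<Longrightarrow> x \<oplus>\<^bsub>M\<^esub> y \<in> S"
    and smult: "\<And>a x. \<lbrakk>a \<in> carrier R; x \<in> S\<rbrakk> \<Longrightarrow> a \<odot>\<^bsub>M\<^esub> x \<in> S"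
  shows "free_map R M S f \<in> S"
proof -
  have *: "(\<Oplus>\<^bsub>M\<^esub>s\<in>A. f s \<odot>\<^bsub>M\<^esub> s) \<in> S" if "A \<subseteq> S" for A
    using that
  proof (induct A rule: infinite_finite_induct)
    case (insert x A)
    then have "f s \<odot>\<^bsub>M\<^esub> s \<in> S" if "s \<in> insert x A" for s
      using that smult R.free_module_val[OF f] by auto
    moreover from this have "(\<lambda>s. f s \<odot>\<^bsub>M\<^esub> s) \<in> A \<rightarrow> carrier M" "f x \<odot>\<^bsub>M\<^esub> x \<in> carrier M"
      using S by auto
    ultimately show ?case using insert add by simp
  qed (use zero in auto)
  show ?thesis unfolding free_map_def by (rule *) auto
qed

definition kernel_module ::
    "('r, 'c) ring_scheme \<Rightarrow> ('r, 'm, 'd) module_scheme \<Rightarrow> 'm set \<Rightarrow> ('r, 'm \<Rightarrow> 'r) module" where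
  "kernel_module R M S = free_module R S\<lparr>carrier := free_map_ker R M S\<rparr>"

lemma (in left_module) left_module_kernel_module:
  assumes "S \<subseteq> carrier M"
  shows "left_module R (kernel_module R M S)"
proof -
  interpret F: left_module R "free_module R S" by (rule R.left_module_free)
  interpret h: left_module_hom R "free_module R S" M "free_map R M S"
    by unfold_locales (rule free_map_hom[OF assms])
  show ?thesis using h.left_module_kernel by (simp add: kernel_module_def free_map_ker_def)
qed

lemma kernel_module_simps:
  "carrier (kernel_module R M S) = free_map_ker R M S"
  "\<zero>\<^bsub>kernel_module R M S\<^esub> = \<zero>\<^bsub>free_module R S\<^esub>"
  "x \<oplus>\<^bsub>kernel_module R M S\<^esub> y = x \<oplus>\<^bsub>free_module R S\<^esub> y"
  "a \<odot>\<^bsub>kernel_module R M S\<^esub> x = a \<odot>\<^bsub>free_module R S\<^esub> x"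
  by (simp_all add: kernel_module_def)

text \<open>Since \<open>F\<^sub>2 \<rightarrow> F\<^sub>1 \<rightarrow> K\<^sub>0 \<rightarrow> 0\<close> is exact, cocycles on \<open>F\<^sub>1\<close> are homomorphisms on the
  kernel \<open>K\<^sub>0\<close> of \<open>F\<^sub>0 \<rightarrow> M\<close>; the coboundaries among them are those that extend to \<open>F\<^sub>0\<close>.\<close>

theorem has_dim_ext1:
  fixes R :: "('r, 'c) ring_scheme" and M :: "('r, 'm, 'd) module_scheme"
    and N :: "('r, 'n, 'e) module_scheme" and \<eta> :: "'k::field \<Rightarrow> 'r"
    and L :: "(('m \<Rightarrow> 'r) \<Rightarrow> 'n) \<Rightarrow> 'k vec"
  assumes M: "left_module R M" and N: "left_module R N"
    and \<eta>_closed: "\<And>c. \<eta> c \<in> carrier R"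
    and \<eta>_central: "\<And>c r. r \<in> carrier R \<Longrightarrow> \<eta> c \<otimes>\<^bsub>R\<^esub> r = r \<otimes>\<^bsub>R\<^esub> \<eta> c"
  defines "F0 \<equiv> free_module R (carrier M)"
    and "K \<equiv> kernel_module R M (carrier M)"
  assumes L_cong: "\<And>f g. \<lbrakk>f \<in> module_hom R K N; g \<in> module_hom R K N; \<forall>x\<in>carrier K. f x = g x\<rbrakk> \<Longrightarrow> L f = L g"
    and L_add: "\<And>f g. \<lbrakk>f \<in> module_hom R K N; g \<in> module_hom R K N\<rbrakk> \<Longrightarrow> L (\<lambda>x. f x \<oplus>\<^bsub>N\<^esub> g x) = L f + L g"
    and L_smult: "\<And>c f. f \<in> module_hom R K N \<Longrightarrow> L (\<lambda>x. \<eta> c \<odot>\<^bsub>N\<^esub> f x) = c \<cdot>\<^sub>v L f"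
    and L_onto: "L ` module_hom R K N = carrier_vec n"
    and L_ker: "\<And>f. f \<in> module_hom R K N \<Longrightarrow>
      L f = 0\<^sub>v n \<longleftrightarrow> (\<exists>g\<in>module_hom R F0 N. \<forall>x\<in>carrier K. f x = g x)"
  shows "has_dim (ext1 R \<eta> M N) n"
proof -
  interpret M: left_module R M by fact
  interpret N: left_module R N by fact
  interpret F0: left_module R F0 unfolding F0_def by (rule M.R.left_module_free)
  interpret K: left_module R K unfolding K_def by (rule M.left_module_kernel_module) simp
  define K0 where "K0 = free_map_ker R M (carrier M)"
  have K0: "carrier K = K0" by (simp add: K_def K0_def kernel_module_simps)
  have K0_sub: "K0 \<subseteq> carrier F0" by (auto simp: K0_def F0_def free_map_ker_def)
  have K_ops: "\<zero>\<^bsub>K\<^esub> = \<zero>\<^bsub>F0\<^esub>" "x \<oplus>\<^bsub>K\<^esub> y = x \<oplus>\<^bsub>F0\<^esub> y" "a \<odot>\<^bsub>K\<^esub> x = a \<odot>\<^bsub>F0\<^esub> x" for x y a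
    by (simp_all add: K_def F0_def kernel_module_simps)
  define F1 where "F1 = free_module R K0"
  define d1 where "d1 = free_map R F0 K0"
  interpret F1: left_module R F1 unfolding F1_def by (rule M.R.left_module_free)
  interpret d1: left_module_hom R F1 F0 d1
    by unfold_locales (simp add: F1_def d1_def F0.free_map_hom K0_sub)
  define K1 where "K1 = free_map_ker R F0 K0"
  have K1: "K1 = {x \<in> carrier F1. d1 x = \<zero>\<^bsub>F0\<^esub>}" by (simp add: K1_def free_map_ker_def d1_def F1_def)
  define F2 where "F2 = free_module R K1"
  define d2 where "d2 = free_map R F1 K1"
  interpret F2: left_module R F2 unfolding F2_def by (rule M.R.left_module_free)
  have d1_K0: "d1 x \<in> K0" if "x \<in> carrier F1" for x
    unfolding d1_def
  proof (rule F0.free_map_in_submodule)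
    show "x \<in> carrier (free_module R K0)" using that by (simp add: F1_def)
  qed (use K0_sub K.M.zero_closed K.M.add.m_closed K.smult_closed in \<open>auto simp: K0 K_ops\<close>)
  have d2_K1: "d2 x \<in> K1" if "x \<in> carrier F2" for x
    unfolding d2_def
  proof (rule F1.free_map_in_submodule)
    show "x \<in> carrier (free_module R K1)" using that by (simp add: F2_def)
  qed (auto simp: K1 d1.zero d1.add d1.smult F1.smult_closed F0.smult_r_null)
  \<comment> \<open>A set-theoretic section of \<open>d1\<close> over the kernel. It is not linear,
    but a cocycle does not see the failure, because it vanishes on \<open>K1\<close>.\<close>
  define u where "u = M.R.free_unit K0"
  have u: "u k \<in> carrier F1" "d1 (u k) = k" if "k \<in> K0" for k
    using that K0_sub M.R.free_unit_closed F0.free_map_unit by (simp_all add: u_def F1_def d1_def)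
  define H where "H = hom_space R \<eta> F1 N"
  define Z where "Z = {f \<in> carrier H. \<forall>x\<in>carrier F2. f (d2 x) = \<zero>\<^bsub>N\<^esub>}"
  define B where "B = (\<lambda>g. \<lambda>x\<in>carrier F1. g (d1 x)) ` carrier (hom_space R \<eta> F0 N)"
  have H_simps: "carrier H = module_hom R F1 N \<inter> extensional (carrier F1)"
    "\<zero>\<^bsub>H\<^esub> = (\<lambda>x\<in>carrier F1. \<zero>\<^bsub>N\<^esub>)" "f \<oplus>\<^bsub>H\<^esub> g = (\<lambda>x\<in>carrier F1. f x \<oplus>\<^bsub>N\<^esub> g x)"
    "c \<odot>\<^bsub>H\<^esub> f = (\<lambda>x\<in>carrier F1. \<eta> c \<odot>\<^bsub>N\<^esub> f x)" for f g c
    by (simp_all add: H_def hom_space_def)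
  have hom_Z: "left_module_hom R F1 N f" if "f \<in> Z" for f
    using that M.R.ring_axioms F1.left_module_axioms N.left_module_axioms
    by (simp add: Z_def H_simps left_module_hom_def left_module_hom_axioms_def)
  \<comment> \<open>Every element of \<open>K1\<close> is the image under \<open>d2\<close> of its
    own basis vector.\<close>
  have Z_K1: "f y = \<zero>\<^bsub>N\<^esub>" if "f \<in> Z" "y \<in> K1" for f y
  proof -
    have "K1 \<subseteq> carrier F1" by (auto simp: K1)
    then have "d2 (M.R.free_unit K1 y) = y" "M.R.free_unit K1 y \<in> carrier F2"
      unfolding d2_def F2_def using that M.R.free_unit_closed F1.free_map_unit by auto
    then show ?thesis using that by (auto simp: Z_def)
  qed
  \<comment> \<open>\<open>x\<close> and \<open>u (d1 x)\<close> have the same image under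
    \<open>d1\<close>, so they differ by an element of \<open>K1\<close>. Hence \<open>f\<close>
    factors through \<open>d1\<close>.\<close>
  have Z_factor: "f x = f (u (d1 x))" if f: "f \<in> Z" and x: "x \<in> carrier F1" for f x
  proof -
    interpret f: left_module_hom R F1 N f using f by (rule hom_Z)
    have ux: "u (d1 x) \<in> carrier F1" "d1 (u (d1 x)) = d1 x" using u d1_K0[OF x] by auto
    have "x \<ominus>\<^bsub>F1\<^esub> u (d1 x) \<in> K1"
      using x ux d1.closed by (auto simp: K1 d1.diff F0.M.r_neg a_minus_def[of F0])
    then have "f x \<ominus>\<^bsub>N\<^esub> f (u (d1 x)) = \<zero>\<^bsub>N\<^esub>" using Z_K1[OF f] f.diff x ux by metis
    then show ?thesis by (rule N.M.minus_eq_zeroD[OF _ f.closed[OF x] f.closed[OF ux(1)]])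
  qed
  have Z_hom: "(\<lambda>k. f (u k)) \<in> module_hom R K N" if f: "f \<in> Z" for f
  proof -
    interpret f: left_module_hom R F1 N f using f by (rule hom_Z)
    have "f (u (x \<oplus>\<^bsub>F0\<^esub> y)) = f (u x) \<oplus>\<^bsub>N\<^esub> f (u y)" if "x \<in> K0" "y \<in> K0" for x y
      using Z_factor[OF f, of "u x \<oplus>\<^bsub>F1\<^esub> u y"] that u by (simp add: d1.add f.add)
    moreover have "f (u (a \<odot>\<^bsub>F0\<^esub> x)) = a \<odot>\<^bsub>N\<^esub> f (u x)" if "a \<in> carrier R" "x \<in> K0" for a x
      using Z_factor[OF f, of "a \<odot>\<^bsub>F1\<^esub> u x"] that u by (simp add: d1.smult f.smult F1.smult_closed)
    ultimately show ?thesis using u f.closed by (auto simp: module_hom_def K0 K_ops)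
  qed
  have mult_hom: "(\<lambda>x. \<eta> c \<odot>\<^bsub>N\<^esub> f x) \<in> module_hom R A N" if "f \<in> module_hom R A N" for f c A
    using that \<eta>_closed \<eta>_central
    by (auto simp: module_hom_def N.smult_r_distr Pi_iff simp flip: N.smult_assoc intro!: N.smult_closed)
  have comp_Z: "(\<lambda>x\<in>carrier F1. h (d1 x)) \<in> Z" if h: "h \<in> module_hom R K N" for h
  proof -
    interpret h: left_module_hom R K N h by unfold_locales (rule h)
    have "(\<lambda>x\<in>carrier F1. h (d1 x)) \<in> module_hom R F1 N"
      using d1_K0 h.closed h.add h.smult F1.smult_closed
      by (auto simp: module_hom_def K0 d1.add d1.smult K_ops)
    moreover have "h (d1 (d2 x)) = \<zero>\<^bsub>N\<^esub>" "d2 x \<in> carrier F1" if "x \<in> carrier F2" for x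
      using d2_K1[OF that] h.zero by (auto simp: K1 K_ops)
    ultimately show ?thesis by (auto simp: Z_def H_simps)
  qed
  have F0_K: "h \<in> module_hom R K N" if "h \<in> module_hom R F0 N" for h
  proof -
    interpret h: left_module_hom R F0 N h by unfold_locales (rule that)
    have "x \<in> carrier F0" if "x \<in> K0" for x using that K0_sub by auto
    then show ?thesis by (auto simp: module_hom_def K0 K_ops h.add h.smult intro: h.closed)
  qed
  have add_Z: "f \<oplus>\<^bsub>H\<^esub> g \<in> Z" if f: "f \<in> Z" and g: "g \<in> Z" for f g
  proof -
    interpret f: left_module_hom R F1 N f using f by (rule hom_Z)
    interpret g: left_module_hom R F1 N g using g by (rule hom_Z)
    have "f (x \<oplus>\<^bsub>F1\<^esub> y) \<oplus>\<^bsub>N\<^esub> g (x \<oplus>\<^bsub>F1\<^esub> y) = (f x \<oplus>\<^bsub>N\<^esub> g x) \<oplus>\<^bsub>N\<^esub> (f y \<oplus>\<^bsub>N\<^esub> g y)"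
      if "x \<in> carrier F1" "y \<in> carrier F1" for x y
      using that f.closed g.closed
      by (simp add: f.add g.add N.M.a_ac)
    then show ?thesis using f g d2_K1 F1.smult_closed
      by (auto simp: Z_def H_simps module_hom_def N.smult_r_distr K1 Pi_iff)
  qed
  have smult_Z: "c \<odot>\<^bsub>H\<^esub> f \<in> Z" if f: "f \<in> Z" for f c
  proof -
    have "(\<lambda>x. \<eta> c \<odot>\<^bsub>N\<^esub> f x) \<in> module_hom R F1 N" using mult_hom f by (auto simp: Z_def H_simps)
    then have "c \<odot>\<^bsub>H\<^esub> f \<in> module_hom R F1 N"
      using F1.smult_closed by (auto simp: module_hom_def H_simps)
    then show ?thesis using f d2_K1 \<eta>_closed by (auto simp: Z_def H_simps K1 N.smult_r_null)
  qed
  define V where "V = H\<lparr>carrier := Z\<rparr>"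
  have V_simps: "carrier V = Z" "f \<oplus>\<^bsub>V\<^esub> g = f \<oplus>\<^bsub>H\<^esub> g" "\<zero>\<^bsub>V\<^esub> = \<zero>\<^bsub>H\<^esub>" "c \<odot>\<^bsub>V\<^esub> f = c \<odot>\<^bsub>H\<^esub> f" for f g c
    by (simp_all add: V_def)
  have Zval: "f x \<in> carrier N" if "f \<in> Z" "x \<in> carrier F1" for f x
    using that by (auto simp: Z_def H_simps module_hom_def)
  have Zext: "f \<in> extensional (carrier F1)" if "f \<in> Z" for f
    using that by (auto simp: Z_def H_simps)
  have zero_Z: "\<zero>\<^bsub>H\<^esub> \<in> Z"
    using comp_Z[of "\<lambda>_. \<zero>\<^bsub>N\<^esub>"] by (simp add: H_simps module_hom_def N.smult_r_null)
  have neg_Z: "(\<lambda>x\<in>carrier F1. \<ominus>\<^bsub>N\<^esub> f x) \<in> Z" if f: "f \<in> Z" for f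
  proof -
    interpret f: left_module_hom R F1 N f using f by (rule hom_Z)
    show ?thesis using f d2_K1 F1.smult_closed f.closed
      by (auto simp: Z_def H_simps module_hom_def f.add f.smult N.M.minus_add N.smult_r_minus K1)
  qed
  have agV: "abelian_group V"
  proof (rule abelian_groupI)
    fix f assume f: "f \<in> carrier V"
    show "\<zero>\<^bsub>V\<^esub> \<oplus>\<^bsub>V\<^esub> f = f"
      using f Zext[of f] Zval[of f] by (intro extensionalityI[of _ "carrier F1"]) (auto simp: V_simps H_simps)
    have "(\<lambda>x\<in>carrier F1. \<ominus>\<^bsub>N\<^esub> f x) \<oplus>\<^bsub>V\<^esub> f = \<zero>\<^bsub>V\<^esub>"
      using f Zval[of f] by (simp add: V_simps H_simps N.M.l_neg cong: restrict_cong)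
    then show "\<exists>g\<in>carrier V. g \<oplus>\<^bsub>V\<^esub> f = \<zero>\<^bsub>V\<^esub>"
      using neg_Z f by (auto simp: V_simps)
    fix g assume g: "g \<in> carrier V"
    show "f \<oplus>\<^bsub>V\<^esub> g \<in> carrier V" using add_Z f g by (simp add: V_simps)
    show "f \<oplus>\<^bsub>V\<^esub> g = g \<oplus>\<^bsub>V\<^esub> f"
      using f g Zval by (simp add: V_simps H_simps N.M.a_comm cong: restrict_cong)
    fix h assume h: "h \<in> carrier V"
    show "f \<oplus>\<^bsub>V\<^esub> g \<oplus>\<^bsub>V\<^esub> h = f \<oplus>\<^bsub>V\<^esub> (g \<oplus>\<^bsub>V\<^esub> h)"
      using f g h Zval by (simp add: V_simps H_simps N.M.a_assoc cong: restrict_cong)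
  qed (simp add: V_simps zero_Z)
  \<comment> \<open>The homomorphism on the kernel induced by the cocycle \<open>f\<close>, measured
    by \<open>L\<close>.\<close>
  define \<Phi> where "\<Phi> f = L (\<lambda>k. f (u k))" for f
  have u_F1: "u k \<in> carrier F1" if "k \<in> carrier K" for k using u that by (simp add: K0)
  have comp_u: "\<forall>k\<in>carrier K. (\<lambda>x\<in>carrier F1. h (d1 x)) (u k) = h k" for h :: "('m \<Rightarrow> 'r) \<Rightarrow> 'n"
    using u by (simp add: K0)
  have "has_dim (quotient_space V B) n"
  proof (rule has_dim_quotient_space[where \<Phi> = \<Phi>])
    show "abelian_group V" by (rule agV)
    show "c \<odot>\<^bsub>V\<^esub> v \<in> carrier V" if "v \<in> carrier V" for c v
      using that smult_Z by (simp add: V_simps)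
    show "\<Phi> (f \<oplus>\<^bsub>V\<^esub> g) = \<Phi> f + \<Phi> g" if fg: "f \<in> carrier V" "g \<in> carrier V" for f g
    proof -
      \<comment> \<open>The sum in \<open>V\<close> is restricted to \<open>carrier F1\<close>, so
        it agrees with the pointwise sum only for arguments in \<open>K\<close>. Hence the
        hypothesis \<open>L_cong\<close>.\<close>
      have "\<Phi> (f \<oplus>\<^bsub>V\<^esub> g) = L (\<lambda>k. f (u k) \<oplus>\<^bsub>N\<^esub> g (u k))"
        unfolding \<Phi>_def
      proof (rule L_cong)
        show "(\<lambda>k. (f \<oplus>\<^bsub>V\<^esub> g) (u k)) \<in> module_hom R K N"
          using Z_hom add_Z fg by (simp add: V_simps)
        have "(\<lambda>k. f (u k) \<oplus>\<^bsub>N\<^esub> g (u k)) \<in> module_hom R K N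
          \<longleftrightarrow> (\<lambda>k. (f \<oplus>\<^bsub>V\<^esub> g) (u k)) \<in> module_hom R K N"
          using u_F1 K.smult_closed by (auto simp: module_hom_def V_simps H_simps Pi_iff)
        then show "(\<lambda>k. f (u k) \<oplus>\<^bsub>N\<^esub> g (u k)) \<in> module_hom R K N"
          using Z_hom add_Z fg by (simp add: V_simps)
      qed (use u_F1 in \<open>simp add: V_simps H_simps\<close>)
      also have "\<dots> = \<Phi> f + \<Phi> g" unfolding \<Phi>_def using fg Z_hom by (intro L_add) (auto simp: V_simps)
      finally show ?thesis .
    qed
    show "\<Phi> (c \<odot>\<^bsub>V\<^esub> f) = c \<cdot>\<^sub>v \<Phi> f" if f: "f \<in> carrier V" for c f
    proof -
      have "\<Phi> (c \<odot>\<^bsub>V\<^esub> f) = L (\<lambda>k. \<eta> c \<odot>\<^bsub>N\<^esub> f (u k))"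
        unfolding \<Phi>_def
      proof (rule L_cong)
        have f: "f \<in> Z" using f by (simp add: V_simps)
        show "(\<lambda>k. (c \<odot>\<^bsub>V\<^esub> f) (u k)) \<in> module_hom R K N"
          using Z_hom[OF smult_Z[OF f]] by (simp add: V_simps)
        show "(\<lambda>k. \<eta> c \<odot>\<^bsub>N\<^esub> f (u k)) \<in> module_hom R K N"
          by (rule mult_hom[OF Z_hom[OF f]])
      qed (use u_F1 in \<open>simp add: V_simps H_simps\<close>)
      also have "\<dots> = c \<cdot>\<^sub>v \<Phi> f" unfolding \<Phi>_def using f Z_hom by (intro L_smult) (auto simp: V_simps)
      finally show ?thesis .
    qed
    show "\<Phi> ` carrier V = carrier_vec n"
    proof
      show "\<Phi> ` carrier V \<subseteq> carrier_vec n"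
        using Z_hom L_onto by (auto simp: \<Phi>_def V_simps)
      show "carrier_vec n \<subseteq> \<Phi> ` carrier V"
      proof
        fix x :: "'k vec" assume "x \<in> carrier_vec n"
        then obtain h where h: "h \<in> module_hom R K N" "x = L h" using L_onto by blast
        have "\<Phi> (\<lambda>x\<in>carrier F1. h (d1 x)) = L h"
          unfolding \<Phi>_def by (rule L_cong[OF Z_hom[OF comp_Z[OF h(1)]] h(1) comp_u])
        then show "x \<in> \<Phi> ` carrier V" using h comp_Z by (metis V_simps(1) image_eqI)
      qed
    qed
    show "B = {f \<in> carrier V. \<Phi> f = 0\<^sub>v n}"
    proof (intro equalityI subsetI)
      fix f assume "f \<in> B"
      then obtain g where g: "g \<in> module_hom R F0 N" "f = (\<lambda>x\<in>carrier F1. g (d1 x))"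
        by (auto simp: B_def hom_space_def)
      then have f: "f \<in> Z" using comp_Z F0_K by simp
      have "\<exists>g\<in>module_hom R F0 N. \<forall>k\<in>carrier K. f (u k) = g k"
        unfolding g(2) using g(1) comp_u by blast
      then show "f \<in> {f \<in> carrier V. \<Phi> f = 0\<^sub>v n}"
        using f L_ker[OF Z_hom[OF f]] by (simp add: V_simps \<Phi>_def)
    next
      fix f assume "f \<in> {f \<in> carrier V. \<Phi> f = 0\<^sub>v n}"
      then have f: "f \<in> Z" and "\<Phi> f = 0\<^sub>v n" by (auto simp: V_simps)
      then obtain g where g: "g \<in> module_hom R F0 N" "\<forall>k\<in>carrier K. f (u k) = g k"
        using L_ker[OF Z_hom[OF f]] by (auto simp: \<Phi>_def)
      have "restrict g (carrier F0) \<in> carrier (hom_space R \<eta> F0 N)"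
        using g(1) F0.smult_closed by (auto simp: hom_space_def module_hom_def)
      moreover have "f = (\<lambda>x\<in>carrier F1. restrict g (carrier F0) (d1 x))"
      proof (rule extensionalityI[of _ "carrier F1"])
        fix x assume x: "x \<in> carrier F1"
        then show "f x = (\<lambda>x\<in>carrier F1. restrict g (carrier F0) (d1 x)) x"
          using Z_factor[OF f x] g(2) d1_K0 d1.closed by (simp add: K0)
      qed (use Zext[OF f] in auto)
      ultimately show "f \<in> B"
        unfolding B_def by (intro image_eqI[where x = "restrict g (carrier F0)"])
    qed
  qed
  then show ?thesis
    by (simp add: ext1_def Let_def V_def H_def Z_def B_def F2_def d2_def K1_def F1_def d1_def K0_def F0_def)
qed

section \<open>The free algebra and its representations\<close>

text \<open>Every word arises from the empty one by putting letters in front. Multiplication by a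
  generator on the left matches operators that are composed from the left.\<close>

lemma free_alg_induct [case_names scal add var_mult]:
  fixes p :: "'k::field free_alg"
  assumes scal: "\<And>c. P (scal c)"
    and add: "\<And>p q. P p \<Longrightarrow> P q \<Longrightarrow> P (p + q)"
    and var_mult: "\<And>x p. P p \<Longrightarrow> P (var x * p)"
  shows "P p"
proof (induct p rule: update_induct)
  case const
  then show ?case using scal[of 0] by (simp add: scal_def)
next
  case (update f a b)
  have "P (Poly_Mapping.single (Free_Mon u) b)" for u
  proof (induct u)
    case Nil
    then show ?case using scal[of b] by (simp add: scal_def zero_free_mon_def)
  next
    case (Cons x u)
    then show ?case using var_mult[of "Poly_Mapping.single (Free_Mon u) b" x]
      by (simp add: var_def mult_single)
  qed
  then have "P (Poly_Mapping.single a b)" by (cases a) simp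
  moreover have "Poly_Mapping.update a b f = f + Poly_Mapping.single a b"
    using update(1) by (intro poly_mapping_eqI)
      (auto simp: lookup_update lookup_add lookup_single in_keys_iff when_def)
  ultimately show ?case using add update(3) by simp
qed

lemma scal_simps:
  "scal 0 = 0" "scal 1 = 1" "scal (a + b) = scal a + scal b" "scal (a * b) = scal a * scal b"
  by (simp_all add: scal_def single_add mult_single)

lemma scal_commute: "scal c * p = p * scal c"
proof (induct p rule: free_alg_induct)
  case (var_mult x p)
  have "scal c * var x = var x * scal c" by (simp add: scal_def var_def mult_single)
  then have "scal c * (var x * p) = var x * (scal c * p)" by (simp flip: mult.assoc)
  then show ?case using var_mult by (simp add: mult.assoc)
next
  case (scal d)
  then show ?case by (metis scal_simps(4) mult.commute)
qed (simp add: distrib_left distrib_right)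

text \<open>\<open>foldr\<close> lets the last letter act first, so concatenation of words becomes
  composition of operators and the result is a left action.\<close>

fun word_act :: "(gen \<Rightarrow> 'a \<Rightarrow> 'a) \<Rightarrow> gen free_mon \<Rightarrow> 'a \<Rightarrow> 'a" where
  "word_act A (Free_Mon u) v = foldr A u v"

definition act :: "('k::field \<Rightarrow> 'a \<Rightarrow> 'a::ab_group_add) \<Rightarrow> (gen \<Rightarrow> 'a \<Rightarrow> 'a) \<Rightarrow> 'k free_alg \<Rightarrow> 'a \<Rightarrow> 'a" where
  "act s A p v = (\<Sum>m\<in>Poly_Mapping.keys p. s (Poly_Mapping.lookup p m) (word_act A m v))"

locale gen_rep = vector_space s for s :: "'k::field \<Rightarrow> 'a::ab_group_add \<Rightarrow> 'a" +
  fixes A :: "gen \<Rightarrow> 'a \<Rightarrow> 'a"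
  assumes gen_add: "A x (v + w) = A x v + A x w"
    and gen_scale: "A x (s c v) = s c (A x v)"
begin

lemma word_act_add_right: "word_act A m (v + w) = word_act A m v + word_act A m w"
proof (cases m)
  case (Free_Mon u)
  then show ?thesis by (induct u arbitrary: m) (simp_all add: gen_add)
qed

lemma word_act_scale: "word_act A m (s c v) = s c (word_act A m v)"
proof (cases m)
  case (Free_Mon u)
  then show ?thesis by (induct u arbitrary: m) (simp_all add: gen_scale)
qed

lemma act_superset:
  "\<lbrakk>finite S; Poly_Mapping.keys p \<subseteq> S\<rbrakk> \<Longrightarrow>
    act s A p v = (\<Sum>m\<in>S. s (Poly_Mapping.lookup p m) (word_act A m v))"
  unfolding act_def by (rule sum.mono_neutral_left) (auto simp: in_keys_iff)

lemma act_add_left: "act s A (p + q) v = act s A p v + act s A q v"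
proof -
  let ?S = "Poly_Mapping.keys p \<union> Poly_Mapping.keys q"
  have "act s A (p + q) v = (\<Sum>m\<in>?S. s (Poly_Mapping.lookup (p + q) m) (word_act A m v))"
    by (rule act_superset) (use keys_add[of p q] in auto)
  also have "\<dots> = (\<Sum>m\<in>?S. s (Poly_Mapping.lookup p m) (word_act A m v))
      + (\<Sum>m\<in>?S. s (Poly_Mapping.lookup q m) (word_act A m v))"
    by (simp add: lookup_add scale_left_distrib sum.distrib)
  also have "\<dots> = act s A p v + act s A q v"
    by (subst (1 2) act_superset[symmetric]) auto
  finally show ?thesis .
qed

lemma act_single: "act s A (Poly_Mapping.single m c) v = s c (word_act A m v)"
  by (subst act_superset[of "{m}"]) auto

lemma act_scal: "act s A (scal c) v = s c v"
  by (simp add: scal_def act_single zero_free_mon_def)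

lemma act_var: "act s A (var x) v = A x v"
  by (simp add: var_def act_single)

lemma act_zero_left: "act s A 0 v = 0"
  by (simp add: act_def)

lemma act_one: "act s A 1 v = v"
  using act_scal[of 1] by (simp add: scal_simps)

lemma act_minus_left: "act s A (- p) v = - act s A p v"
  using act_add_left[of "- p" p v] by (simp add: act_zero_left eq_neg_iff_add_eq_0)

lemma act_diff_left: "act s A (p - q) v = act s A p v - act s A q v"
  using act_add_left[of p "- q" v] by (simp add: act_minus_left)

lemma act_add: "act s A p (v + w) = act s A p v + act s A p w"
  by (simp add: act_def word_act_add_right scale_right_distrib sum.distrib)

lemma act_scale: "act s A p (s c v) = s c (act s A p v)"
  by (simp add: act_def word_act_scale scale_sum_right mult.commute)

lemma act_zero: "act s A p 0 = 0"
  using act_scale[of p 0 0] by simp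

lemma act_minus: "act s A p (- v) = - act s A p v"
  using act_scale[of p "- 1" v] by simp

lemma act_diff: "act s A p (v - w) = act s A p v - act s A p w"
  using act_add[of p v "- w"] by (simp add: act_minus)

lemma act_var_mult: "act s A (var x * p) v = A x (act s A p v)"
proof -
  have *: "act s A (var x * Poly_Mapping.single m c) v = A x (act s A (Poly_Mapping.single m c) v)" for m c
    by (cases m) (simp add: var_def mult_single act_single gen_scale)
  show ?thesis
  proof (induct p rule: update_induct)
    case const
    then show ?case using gen_scale[of x 0 0] by (simp add: act_zero_left)
  next
    case (update f a b)
    have "Poly_Mapping.update a b f = f + Poly_Mapping.single a b"
      using update(1) by (intro poly_mapping_eqI)
        (auto simp: lookup_update lookup_add lookup_single in_keys_iff when_def)
    then show ?case using update(3) * by (simp add: distrib_left act_add_left gen_add)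
  qed
qed

lemma act_scal_mult: "act s A (scal c * p) v = s c (act s A p v)"
proof (induct p rule: free_alg_induct)
  case (scal d)
  then show ?case by (simp add: act_scal flip: scal_simps)
next
  case (add p q)
  then show ?case by (simp add: distrib_left act_add_left scale_right_distrib)
next
  case (var_mult x p)
  have "scal c * (var x * p) = var x * (scal c * p)" by (metis scal_commute mult.assoc)
  then show ?case using var_mult by (simp add: act_var_mult gen_scale)
qed

lemma act_mult: "act s A (p * q) v = act s A p (act s A q v)"
  by (induct p rule: free_alg_induct)
    (simp_all add: act_scal act_scal_mult act_add_left act_var_mult distrib_right mult.assoc)

lemma act_power: "act s A (p ^ n) v = (act s A p ^^ n) v"
  by (induct n arbitrary: v) (simp_all add: act_one act_mult)

lemmas act_simps = act_add_left act_diff_left act_minus_left act_mult act_power act_one act_scal act_var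

end

locale H_rep = gen_rep s A for s :: "'k::field \<Rightarrow> 'a::ab_group_add \<Rightarrow> 'a" and A +
  fixes N M :: nat and lam :: "'k \<times> 'k \<times> 'k"
  assumes rels: "r \<in> H_rels N M lam \<Longrightarrow> act s A r v = 0"

section \<open>The algebra as a quotient ring\<close>

lemma H_ideal_ideal: "ideal (H_ideal N M (lam :: 'k::field \<times> 'k \<times> 'k)) class_ring"
  unfolding H_ideal_def by (rule ring.genideal_ideal[OF class_ring.ring_axioms]) auto

lemma ring_H_alg: "ring (H_alg N M (lam :: 'k::field \<times> 'k \<times> 'k))"
  unfolding H_alg_def by (rule ideal.quotient_is_ring[OF H_ideal_ideal])

lemma H_rels_in_ideal: "r \<in> H_rels N M lam \<Longrightarrow> r \<in> H_ideal N M lam"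
  unfolding H_ideal_def using ring.genideal_self[OF class_ring.ring_axioms, of "H_rels N M lam"] by auto

lemma H_class_in_carrier [simp]: "H_class N M lam p \<in> carrier (H_alg N M lam)"
  by (auto simp: H_class_def H_alg_def FactRing_def A_RCOSETS_def')

lemma carrier_H_algE:
  assumes "r \<in> carrier (H_alg N M lam)" obtains p where "r = H_class N M lam p"
  using assms by (auto simp: H_class_def H_alg_def FactRing_def A_RCOSETS_def')

lemma H_class_mult: "H_class N M lam p \<otimes>\<^bsub>H_alg N M lam\<^esub> H_class N M lam q = H_class N M lam (p * q)"
proof -
  interpret I: ideal "H_ideal N M lam" class_ring by (rule H_ideal_ideal)
  show ?thesis using I.rcoset_mult_add[of p q] by (simp add: H_class_def H_alg_def FactRing_def)
qed

lemma H_class_add: "H_class N M lam p \<oplus>\<^bsub>H_alg N M lam\<^esub> H_class N M lam q = H_class N M lam (p + q)"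
proof -
  interpret I: ideal "H_ideal N M lam" class_ring by (rule H_ideal_ideal)
  show ?thesis using I.a_rcos_sum[of p q] by (simp add: H_class_def H_alg_def FactRing_def)
qed

lemma H_class_one: "\<one>\<^bsub>H_alg N M lam\<^esub> = H_class N M lam 1"
  by (simp add: H_class_def H_alg_def FactRing_def)

lemma H_class_zero: "\<zero>\<^bsub>H_alg N M lam\<^esub> = H_class N M lam 0"
  using ideal.Icarr[OF H_ideal_ideal]
  by (simp add: H_class_def H_alg_def FactRing_def a_r_coset_def')

lemma H_class_eq_zero:
  assumes "p \<in> H_ideal N M lam" shows "H_class N M lam p = \<zero>\<^bsub>H_alg N M lam\<^esub>"
proof -
  interpret I: ideal "H_ideal N M lam" class_ring by (rule H_ideal_ideal)
  show ?thesis using I.a_rcos_const[OF assms] by (simp add: H_class_def H_alg_def FactRing_def)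
qed

lemma mem_H_class: "q \<in> H_class N M lam p \<longleftrightarrow> q - p \<in> H_ideal N M lam"
  by (auto simp: H_class_def a_r_coset_def' intro: bexI[of _ "q - p"])

lemma H_const_in_carrier [simp]: "H_const N M lam c \<in> carrier (H_alg N M lam)"
  and H_gen_in_carrier [simp]: "H_gen N M lam x \<in> carrier (H_alg N M lam)"
  by (simp_all add: H_const_def H_gen_def)

lemma H_const_central:
  "r \<in> carrier (H_alg N M lam) \<Longrightarrow>
    H_const N M lam c \<otimes>\<^bsub>H_alg N M lam\<^esub> r = r \<otimes>\<^bsub>H_alg N M lam\<^esub> H_const N M lam c"
  by (auto elim!: carrier_H_algE simp: H_const_def H_class_mult scal_commute)

lemma H_const_mult: "H_const N M lam a \<otimes>\<^bsub>H_alg N M lam\<^esub> H_const N M lam b = H_const N M lam (a * b)"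
  and H_const_add: "H_const N M lam a \<oplus>\<^bsub>H_alg N M lam\<^esub> H_const N M lam b = H_const N M lam (a + b)"
  and H_const_one: "H_const N M lam 1 = \<one>\<^bsub>H_alg N M lam\<^esub>"
  and H_const_zero: "H_const N M lam 0 = \<zero>\<^bsub>H_alg N M lam\<^esub>"
  by (simp_all add: H_const_def H_class_mult H_class_add H_class_one H_class_zero scal_simps)

context H_rep
begin

text \<open>The elements acting as zero everywhere form a two-sided ideal containing the relations,
  and \<open>H_ideal\<close> is the least such ideal.\<close>

lemma act_ideal:
  assumes "p \<in> H_ideal N M lam" shows "act s A p v = 0"
proof -
  let ?I = "{p. \<forall>v. act s A p v = 0}"
  have "ideal ?I class_ring"
  proof (rule idealI)
    show "subgroup ?I (add_monoid (class_ring :: 'k free_alg ring))"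
    proof (rule group.subgroupI)
      show "group (add_monoid (class_ring :: 'k free_alg ring))" by (intro abelian_group.a_group ring.is_abelian_group class_ring.ring_axioms)
      fix p assume p: "p \<in> ?I"
      have "a_inv class_ring p = - p" by (simp only: class_ring_simps)
      then have "inv\<^bsub>add_monoid class_ring\<^esub> p = - p" unfolding a_inv_def .
      then show "inv\<^bsub>add_monoid class_ring\<^esub> p \<in> ?I" using p by (simp add: act_minus_left)
    qed (auto simp: act_add_left intro: exI[of _ 0] simp: act_zero_left)
  qed (auto simp: act_mult act_zero class_ring.ring_axioms)
  then have "H_ideal N M lam \<subseteq> ?I"
    unfolding H_ideal_def using rels by (intro ring.genideal_minimal[OF class_ring.ring_axioms]) auto
  then show ?thesis using assms by auto
qed

text \<open>Elements of \<open>H_alg\<close> are cosets, and the action goes through an arbitrary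
  representative; by \<open>act_ideal\<close> the choice does not matter.\<close>

definition rep_module :: "('k free_alg set, 'a) module" where
  "rep_module = \<lparr>carrier = UNIV, mult = undefined, one = undefined, zero = 0, add = (+),
    smult = (\<lambda>r v. act s A (SOME p. p \<in> r) v)\<rparr>"

lemma rep_module_simps:
  "carrier rep_module = UNIV" "\<zero>\<^bsub>rep_module\<^esub> = 0" "v \<oplus>\<^bsub>rep_module\<^esub> w = v + w"
  by (simp_all add: rep_module_def)

lemma rep_module_smult: "H_class N M lam p \<odot>\<^bsub>rep_module\<^esub> v = act s A p v"
proof -
  have "0 \<in> H_ideal N M lam"
    using additive_subgroup.zero_closed[OF ideal.axioms(1), OF H_ideal_ideal] by (simp add: class_ring_simps)
  then have "p \<in> H_class N M lam p" by (simp add: mem_H_class)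
  then have "(SOME q. q \<in> H_class N M lam p) \<in> H_class N M lam p" by (rule someI)
  then have "act s A ((SOME q. q \<in> H_class N M lam p) - p) v = 0" by (simp add: mem_H_class act_ideal)
  then show ?thesis by (simp add: rep_module_def act_diff_left)
qed

lemma left_module_rep_module: "left_module (H_alg N M lam) rep_module"
proof (intro left_module.intro left_module_axioms.intro)
  show "ring (H_alg N M lam)" by (rule ring_H_alg)
  show "abelian_group rep_module"
  proof (rule abelian_groupI)
    show "\<exists>w\<in>carrier rep_module. w \<oplus>\<^bsub>rep_module\<^esub> v = \<zero>\<^bsub>rep_module\<^esub>" for v
      by (rule bexI[of _ "- v"]) (simp_all add: rep_module_simps)
  qed (simp_all add: rep_module_simps)
qed (auto elim!: carrier_H_algE simp: rep_module_smult rep_module_simps H_class_add H_class_mult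
      H_class_one act_add_left act_add act_mult act_one)

end

section \<open>\<open>Ext\<^sup>1\<close> through block triangular representations\<close>

text \<open>Pairs are ordered as \<open>(w, v)\<close>: \<open>ext_gen B A D\<close> is the block matrix \<open>(B, D; 0, A)\<close> of an extension
  of the representation \<open>A\<close> by \<open>B\<close>.\<close>

definition ext_scale ::
    "('k \<Rightarrow> 'b \<Rightarrow> 'b) \<Rightarrow> ('k \<Rightarrow> 'a \<Rightarrow> 'a) \<Rightarrow> 'k \<Rightarrow> 'b \<times> 'a \<Rightarrow> 'b \<times> 'a" where
  "ext_scale sB sA c = (\<lambda>(w, v). (sB c w, sA c v))"

definition ext_gen ::
    "(gen \<Rightarrow> 'b \<Rightarrow> 'b::plus) \<Rightarrow> (gen \<Rightarrow> 'a \<Rightarrow> 'a) \<Rightarrow> (gen \<Rightarrow> 'a \<Rightarrow> 'b) \<Rightarrow> gen \<Rightarrow> 'b \<times> 'a \<Rightarrow> 'b \<times> 'a" where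
  "ext_gen B A D x = (\<lambda>(w, v). (B x w + D x v, A x v))"

lemma ext_simps:
  "ext_scale sB sA c (w, v) = (sB c w, sA c v)" "ext_gen B A D x (w, v) = (B x w + D x v, A x v)"
  "snd (ext_scale sB sA c u) = sA c (snd u)" "snd (ext_gen B A D x u) = A x (snd u)"
  by (simp_all add: ext_scale_def ext_gen_def split: prod.splits)

text \<open>The condition says that the graph of \<open>T\<close>, the set of all pairs
  \<open>(T v, v)\<close>, is stable under the block matrices: it is a complement of the submodule,
  so the extension splits.\<close>

definition inner ::
    "('k \<Rightarrow> 'b \<Rightarrow> 'b::ab_group_add) \<Rightarrow> (gen \<Rightarrow> 'b \<Rightarrow> 'b) \<Rightarrow> ('k \<Rightarrow> 'a \<Rightarrow> 'a::ab_group_add) \<Rightarrow>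
      (gen \<Rightarrow> 'a \<Rightarrow> 'a) \<Rightarrow> (gen \<Rightarrow> 'a \<Rightarrow> 'b) \<Rightarrow> bool" where
  "inner sB B sA A D \<longleftrightarrow> (\<exists>T. (\<forall>v w. T (v + w) = T v + T w) \<and> (\<forall>c v. T (sA c v) = sB c (T v)) \<and>
    (\<forall>x v. D x v = T (A x v) - B x (T v)))"

text \<open>The operators \<open>A\<close> on a concrete space stand for the abstract module
  \<open>V\<close>. The defining relations are not assumed for \<open>A\<close>: they are inherited
  from \<open>V\<close> because \<open>\<iota>\<close> is injective.\<close>

locale H_model = gen_rep s A for s :: "'k::field \<Rightarrow> 'a::ab_group_add \<Rightarrow> 'a" and A +
  fixes N M :: nat and lam :: "'k \<times> 'k \<times> 'k"
    and V :: "('k free_alg set, 'v) module" and \<iota> :: "'a \<Rightarrow> 'v"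
  assumes left_module: "left_module (H_alg N M lam) V"
    and bij: "bij_betw \<iota> UNIV (carrier V)"
    and \<iota>_add: "\<iota> (v + w) = \<iota> v \<oplus>\<^bsub>V\<^esub> \<iota> w"
    and \<iota>_scale: "\<iota> (s c v) = H_const N M lam c \<odot>\<^bsub>V\<^esub> \<iota> v"
    and \<iota>_gen: "\<iota> (A x v) = H_gen N M lam x \<odot>\<^bsub>V\<^esub> \<iota> v"
begin

sublocale left_module "H_alg N M lam" V by (rule left_module)

lemma \<iota>_closed [simp]: "\<iota> v \<in> carrier V"
  using bij by (auto simp: bij_betw_def)

lemma \<iota>_inject: "\<iota> v = \<iota> w \<longleftrightarrow> v = w"
  using bij by (auto simp: bij_betw_def inj_on_def)

lemma \<iota>_zero: "\<iota> 0 = \<zero>\<^bsub>V\<^esub>"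
  using \<iota>_add[of 0 0] by (simp add: M.add.r_cancel_one')

lemma \<iota>_minus: "\<iota> (- v) = \<ominus>\<^bsub>V\<^esub> \<iota> v"
  by (rule M.minus_equality[symmetric]) (simp_all flip: \<iota>_add add: \<iota>_zero)

lemma \<iota>_diff: "\<iota> (v - w) = \<iota> v \<ominus>\<^bsub>V\<^esub> \<iota> w"
  using \<iota>_add[of v "- w"] by (simp add: \<iota>_minus a_minus_def)

lemma \<iota>_act: "\<iota> (act s A p v) = H_class N M lam p \<odot>\<^bsub>V\<^esub> \<iota> v"
proof (induct p rule: free_alg_induct)
  case (scal c)
  then show ?case by (simp add: act_scal \<iota>_scale H_const_def)
next
  case (add p q)
  then show ?case by (simp add: act_add_left \<iota>_add smult_l_distr flip: H_class_add)
next
  case (var_mult x p)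
  then show ?case by (simp add: act_mult act_var \<iota>_gen smult_assoc H_gen_def flip: H_class_mult)
qed

definition co :: "'v \<Rightarrow> 'a" where "co = inv_into UNIV \<iota>"

lemma co_\<iota> [simp]: "co (\<iota> v) = v"
  using bij by (simp add: co_def bij_betw_def)

lemma \<iota>_co [simp]: "x \<in> carrier V \<Longrightarrow> \<iota> (co x) = x"
  using bij by (simp add: co_def bij_betw_def f_inv_into_f)

lemma co_eq: "x \<in> carrier V \<Longrightarrow> co x = v \<longleftrightarrow> x = \<iota> v"
  by auto

lemma co_add: "\<lbrakk>x \<in> carrier V; y \<in> carrier V\<rbrakk> \<Longrightarrow> co (x \<oplus>\<^bsub>V\<^esub> y) = co x + co y"
  by (simp add: co_eq \<iota>_add)

lemma co_smult: "x \<in> carrier V \<Longrightarrow> co (H_class N M lam p \<odot>\<^bsub>V\<^esub> x) = act s A p (co x)"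
  by (simp add: co_eq \<iota>_act smult_closed)

lemma co_zero: "co \<zero>\<^bsub>V\<^esub> = 0"
  by (simp add: co_eq \<iota>_zero)

lemma co_diff: "\<lbrakk>x \<in> carrier V; y \<in> carrier V\<rbrakk> \<Longrightarrow> co (x \<ominus>\<^bsub>V\<^esub> y) = co x - co y"
  by (simp add: co_eq \<iota>_diff M.minus_closed)

lemma rels: "r \<in> H_rels N M lam \<Longrightarrow> act s A r v = 0"
  by (simp flip: \<iota>_inject add: \<iota>_act \<iota>_zero H_class_eq_zero[OF H_rels_in_ideal] smult_l_null)

end

lemma (in abelian_group) a_inv_zero: "\<ominus> \<zero> = \<zero>"
  by (rule minus_equality) simp_all

lemma (in left_module_hom) finsum_comm:
  "g \<in> S \<rightarrow> carrier M \<Longrightarrow> f (\<Oplus>\<^bsub>M\<^esub>i\<in>S. g i) = (\<Oplus>\<^bsub>N\<^esub>i\<in>S. f (g i))"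
proof (induct S rule: infinite_finite_induct)
  case (insert x S)
  then have "g x \<in> carrier M" "g \<in> S \<rightarrow> carrier M" by auto
  then show ?case using insert by (simp add: add Pi_iff closed)
qed (simp_all add: zero)

lemma (in left_module_hom) free_lift_comp:
  assumes h: "h \<in> S \<rightarrow> carrier M" and x: "x \<in> carrier (free_module R S)"
  shows "f (free_lift R M S h x) = free_lift R N S (\<lambda>s. f (h s)) x"
proof -
  have hs: "h s \<in> carrier M" if "s \<in> S" for s using h that by auto
  note xs = M.R.free_module_val[OF x]
  have "f (free_lift R M S h x) = (\<Oplus>\<^bsub>N\<^esub> s \<in> {s \<in> S. x s \<noteq> \<zero>\<^bsub>R\<^esub>}. f (x s \<odot>\<^bsub>M\<^esub> h s))"
    unfolding free_lift_def using hs xs by (intro finsum_comm) (auto intro: M.smult_closed)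
  also have "\<dots> = free_lift R N S (\<lambda>s. f (h s)) x"
    unfolding free_lift_def using hs xs
    by (intro N.M.finsum_cong') (auto simp: smult closed intro!: N.smult_closed)
  finally show ?thesis .
qed

text \<open>In the extension \<open>W\<close> is the submodule and \<open>V\<close> the quotient.
  Coordinates are fixed on the quotient only, since sections have to be built from there.\<close>

locale H_model_pair =
  V: H_model sA A N M lam V \<iota>V + W: H_model sB B N M lam W \<iota>W
  for sA :: "'k::field \<Rightarrow> 'a::ab_group_add \<Rightarrow> 'a" and A and sB :: "'k \<Rightarrow> 'b::ab_group_add \<Rightarrow> 'b" and B
    and N M lam and V :: "('k free_alg set, 'v) module" and \<iota>V
    and W :: "('k free_alg set, 'w) module" and \<iota>W +
  fixes I :: "nat set" and e :: "nat \<Rightarrow> 'a" and coord :: "nat \<Rightarrow> 'a \<Rightarrow> 'k"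
  assumes finite_I: "finite I"
    and coord_sum: "v = (\<Sum>i\<in>I. sA (coord i v) (e i))"
    and coord_add: "coord i (v + w) = coord i v + coord i w"
    and coord_scale: "coord i (sA c v) = c * coord i v"
begin

abbreviation "H \<equiv> H_alg N M lam"
abbreviation "cl \<equiv> H_class N M lam"
abbreviation "sE \<equiv> ext_scale sB sA"
abbreviation "E \<equiv> ext_gen B A"

definition F where "F = free_module H (carrier V)"
definition K where "K = kernel_module H V (carrier V)"
definition pr where "pr = free_map H V (carrier V)"

sublocale F: left_module H F
  unfolding F_def by (rule V.R.left_module_free)

sublocale K: left_module H K
  unfolding K_def by (rule V.left_module_kernel_module) simp

sublocale pr: left_module_hom H F V pr
  by unfold_locales (simp add: F_def pr_def V.free_map_hom)

lemma K_simps: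
  "carrier K = {x \<in> carrier F. pr x = \<zero>\<^bsub>V\<^esub>}" "\<zero>\<^bsub>K\<^esub> = \<zero>\<^bsub>F\<^esub>" "x \<oplus>\<^bsub>K\<^esub> y = x \<oplus>\<^bsub>F\<^esub> y" "r \<odot>\<^bsub>K\<^esub> x = r \<odot>\<^bsub>F\<^esub> x"
  by (simp_all add: K_def F_def pr_def kernel_module_simps free_map_ker_def)

definition unit where "unit v = V.R.free_unit (carrier V) (\<iota>V v)"

lemma unit_closed [simp]: "unit v \<in> carrier F"
  by (simp add: unit_def F_def V.R.free_unit_closed)

lemma pr_unit: "pr (unit v) = \<iota>V v"
  by (simp add: unit_def pr_def V.free_map_unit)

text \<open>The map \<open>unit\<close> already splits \<open>pr\<close>, but it is not additive,
  since \<open>F\<close> is free on the underlying set of \<open>V\<close>. Expanding in the basis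
  gives a section that is linear over the field, though in general not over
  \<open>H\<close>.\<close>

definition \<sigma> where "\<sigma> v = (\<Oplus>\<^bsub>F\<^esub>i\<in>I. cl (scal (coord i v)) \<odot>\<^bsub>F\<^esub> unit (e i))"

lemma \<sigma>_closed [simp]: "\<sigma> v \<in> carrier F"
  unfolding \<sigma>_def by (rule F.M.finsum_closed) (auto intro: F.smult_closed)

lemma \<sigma>_add: "\<sigma> (v + w) = \<sigma> v \<oplus>\<^bsub>F\<^esub> \<sigma> w"
  unfolding \<sigma>_def coord_add scal_simps H_class_add[symmetric]
  by (subst F.M.finsum_addf[symmetric]) (auto simp: F.smult_l_distr intro: F.smult_closed F.M.finsum_cong')

lemma \<sigma>_scale: "\<sigma> (sA c v) = cl (scal c) \<odot>\<^bsub>F\<^esub> \<sigma> v"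
  unfolding \<sigma>_def coord_scale scal_simps H_class_mult[symmetric]
  by (subst F.smult_finsum) (auto simp: F.smult_assoc intro: F.smult_closed intro!: F.M.finsum_cong')

text \<open>If a homomorphism sends basis vectors to their images under a linear map
  \<open>j\<close>, then expanding in the basis changes nothing. It applies to the projection and to
  the map into an extension.\<close>

lemma hom_\<sigma>:
  assumes L: "left_module_hom H F L g" and j: "\<And>v w. j (v + w) = j v \<oplus>\<^bsub>L\<^esub> j w" "j 0 = \<zero>\<^bsub>L\<^esub>"
    "\<And>c v. j (sA c v) = cl (scal c) \<odot>\<^bsub>L\<^esub> j v" "\<And>v. g (unit v) = j v"
  shows "g (\<sigma> v) = j v"
proof -
  interpret g: left_module_hom H F L g by fact
  have jL: "j v \<in> carrier L" for v using g.closed[of "unit v"] j(4) by simp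
  have "g (\<sigma> v) = (\<Oplus>\<^bsub>L\<^esub>i\<in>I. g (cl (scal (coord i v)) \<odot>\<^bsub>F\<^esub> unit (e i)))"
    unfolding \<sigma>_def by (rule g.finsum_comm) (auto intro: F.smult_closed)
  also have "\<dots> = (\<Oplus>\<^bsub>L\<^esub>i\<in>I. j (sA (coord i v) (e i)))"
    by (rule g.N.M.finsum_cong') (auto simp: g.smult j jL simp flip: j(3))
  also have "\<dots> = j (\<Sum>i\<in>I. sA (coord i v) (e i))"
    using finite_I by induct (simp_all add: j jL g.N.smult_closed)
  finally show ?thesis using coord_sum[of v] by simp
qed

lemma pr_\<sigma>: "pr (\<sigma> v) = \<iota>V v"
  by (rule hom_\<sigma>[OF pr.left_module_hom_axioms])
    (simp_all add: V.\<iota>_add V.\<iota>_zero V.\<iota>_scale H_const_def pr_unit)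

text \<open>The defect of \<open>H\<close>-linearity of the section, evaluated by \<open>f\<close>.
  Its argument lies in \<open>K\<close> because \<open>\<sigma>\<close> splits
  \<open>pr\<close>.\<close>

definition \<delta> :: "(('v \<Rightarrow> 'k free_alg set) \<Rightarrow> 'w) \<Rightarrow> 'k free_alg \<Rightarrow> 'a \<Rightarrow> 'b" where
  "\<delta> f p v = W.co (f (cl p \<odot>\<^bsub>F\<^esub> \<sigma> v \<ominus>\<^bsub>F\<^esub> \<sigma> (act sA A p v)))"

definition D :: "(('v \<Rightarrow> 'k free_alg set) \<Rightarrow> 'w) \<Rightarrow> gen \<Rightarrow> 'a \<Rightarrow> 'b" where
  "D f x = \<delta> f (var x)"

lemma \<delta>_var: "\<delta> f (var x) v = D f x v"
  by (simp add: D_def)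

definition HomK where "HomK = module_hom H K W"

lemma \<sigma>_diff_K: "cl p \<odot>\<^bsub>F\<^esub> \<sigma> v \<ominus>\<^bsub>F\<^esub> \<sigma> (act sA A p v) \<in> carrier K"
  by (simp add: K_simps F.M.minus_closed F.smult_closed pr.diff pr.smult pr_\<sigma> V.\<iota>_act V.smult_closed
      V.M.r_neg a_minus_def[of V])

lemma pr_K_closed: "x \<in> carrier K \<Longrightarrow> x \<in> carrier F"
  by (simp add: K_simps)

lemma HomK_rules:
  assumes "f \<in> HomK"
  shows "x \<in> carrier K \<Longrightarrow> f x \<in> carrier W"
    and "\<lbrakk>x \<in> carrier K; y \<in> carrier K\<rbrakk> \<Longrightarrow> f (x \<oplus>\<^bsub>F\<^esub> y) = f x \<oplus>\<^bsub>W\<^esub> f y"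
    and "x \<in> carrier K \<Longrightarrow> f (cl p \<odot>\<^bsub>F\<^esub> x) = cl p \<odot>\<^bsub>W\<^esub> f x"
    and "f \<zero>\<^bsub>F\<^esub> = \<zero>\<^bsub>W\<^esub>"
proof -
  interpret f: left_module_hom H K W f by unfold_locales (use assms in \<open>simp add: HomK_def\<close>)
  show "x \<in> carrier K \<Longrightarrow> f x \<in> carrier W" by (rule f.closed)
  show "\<lbrakk>x \<in> carrier K; y \<in> carrier K\<rbrakk> \<Longrightarrow> f (x \<oplus>\<^bsub>F\<^esub> y) = f x \<oplus>\<^bsub>W\<^esub> f y"
    using f.add by (simp add: K_simps)
  show "x \<in> carrier K \<Longrightarrow> f (cl p \<odot>\<^bsub>F\<^esub> x) = cl p \<odot>\<^bsub>W\<^esub> f x"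
    using f.smult by (simp add: K_simps)
  show "f \<zero>\<^bsub>F\<^esub> = \<zero>\<^bsub>W\<^esub>" using f.zero by (simp add: K_simps)
qed

lemma K_smult_closed: "x \<in> carrier K \<Longrightarrow> cl p \<odot>\<^bsub>F\<^esub> x \<in> carrier K"
  using K.smult_closed[of "cl p" x] by (simp add: K_simps)

lemma \<delta>_eqI:
  assumes "f \<in> HomK" "x \<in> carrier K" "y \<in> carrier K"
    "cl p \<odot>\<^bsub>F\<^esub> \<sigma> v \<ominus>\<^bsub>F\<^esub> \<sigma> (act sA A p v) = x \<oplus>\<^bsub>F\<^esub> y"
  shows "\<delta> f p v = W.co (f x) + W.co (f y)"
  using assms by (simp add: \<delta>_def HomK_rules W.co_add)

lemma \<delta>_scal: "f \<in> HomK \<Longrightarrow> \<delta> f (scal c) v = 0"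
  by (simp add: \<delta>_def V.act_scal \<sigma>_scale F.smult_closed F.M.r_neg a_minus_def[of F] HomK_rules W.co_zero)

lemma \<delta>_add_left:
  assumes f: "f \<in> HomK" shows "\<delta> f (p + q) v = \<delta> f p v + \<delta> f q v"
  unfolding \<delta>_def[of f p v] \<delta>_def[of f q v]
proof (rule \<delta>_eqI[OF f \<sigma>_diff_K \<sigma>_diff_K])
  have cl: "cl r \<odot>\<^bsub>F\<^esub> \<sigma> v \<in> carrier F" for r by (simp add: F.smult_closed)
  show "cl (p + q) \<odot>\<^bsub>F\<^esub> \<sigma> v \<ominus>\<^bsub>F\<^esub> \<sigma> (act sA A (p + q) v) =
    (cl p \<odot>\<^bsub>F\<^esub> \<sigma> v \<ominus>\<^bsub>F\<^esub> \<sigma> (act sA A p v)) \<oplus>\<^bsub>F\<^esub> (cl q \<odot>\<^bsub>F\<^esub> \<sigma> v \<ominus>\<^bsub>F\<^esub> \<sigma> (act sA A q v))"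
    by (simp add: H_class_add[symmetric] F.smult_l_distr V.act_add_left \<sigma>_add a_minus_def[of F]
        F.M.minus_add cl F.M.a_ac)
qed

text \<open>Leibniz rule: insert \<open>q \<sigma>(p v)\<close> between
  \<open>q p \<sigma>(v)\<close> and \<open>\<sigma>(q p v)\<close>. Together with vanishing on
  constants it makes \<open>\<delta> f\<close> a derivation, so the generators determine it.\<close>

lemma \<delta>_mult:
  assumes f: "f \<in> HomK" shows "\<delta> f (q * p) v = act sB B q (\<delta> f p v) + \<delta> f q (act sA A p v)"
proof -
  let ?x = "cl p \<odot>\<^bsub>F\<^esub> \<sigma> v" and ?y = "\<sigma> (act sA A p v)" and ?z = "\<sigma> (act sA A q (act sA A p v))"
  have cl: "?x \<in> carrier F" "cl q \<odot>\<^bsub>F\<^esub> ?x \<in> carrier F" "cl q \<odot>\<^bsub>F\<^esub> ?y \<in> carrier F"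
    by (simp_all add: F.smult_closed)
  have "\<delta> f (q * p) v = W.co (f (cl q \<odot>\<^bsub>F\<^esub> (?x \<ominus>\<^bsub>F\<^esub> ?y))) + W.co (f (cl q \<odot>\<^bsub>F\<^esub> ?y \<ominus>\<^bsub>F\<^esub> ?z))"
  proof (rule \<delta>_eqI[OF f K_smult_closed[OF \<sigma>_diff_K] \<sigma>_diff_K])
    have "cl (q * p) \<odot>\<^bsub>F\<^esub> \<sigma> v = cl q \<odot>\<^bsub>F\<^esub> ?x" by (simp add: F.smult_assoc flip: H_class_mult)
    then show "cl (q * p) \<odot>\<^bsub>F\<^esub> \<sigma> v \<ominus>\<^bsub>F\<^esub> \<sigma> (act sA A (q * p) v) =
      cl q \<odot>\<^bsub>F\<^esub> (?x \<ominus>\<^bsub>F\<^esub> ?y) \<oplus>\<^bsub>F\<^esub> (cl q \<odot>\<^bsub>F\<^esub> ?y \<ominus>\<^bsub>F\<^esub> ?z)"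
      using cl by (simp add: V.act_mult a_minus_def[of F] F.smult_r_distr F.smult_r_minus F.M.a_ac
          F.M.r_neg1 F.M.r_neg2)
  qed
  also have "W.co (f (cl q \<odot>\<^bsub>F\<^esub> (?x \<ominus>\<^bsub>F\<^esub> ?y))) = act sB B q (\<delta> f p v)"
    using \<sigma>_diff_K[of p v] by (simp add: \<delta>_def HomK_rules[OF f] W.co_smult)
  finally show ?thesis by (simp add: \<delta>_def)
qed

lemma D_add:
  assumes f: "f \<in> HomK" shows "D f x (v + w) = D f x v + D f x w"
  unfolding D_def \<delta>_def[of f _ v] \<delta>_def[of f _ w]
proof (rule \<delta>_eqI[OF f \<sigma>_diff_K \<sigma>_diff_K])
  have cl: "cl r \<odot>\<^bsub>F\<^esub> \<sigma> v \<in> carrier F" for r v by (simp add: F.smult_closed)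
  show "cl p \<odot>\<^bsub>F\<^esub> \<sigma> (v + w) \<ominus>\<^bsub>F\<^esub> \<sigma> (act sA A p (v + w)) =
    (cl p \<odot>\<^bsub>F\<^esub> \<sigma> v \<ominus>\<^bsub>F\<^esub> \<sigma> (act sA A p v)) \<oplus>\<^bsub>F\<^esub> (cl p \<odot>\<^bsub>F\<^esub> \<sigma> w \<ominus>\<^bsub>F\<^esub> \<sigma> (act sA A p w))" for p
    by (simp add: F.smult_r_distr V.act_add \<sigma>_add a_minus_def[of F] F.M.minus_add cl F.M.a_ac)
qed

lemma D_scale:
  assumes f: "f \<in> HomK" shows "D f x (sA c v) = sB c (D f x v)"
proof -
  \<comment> \<open>Constants are central and have no defect, so the Leibniz rule applied in both
    orders gives homogeneity.\<close>
  have "\<delta> f (var x * scal c) v = \<delta> f (scal c * var x) v" by (simp add: scal_commute)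
  then show ?thesis by (simp add: \<delta>_mult[OF f] \<delta>_scal[OF f] V.act_scal W.act_scal W.act_zero D_def)
qed

lemma gen_rep_ext:
  assumes "\<And>x v w. Z x (v + w) = Z x v + Z x w" "\<And>x c v. Z x (sA c v) = sB c (Z x v)"
  shows "gen_rep sE (E Z)"
  by unfold_locales
    (auto simp: ext_scale_def ext_gen_def V.scale_right_distrib W.scale_right_distrib V.scale_left_distrib
      W.scale_left_distrib V.gen_add W.gen_add V.gen_scale W.gen_scale assms add_ac)

lemma act_ext_left:
  assumes "gen_rep sE (E Z)" shows "act sE (E Z) p (w, 0) = (act sB B p w, 0)"
proof -
  interpret E: gen_rep sE "E Z" by fact
  have "A x 0 = 0" "Z x 0 = 0" for x
    using E.act_zero[of "var x"] W.act_zero[of "var x"] unfolding E.act_var W.act_var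
    by (auto simp: ext_simps zero_prod_def)
  then show ?thesis
    by (induct p rule: free_alg_induct)
      (simp_all add: E.act_simps W.act_simps ext_simps)
qed

text \<open>The upper right block of \<open>p\<close> in the extension obeys the same Leibniz rule
  as \<open>\<delta> f\<close> and agrees with it on generators.\<close>

lemma act_ext_right:
  assumes f: "f \<in> HomK" shows "act sE (E (D f)) p (0, v) = (\<delta> f p v, act sA A p v)"
proof -
  interpret E: gen_rep sE "E (D f)" by (rule gen_rep_ext) (simp_all add: f D_add D_scale)
  show ?thesis
    by (induct p rule: free_alg_induct)
      (simp_all add: E.act_simps W.act_simps V.act_simps ext_simps \<delta>_scal f
        \<delta>_add_left \<delta>_mult \<delta>_var)
qed

text \<open>A relation is zero in \<open>H\<close> and acts as zero on \<open>V\<close>, so both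
  terms of its defect vanish.\<close>

lemma H_rep_D:
  assumes f: "f \<in> HomK" shows "H_rep sE (E (D f)) N M lam"
proof -
  interpret E: gen_rep sE "E (D f)" by (rule gen_rep_ext) (simp_all add: f D_add D_scale)
  show ?thesis
  proof
    fix r and u :: "'b \<times> 'a" assume r: "r \<in> H_rels N M lam"
    obtain w v where u: "u = (w, v)" by (cases u)
    have *: "cl r \<odot>\<^bsub>F\<^esub> \<sigma> v = \<zero>\<^bsub>F\<^esub>"
      by (simp add: H_class_eq_zero[OF H_rels_in_ideal[OF r]] F.smult_l_null)
    have "\<sigma> 0 = \<zero>\<^bsub>F\<^esub>" using \<sigma>_add[of 0 0] by (simp add: F.M.add.r_cancel_one')
    then have "\<delta> f r v = 0"
      by (simp add: \<delta>_def * V.rels[OF r] a_minus_def F.M.a_inv_zero HomK_rules[OF f] W.co_zero)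
    then have "act sE (E (D f)) r (w, 0) + act sE (E (D f)) r (0, v) = 0"
      by (simp add: act_ext_left E.gen_rep_axioms act_ext_right f V.rels W.rels r zero_prod_def)
    then show "act sE (E (D f)) r u = 0" by (simp flip: E.act_add add: u)
  qed
qed

text \<open>A block satisfying the relations makes the pairs an \<open>H\<close>-module over
  \<open>V\<close>. The projection \<open>pr\<close> lifts to it by freeness, and on the kernel of
  \<open>pr\<close> the lift takes values in \<open>W\<close>.\<close>

lemma HomK_onto:
  assumes "H_rep sE (E Z) N M lam"
  shows "\<exists>f\<in>HomK. D f = Z"
proof -
  interpret E: H_rep sE "E Z" N M lam by fact
  interpret EM: left_module H E.rep_module by (rule E.left_module_rep_module)
  \<comment> \<open>The basis vector of \<open>x\<close> goes to \<open>(0, V.co x)\<close>, that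
    is, along the linear section of the extension in which the blocks \<open>Z\<close> are written.
    This makes the block of \<open>f\<close> equal to \<open>Z\<close> itself.\<close>
  define G where "G = free_lift H E.rep_module (carrier V) (\<lambda>x. (0, V.co x))"
  interpret G: left_module_hom H F E.rep_module G
    by unfold_locales (simp add: G_def F_def EM.free_lift_hom E.rep_module_simps)
  interpret sn: left_module_hom H E.rep_module V "\<lambda>u. \<iota>V (snd u)"
  proof (unfold_locales, unfold module_hom_def, intro CollectI conjI allI impI)
    fix r u assume "r \<in> carrier H \<and> u \<in> carrier E.rep_module"
    then obtain p where r: "r = cl p" by (metis carrier_H_algE)
    have "snd (act sE (E Z) p u) = act sA A p (snd u)"
      by (induct p rule: free_alg_induct)
        (simp_all add: E.act_simps V.act_simps ext_simps)
    then show "\<iota>V (snd (r \<odot>\<^bsub>E.rep_module\<^esub> u)) = r \<odot>\<^bsub>V\<^esub> \<iota>V (snd u)"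
      by (simp add: r E.rep_module_smult V.\<iota>_act)
  qed (simp_all add: E.rep_module_simps V.\<iota>_add)
  have snd_G: "\<iota>V (snd (G x)) = pr x" if "x \<in> carrier F" for x
  proof -
    have "\<iota>V (snd (G x)) = free_lift H V (carrier V) (\<lambda>s. \<iota>V (V.co s)) x"
      using that unfolding G_def F_def by (subst sn.free_lift_comp) (simp_all add: E.rep_module_simps)
    also have "\<dots> = pr x"
      unfolding pr_def free_map_eq_free_lift free_lift_def
      using that V.R.free_module_val[of x "carrier V"]
      by (intro V.M.finsum_cong') (auto intro!: V.smult_closed simp: F_def)
    finally show ?thesis .
  qed
  have G_unit: "G (unit v) = (0, v)" for v
    unfolding G_def unit_def by (subst EM.free_lift_unit) (simp_all add: E.rep_module_simps)
  have G_\<sigma>: "G (\<sigma> v) = (0, v)" for v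
    by (rule hom_\<sigma>[OF G.left_module_hom_axioms])
      (simp_all add: G_unit E.rep_module_simps E.rep_module_smult E.act_scal ext_simps zero_prod_def)
  \<comment> \<open>On \<open>K\<close> the second component is \<open>pr x = 0\<close>, so only the
    part in \<open>W\<close> is left.\<close>
  have G_K: "G x = (fst (G x), 0)" if "x \<in> carrier K" for x
  proof -
    have "\<iota>V (snd (G x)) = \<iota>V 0" using that snd_G by (simp add: K_simps V.\<iota>_zero)
    then show ?thesis by (simp add: V.\<iota>_inject prod_eq_iff)
  qed
  define f where "f x = \<iota>W (fst (G x))" for x
  have f: "f \<in> HomK"
    unfolding HomK_def module_hom_def
  proof (intro CollectI conjI allI impI)
    fix r x assume "r \<in> carrier H \<and> x \<in> carrier K"
    then obtain p where r: "r = cl p" and x: "x \<in> carrier K" by (metis carrier_H_algE)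
    have "G (cl p \<odot>\<^bsub>F\<^esub> x) = act sE (E Z) p (fst (G x), 0)"
      using x G_K[OF x] by (simp add: G.smult pr_K_closed E.rep_module_smult)
    then show "f (r \<odot>\<^bsub>K\<^esub> x) = r \<odot>\<^bsub>W\<^esub> f x"
      by (simp add: f_def r K_simps act_ext_left E.gen_rep_axioms W.\<iota>_act)
  qed (simp_all add: f_def K_simps G.add E.rep_module_simps W.\<iota>_add)
  have "D f x v = Z x v" for x v
  proof -
    have "G (cl (var x) \<odot>\<^bsub>F\<^esub> \<sigma> v \<ominus>\<^bsub>F\<^esub> \<sigma> (A x v)) = act sE (E Z) (var x) (0, v) \<ominus>\<^bsub>E.rep_module\<^esub> (0, A x v)"
      by (simp add: G.diff F.smult_closed G.smult G_\<sigma> E.rep_module_smult)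
    also have "\<dots> = (Z x v, 0)"
    proof -
      have "\<ominus>\<^bsub>E.rep_module\<^esub> (0, A x v) = (0, - A x v)"
        by (rule EM.M.minus_equality) (simp_all add: E.rep_module_simps zero_prod_def)
      then show ?thesis
        by (simp add: a_minus_def E.rep_module_simps E.act_var ext_simps W.act_zero flip: W.act_var)
    qed
    finally show ?thesis by (simp add: D_def \<delta>_def V.act_var f_def)
  qed
  then show ?thesis using f by blast
qed

text \<open>A homomorphism \<open>g\<close> on \<open>F\<close> is determined by its restriction to
  \<open>K\<close> and by its values on the section, and \<open>- g \<circ> \<sigma>\<close> plays
  the role of \<open>T\<close>. Compatibility of the two pieces with \<open>H\<close> is exactly the
  condition on an inner block.\<close>

lemma inner_iff:
  assumes f: "f \<in> HomK"
  shows "inner sB B sA A (D f) \<longleftrightarrow> (\<exists>g\<in>module_hom H F W. \<forall>x\<in>carrier K. f x = g x)"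
proof
  assume "\<exists>g\<in>module_hom H F W. \<forall>x\<in>carrier K. f x = g x"
  then obtain g where g: "g \<in> module_hom H F W" "\<And>x. x \<in> carrier K \<Longrightarrow> f x = g x" by blast
  interpret g: left_module_hom H F W g by unfold_locales (rule g(1))
  \<comment> \<open>The minus sign matches the convention \<open>T A - B T\<close> in
    \<open>inner\<close>: the defect under \<open>g\<close> is
    \<open>B (g \<sigma>) - (g \<sigma>) A\<close>.\<close>
  define T where "T v = - W.co (g (\<sigma> v))" for v
  have "T (v + w) = T v + T w" for v w
    by (simp add: T_def \<sigma>_add g.add W.co_add g.closed)
  moreover have "T (sA c v) = sB c (T v)" for c v
    by (simp add: T_def \<sigma>_scale g.smult W.co_smult g.closed W.act_scal)
  moreover have "D f x v = T (A x v) - B x (T v)" for x v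
  proof -
    have "f (cl (var x) \<odot>\<^bsub>F\<^esub> \<sigma> v \<ominus>\<^bsub>F\<^esub> \<sigma> (A x v)) = cl (var x) \<odot>\<^bsub>W\<^esub> g (\<sigma> v) \<ominus>\<^bsub>W\<^esub> g (\<sigma> (A x v))"
      using g(2)[OF \<sigma>_diff_K[of "var x" v]] by (simp add: V.act_var g.diff g.smult F.smult_closed)
    then have "D f x v = act sB B (var x) (W.co (g (\<sigma> v))) - W.co (g (\<sigma> (A x v)))"
      by (simp add: D_def \<delta>_def V.act_var W.co_diff g.closed W.smult_closed W.co_smult)
    moreover have "B x (- w) = - B x w" for w
      using W.act_minus[of "var x" w] by (simp add: W.act_var)
    ultimately show ?thesis by (simp add: T_def W.act_var)
  qed
  ultimately show "inner sB B sA A (D f)" unfolding inner_def by blast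
next
  assume "inner sB B sA A (D f)"
  then obtain T where T: "\<And>v w. T (v + w) = T v + T w" "\<And>c v. T (sA c v) = sB c (T v)"
    "\<And>x v. D f x v = T (A x v) - B x (T v)"
    unfolding inner_def by blast
  \<comment> \<open>The graph of \<open>T\<close> is stable under the generators, hence under every
    \<open>p\<close>; comparing first components on \<open>(T v, v)\<close> extends the formula from
    generators to the free algebra.\<close>
  have \<delta>_T: "\<delta> f p v = T (act sA A p v) - act sB B p (T v)" for p v
  proof -
    interpret E: H_rep sE "E (D f)" N M lam by (rule H_rep_D[OF f])
    have "B x (T v) + D f x v = T (A x v)" for x v by (simp add: T(3))
    then have "act sE (E (D f)) p (T v, v) = (T (act sA A p v), act sA A p v)"
      by (induct p rule: free_alg_induct)
        (simp_all add: E.act_simps V.act_simps ext_simps T(1,2))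
    moreover have "act sE (E (D f)) p (T v, v) = act sE (E (D f)) p (T v, 0) + act sE (E (D f)) p (0, v)"
      by (simp flip: E.act_add)
    ultimately show ?thesis
      by (simp add: act_ext_left E.gen_rep_axioms act_ext_right f eq_diff_eq add.commute)
  qed
  define s where "s x = \<sigma> (V.co (pr x))" for x
  have s: "s x \<in> carrier F" "x \<ominus>\<^bsub>F\<^esub> s x \<in> carrier K" if "x \<in> carrier F" for x
    using that by (simp_all add: s_def K_simps F.M.minus_closed pr.diff pr_\<sigma> pr.closed V.M.r_neg a_minus_def[of V])
  \<comment> \<open>Split \<open>x\<close> into \<open>x - s x\<close>, which lies in
    \<open>K\<close> and is handled by \<open>f\<close>, and
    \<open>s x = \<sigma> (V.co (pr x))\<close>, where the value \<open>- T\<close> is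
    prescribed.\<close>
  define g where "g x = f (x \<ominus>\<^bsub>F\<^esub> s x) \<ominus>\<^bsub>W\<^esub> \<iota>W (T (V.co (pr x)))" for x
  have g_closed: "g x \<in> carrier W" if "x \<in> carrier F" for x
    using that s by (simp add: g_def HomK_rules[OF f] W.M.minus_closed)
  have co_g: "W.co (g x) = W.co (f (x \<ominus>\<^bsub>F\<^esub> s x)) - T (V.co (pr x))" if "x \<in> carrier F" for x
    using that s by (simp add: g_def W.co_diff HomK_rules[OF f])
  have "g \<in> module_hom H F W"
    unfolding module_hom_def
  proof (intro CollectI conjI allI impI)
    show "g \<in> carrier F \<rightarrow> carrier W" using g_closed by auto
  next
    fix x y assume xy: "x \<in> carrier F \<and> y \<in> carrier F"
    have "x \<oplus>\<^bsub>F\<^esub> y \<ominus>\<^bsub>F\<^esub> s (x \<oplus>\<^bsub>F\<^esub> y) = (x \<ominus>\<^bsub>F\<^esub> s x) \<oplus>\<^bsub>F\<^esub> (y \<ominus>\<^bsub>F\<^esub> s y)"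
      using xy by (simp add: s_def pr.add V.co_add pr.closed \<sigma>_add a_minus_def[of F] F.M.minus_add F.M.a_ac)
    then have "W.co (g (x \<oplus>\<^bsub>F\<^esub> y)) = W.co (g x \<oplus>\<^bsub>W\<^esub> g y)"
      using xy s by (simp add: co_g HomK_rules[OF f] W.co_add g_closed pr.add V.co_add pr.closed T)
    then show "g (x \<oplus>\<^bsub>F\<^esub> y) = g x \<oplus>\<^bsub>W\<^esub> g y"
      using xy g_closed by (metis W.\<iota>_co F.M.add.m_closed W.M.add.m_closed)
  next
    fix r x assume rx: "r \<in> carrier H \<and> x \<in> carrier F"
    then obtain p where r: "r = cl p" and x: "x \<in> carrier F" by (metis carrier_H_algE)
    let ?v = "V.co (pr x)"
    have cls: "cl p \<odot>\<^bsub>F\<^esub> x \<in> carrier F" "cl p \<odot>\<^bsub>F\<^esub> s x \<in> carrier F"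
      using x s by (simp_all add: F.smult_closed)
    have v: "V.co (pr (cl p \<odot>\<^bsub>F\<^esub> x)) = act sA A p ?v"
      using x by (simp add: pr.smult V.co_smult pr.closed)
    have "cl p \<odot>\<^bsub>F\<^esub> x \<ominus>\<^bsub>F\<^esub> s (cl p \<odot>\<^bsub>F\<^esub> x) =
        cl p \<odot>\<^bsub>F\<^esub> (x \<ominus>\<^bsub>F\<^esub> s x) \<oplus>\<^bsub>F\<^esub> (cl p \<odot>\<^bsub>F\<^esub> \<sigma> ?v \<ominus>\<^bsub>F\<^esub> \<sigma> (act sA A p ?v))"
      using x cls by (simp add: s_def v a_minus_def[of F] F.smult_r_distr F.smult_r_minus F.M.a_ac
          F.M.r_neg F.M.r_neg1 F.M.r_neg2)
    then have "f (cl p \<odot>\<^bsub>F\<^esub> x \<ominus>\<^bsub>F\<^esub> s (cl p \<odot>\<^bsub>F\<^esub> x)) =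
        cl p \<odot>\<^bsub>W\<^esub> f (x \<ominus>\<^bsub>F\<^esub> s x) \<oplus>\<^bsub>W\<^esub> f (cl p \<odot>\<^bsub>F\<^esub> \<sigma> ?v \<ominus>\<^bsub>F\<^esub> \<sigma> (act sA A p ?v))"
      using s[OF x] by (simp add: HomK_rules[OF f] K_smult_closed \<sigma>_diff_K)
    then have "W.co (g (cl p \<odot>\<^bsub>F\<^esub> x)) = act sB B p (W.co (f (x \<ominus>\<^bsub>F\<^esub> s x))) + \<delta> f p ?v - T (act sA A p ?v)"
      using s[OF x] by (simp add: co_g cls v W.co_add W.co_smult W.smult_closed HomK_rules[OF f] \<sigma>_diff_K \<delta>_def)
    also have "\<dots> = act sB B p (W.co (g x))"
      by (simp add: \<delta>_T co_g x W.act_diff)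
    finally have "W.co (g (cl p \<odot>\<^bsub>F\<^esub> x)) = W.co (cl p \<odot>\<^bsub>W\<^esub> g x)" by (simp add: W.co_smult g_closed x)
    then show "g (r \<odot>\<^bsub>F\<^esub> x) = r \<odot>\<^bsub>W\<^esub> g x"
      unfolding r using x g_closed cls by (metis W.\<iota>_co H_class_in_carrier W.smult_closed)
  qed
  moreover have "f x = g x" if "x \<in> carrier K" for x
  proof -
    have "T 0 = 0" using T(1)[of 0 0] by simp
    moreover have "\<sigma> 0 = \<zero>\<^bsub>F\<^esub>" using \<sigma>_add[of 0 0] by (simp add: F.M.add.r_cancel_one')
    ultimately show ?thesis
      using that HomK_rules(1)[OF f that]
      by (simp add: g_def s_def K_simps V.co_zero W.\<iota>_zero a_minus_def F.M.a_inv_zero W.M.a_inv_zero)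
  qed
  ultimately show "\<exists>g\<in>module_hom H F W. \<forall>x\<in>carrier K. f x = g x" by blast
qed

lemma inner_lincomb:
  assumes "inner sB B sA A X" "inner sB B sA A Y"
  shows "inner sB B sA A (\<lambda>x v. sB a (X x v) + sB b (Y x v))"
proof -
  obtain T where T: "\<And>v w. T (v + w) = T v + T w" "\<And>c v. T (sA c v) = sB c (T v)"
    "\<And>x v. X x v = T (A x v) - B x (T v)"
    using assms(1) unfolding inner_def by blast
  obtain S where S: "\<And>v w. S (v + w) = S v + S w" "\<And>c v. S (sA c v) = sB c (S v)"
    "\<And>x v. Y x v = S (A x v) - B x (S v)"
    using assms(2) unfolding inner_def by blast
  show ?thesis unfolding inner_def
    by (rule exI[of _ "\<lambda>v. sB a (T v) + sB b (S v)"])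
      (simp add: T S W.scale_right_distrib W.scale_right_diff_distrib W.gen_add W.gen_scale mult.commute)
qed

text \<open>The blocks \<open>Z a\<close> are a linear family of representatives for all blocks
  modulo the inner ones. The coordinate vector of a cocycle is the unique \<open>a\<close> for which
  its block minus \<open>Z a\<close> is inner.\<close>

theorem has_dim_H_ext1:
  fixes Z :: "'k vec \<Rightarrow> gen \<Rightarrow> 'a \<Rightarrow> 'b"
  assumes Z_add: "\<And>a b x v. \<lbrakk>a \<in> carrier_vec n; b \<in> carrier_vec n\<rbrakk> \<Longrightarrow> Z (a + b) x v = Z a x v + Z b x v"
    and Z_scale: "\<And>a c x v. a \<in> carrier_vec n \<Longrightarrow> Z (c \<cdot>\<^sub>v a) x v = sB c (Z a x v)"
    and Z_rep: "\<And>a. a \<in> carrier_vec n \<Longrightarrow> H_rep sE (E (Z a)) N M lam"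
    and Z_inner: "\<And>a. \<lbrakk>a \<in> carrier_vec n; inner sB B sA A (Z a)\<rbrakk> \<Longrightarrow> a = 0\<^sub>v n"
    and Z_span: "\<And>X. H_rep sE (E X) N M lam \<Longrightarrow> \<exists>a\<in>carrier_vec n. inner sB B sA A (\<lambda>x v. X x v - Z a x v)"
  shows "has_dim (H_ext1 N M lam V W) n"
proof -
  define P where "P f a \<longleftrightarrow> a \<in> carrier_vec n \<and> inner sB B sA A (\<lambda>x v. D f x v - Z a x v)" for f a
  define L where "L f = (SOME a. P f a)" for f
  have P_ex: "\<exists>a. P f a" if "f \<in> HomK" for f
    using Z_span[OF H_rep_D[OF that]] by (auto simp: P_def)
  have P_lincomb: "P h (c \<cdot>\<^sub>v a + d \<cdot>\<^sub>v b)"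
    if "P f a" "P g b" "\<And>x v. D h x v = sB c (D f x v) + sB d (D g x v)" for f g h a b c d
  proof -
    have ab: "a \<in> carrier_vec n" "b \<in> carrier_vec n" using that by (auto simp: P_def)
    have "inner sB B sA A (\<lambda>x v. sB c (D f x v - Z a x v) + sB d (D g x v - Z b x v))"
      using that by (intro inner_lincomb) (auto simp: P_def)
    also have "(\<lambda>x v. sB c (D f x v - Z a x v) + sB d (D g x v - Z b x v)) =
        (\<lambda>x v. D h x v - Z (c \<cdot>\<^sub>v a + d \<cdot>\<^sub>v b) x v)"
      using ab by (simp add: fun_eq_iff that(3) Z_add Z_scale W.scale_right_diff_distrib)
    finally show ?thesis using ab by (simp add: P_def)
  qed
  \<comment> \<open>Formulated for two homomorphisms with equal blocks, so that it also shows that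
    \<open>L\<close> depends only on the restriction to \<open>K\<close>.\<close>
  have P_unique: "a = b" if "P f a" "P g b" "\<And>x v. D f x v = D g x v" for f g a b
  proof -
    have ab: "a \<in> carrier_vec n" "b \<in> carrier_vec n" using that by (auto simp: P_def)
    have "inner sB B sA A (\<lambda>x v. sB (- 1) (D f x v - Z a x v) + sB 1 (D g x v - Z b x v))"
      using that by (intro inner_lincomb) (auto simp: P_def)
    also have "(\<lambda>x v. sB (- 1) (D f x v - Z a x v) + sB 1 (D g x v - Z b x v)) = Z (a + (- 1) \<cdot>\<^sub>v b)"
      using ab by (simp add: fun_eq_iff that(3) Z_add Z_scale)
    finally have "a + (- 1) \<cdot>\<^sub>v b = 0\<^sub>v n" using ab by (intro Z_inner) auto
    then have "(a + (- 1) \<cdot>\<^sub>v b) $ i = 0" if "i < n" for i using that by simp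
    then have "a $ i = b $ i" if "i < n" for i using that ab by simp
    then show ?thesis using ab by (auto intro!: eq_vecI)
  qed
  have P_L: "P f (L f)" if "f \<in> HomK" for f
    unfolding L_def using P_ex[OF that] by (rule someI_ex)
  have L_cl: "L f \<in> carrier_vec n" if "f \<in> HomK" for f using P_L[OF that] by (simp add: P_def)
  have LI: "L f = a" if "f \<in> HomK" "P f a" for f a
    using P_unique[OF P_L[OF that(1)] that(2)] by simp
  note K_eq = K_def[symmetric] and F_eq = F_def[symmetric]
  have HomK': "f \<in> module_hom H K W \<longleftrightarrow> f \<in> HomK" for f by (simp add: HomK_def)
  have D_val: "D f x v = W.co (f (cl (var x) \<odot>\<^bsub>F\<^esub> \<sigma> v \<ominus>\<^bsub>F\<^esub> \<sigma> (act sA A (var x) v)))" for f x v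
    by (simp add: D_def \<delta>_def)
  show ?thesis
    unfolding H_ext1_def
  proof (rule has_dim_ext1[where L = L]; (unfold K_eq F_eq HomK')?)
    show "left_module H V" "left_module H W" by (rule V.left_module W.left_module)+
    show "H_const N M lam c \<in> carrier H" for c by simp
    show "r \<in> carrier H \<Longrightarrow> H_const N M lam c \<otimes>\<^bsub>H\<^esub> r = r \<otimes>\<^bsub>H\<^esub> H_const N M lam c" for c r
      by (rule H_const_central)
    show "L f = L g" if "f \<in> HomK" "g \<in> HomK" "\<forall>x\<in>carrier K. f x = g x" for f g
      using that \<sigma>_diff_K by (intro P_unique[OF P_L P_L, of f g]) (simp_all add: D_val)
    show "L (\<lambda>x. f x \<oplus>\<^bsub>W\<^esub> g x) = L f + L g" if "f \<in> HomK" "g \<in> HomK" for f g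
    proof (rule LI)
      show fg: "(\<lambda>x. f x \<oplus>\<^bsub>W\<^esub> g x) \<in> HomK"
        unfolding HomK_def module_hom_def
      proof (intro CollectI conjI allI impI)
        fix r x assume "r \<in> carrier H \<and> x \<in> carrier K"
        then obtain p where "r = cl p" "x \<in> carrier K" by (metis carrier_H_algE)
        then show "f (r \<odot>\<^bsub>K\<^esub> x) \<oplus>\<^bsub>W\<^esub> g (r \<odot>\<^bsub>K\<^esub> x) = r \<odot>\<^bsub>W\<^esub> (f x \<oplus>\<^bsub>W\<^esub> g x)"
          using that by (simp add: K_simps(4) HomK_rules W.smult_r_distr)
      qed (use that in \<open>auto simp: K_simps(3) HomK_rules W.M.a_ac\<close>)
      have "P (\<lambda>x. f x \<oplus>\<^bsub>W\<^esub> g x) (1 \<cdot>\<^sub>v L f + 1 \<cdot>\<^sub>v L g)"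
        using that by (intro P_lincomb[OF P_L P_L])
          (simp_all add: D_val W.co_add HomK_rules \<sigma>_diff_K)
      then show "P (\<lambda>x. f x \<oplus>\<^bsub>W\<^esub> g x) (L f + L g)" by simp
    qed
    show "L (\<lambda>x. H_const N M lam c \<odot>\<^bsub>W\<^esub> f x) = c \<cdot>\<^sub>v L f" if f: "f \<in> HomK" for c f
    proof (rule LI)
      show "(\<lambda>x. H_const N M lam c \<odot>\<^bsub>W\<^esub> f x) \<in> HomK"
        unfolding HomK_def module_hom_def
      proof (intro CollectI conjI allI impI)
        fix r x assume "r \<in> carrier H \<and> x \<in> carrier K"
        then obtain p where "r = cl p" "x \<in> carrier K" by (metis carrier_H_algE)
        then show "H_const N M lam c \<odot>\<^bsub>W\<^esub> f (r \<odot>\<^bsub>K\<^esub> x) = r \<odot>\<^bsub>W\<^esub> (H_const N M lam c \<odot>\<^bsub>W\<^esub> f x)"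
          using f by (simp add: K_simps(4) HomK_rules H_const_central flip: W.smult_assoc)
      qed (use f in \<open>auto simp: K_simps(3) HomK_rules W.smult_r_distr W.smult_closed\<close>)
      have "P (\<lambda>x. H_const N M lam c \<odot>\<^bsub>W\<^esub> f x) (c \<cdot>\<^sub>v L f + 0 \<cdot>\<^sub>v L f)"
        using f by (intro P_lincomb[OF P_L P_L])
          (simp_all add: D_val W.co_smult H_const_def HomK_rules \<sigma>_diff_K W.act_scal)
      moreover have "c \<cdot>\<^sub>v L f + 0 \<cdot>\<^sub>v L f = c \<cdot>\<^sub>v L f"
        using L_cl[OF f] by (intro eq_vecI) auto
      ultimately show "P (\<lambda>x. H_const N M lam c \<odot>\<^bsub>W\<^esub> f x) (c \<cdot>\<^sub>v L f)" by simp
    qed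
    show "L ` module_hom H K W = carrier_vec n"
    proof
      show "L ` module_hom H K W \<subseteq> carrier_vec n" using L_cl by (auto simp: HomK')
      show "carrier_vec n \<subseteq> L ` module_hom H K W"
      proof
        fix a :: "'k vec" assume a: "a \<in> carrier_vec n"
        obtain f where f: "f \<in> HomK" "D f = Z a" using HomK_onto[OF Z_rep[OF a]] by blast
        have "inner sB B sA A (\<lambda>x v. 0)"
          unfolding inner_def by (rule exI[of _ "\<lambda>v. 0"]) (use W.act_zero[of "var _"] in \<open>simp add: W.act_var\<close>)
        then have "P f a" using a f by (simp add: P_def)
        then have "a = L f" using LI f(1) by simp
        then show "a \<in> L ` module_hom H K W" using f(1) by (simp add: HomK' image_eqI)
      qed
    qed
    show "L f = 0\<^sub>v n \<longleftrightarrow> (\<exists>g\<in>module_hom H F W. \<forall>x\<in>carrier K. f x = g x)" if f: "f \<in> HomK" for f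
    proof -
      have "0 \<cdot>\<^sub>v 0\<^sub>v n = (0\<^sub>v n :: 'k vec)" by (intro eq_vecI) auto
      then have "Z (0\<^sub>v n) x v = 0" for x v using Z_scale[of "0\<^sub>v n" 0 x v] by simp
      then have "P f (0\<^sub>v n) \<longleftrightarrow> inner sB B sA A (D f)" by (simp add: P_def)
      moreover have "L f = 0\<^sub>v n \<longleftrightarrow> P f (0\<^sub>v n)" using P_L[OF f] LI[OF f] by metis
      ultimately show ?thesis using inner_iff[OF f] by simp
    qed
  qed
qed

end

section \<open>Linear combinations of extensions; criteria for dimension 0, 1 and 2\<close>

context H_model_pair
begin

text \<open>A product of block triangular matrices has an upper right entry linear in the upper
  right blocks: each summand contains exactly one of them.\<close>

lemma act_ext_lincomb:
  assumes X: "gen_rep sE (E X)" and Y: "gen_rep sE (E Y)"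
    and XY: "gen_rep sE (E (\<lambda>x v. sB a (X x v) + sB b (Y x v)))"
  shows "act sE (E (\<lambda>x v. sB a (X x v) + sB b (Y x v))) p (0, v) =
    (sB a (fst (act sE (E X) p (0, v))) + sB b (fst (act sE (E Y) p (0, v))), act sA A p v)"
proof -
  interpret X: gen_rep sE "E X" by fact
  interpret Y: gen_rep sE "E Y" by fact
  interpret XY: gen_rep sE "E (\<lambda>x v. sB a (X x v) + sB b (Y x v))" by fact
  have snd_act: "snd (act sE (E X) p u) = act sA A p (snd u)" if "gen_rep sE (E X)" for X p u
  proof -
    interpret X: gen_rep sE "E X" by fact
    show ?thesis
      by (induct p rule: free_alg_induct) (simp_all add: X.act_simps V.act_simps ext_simps)
  qed
  have E_fst: "fst (E X x u) = B x (fst u) + X x (snd u)" for X x u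
    by (cases u) (simp add: ext_simps)
  show ?thesis
    by (induct p rule: free_alg_induct)
      (simp_all add: X.act_simps Y.act_simps XY.act_simps V.act_simps ext_simps E_fst snd_act X Y
        W.scale_right_distrib W.gen_add W.gen_scale)
qed

lemma gen_rep_extD:
  assumes "gen_rep sE (E X)"
  shows "X x (v + w) = X x v + X x w" "X x (sA c v) = sB c (X x v)"
proof -
  interpret X: gen_rep sE "E X" by fact
  have B0: "B x 0 = 0" using W.act_zero[of "var x"] by (simp add: W.act_var)
  show "X x (v + w) = X x v + X x w"
    using X.gen_add[of x "(0, v)" "(0, w)"] by (simp add: ext_simps B0)
  show "X x (sA c v) = sB c (X x v)"
    using X.gen_scale[of x c "(0, v)"] by (simp add: ext_simps B0)
qed

text \<open>The diagonal blocks satisfy the relations already, so only the upper right entry of each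
  relation has to be checked.\<close>

lemma H_rep_extI:
  assumes X: "gen_rep sE (E X)" and r: "\<And>r v. r \<in> H_rels N M lam \<Longrightarrow> fst (act sE (E X) r (0, v)) = 0"
  shows "H_rep sE (E X) N M lam"
proof -
  interpret X: gen_rep sE "E X" by fact
  have snd_act: "snd (act sE (E X) p u) = act sA A p (snd u)" for p u
    by (induct p rule: free_alg_induct) (simp_all add: X.act_simps V.act_simps ext_simps)
  show ?thesis
  proof
    fix r and u :: "'b \<times> 'a" assume rr: "r \<in> H_rels N M lam"
    obtain w v where u: "u = (w, v)" by (cases u)
    have "act sE (E X) r (w, 0) = 0"
      by (simp add: act_ext_left X W.rels rr zero_prod_def)
    moreover have "act sE (E X) r (0, v) = 0"
      using r[OF rr] by (simp add: prod_eq_iff snd_act V.rels rr)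
    ultimately show "act sE (E X) r u = 0" using X.act_add[of r "(w, 0)" "(0, v)"] by (simp add: u)
  qed
qed

lemma H_rep_lincomb:
  assumes X: "H_rep sE (E X) N M lam" and Y: "H_rep sE (E Y) N M lam"
  shows "H_rep sE (E (\<lambda>x v. sB a (X x v) + sB b (Y x v))) N M lam"
proof -
  interpret X: H_rep sE "E X" N M lam by fact
  interpret Y: H_rep sE "E Y" N M lam by fact
  have XY: "gen_rep sE (E (\<lambda>x v. sB a (X x v) + sB b (Y x v)))"
    by (rule gen_rep_ext)
      (simp_all add: gen_rep_extD[OF X.gen_rep_axioms] gen_rep_extD[OF Y.gen_rep_axioms]
        W.scale_right_distrib mult.commute)
  show ?thesis
    by (rule H_rep_extI[OF XY])
      (simp add: act_ext_lincomb[OF X.gen_rep_axioms Y.gen_rep_axioms XY] X.rels Y.rels)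
qed

lemma H_rep_zero: "H_rep sE (E (\<lambda>_ _. 0)) N M lam"
proof -
  have *: "gen_rep sE (E (\<lambda>_ _. 0))" by (rule gen_rep_ext) simp_all
  interpret E: gen_rep sE "E (\<lambda>_ _. 0)" by fact
  have "act sE (E (\<lambda>_ _. 0)) p (0, v) = (0, act sA A p v)" for p v
    using W.act_zero[of "var _"]
    by (induct p rule: free_alg_induct) (simp_all add: E.act_simps V.act_simps ext_simps W.act_var)
  then show ?thesis by (intro H_rep_extI *) simp
qed

lemma has_dim_H_ext1_0:
  assumes "\<And>X. H_rep sE (E X) N M lam \<Longrightarrow> inner sB B sA A X"
  shows "has_dim (H_ext1 N M lam V W) 0"
  by (rule has_dim_H_ext1[where Z = "\<lambda>_ _ _. 0"])
    (use assms H_rep_zero in \<open>auto intro!: exI[of _ "0\<^sub>v 0"]\<close>)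

lemma has_dim_H_ext1_1:
  assumes Z: "H_rep sE (E Z) N M lam"
    and inner_Z: "\<And>c. inner sB B sA A (\<lambda>x v. sB c (Z x v)) \<Longrightarrow> c = 0"
    and span: "\<And>X. H_rep sE (E X) N M lam \<Longrightarrow> \<exists>c. inner sB B sA A (\<lambda>x v. X x v - sB c (Z x v))"
  shows "has_dim (H_ext1 N M lam V W) 1"
proof (rule has_dim_H_ext1[where Z = "\<lambda>a x v. sB (a $ 0) (Z x v)"])
  fix a :: "'k vec" assume a: "a \<in> carrier_vec 1"
  show "H_rep sE (E (\<lambda>x v. sB (a $ 0) (Z x v))) N M lam"
    using H_rep_lincomb[OF Z Z, of "a $ 0" 0] by simp
  show "a = 0\<^sub>v 1" if "inner sB B sA A (\<lambda>x v. sB (a $ 0) (Z x v))"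
    using inner_Z[OF that] a by (intro eq_vecI) auto
next
  fix X assume "H_rep sE (E X) N M lam"
  then obtain c where "inner sB B sA A (\<lambda>x v. X x v - sB c (Z x v))" using span by blast
  then show "\<exists>a\<in>carrier_vec 1. inner sB B sA A (\<lambda>x v. X x v - sB (a $ 0) (Z x v))"
    by (intro bexI[of _ "vec 1 (\<lambda>_. c)"]) simp_all
qed (simp_all add: W.scale_left_distrib)

lemma has_dim_H_ext1_2:
  assumes Z: "H_rep sE (E Z) N M lam" and Y: "H_rep sE (E Y) N M lam"
    and inner_ZY: "\<And>c d. inner sB B sA A (\<lambda>x v. sB c (Z x v) + sB d (Y x v)) \<Longrightarrow> c = 0 \<and> d = 0"
    and span: "\<And>X. H_rep sE (E X) N M lam \<Longrightarrow>
      \<exists>c d. inner sB B sA A (\<lambda>x v. X x v - (sB c (Z x v) + sB d (Y x v)))"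
  shows "has_dim (H_ext1 N M lam V W) 2"
proof (rule has_dim_H_ext1[where Z = "\<lambda>a x v. sB (a $ 0) (Z x v) + sB (a $ 1) (Y x v)"])
  fix a :: "'k vec" assume a: "a \<in> carrier_vec 2"
  show "H_rep sE (E (\<lambda>x v. sB (a $ 0) (Z x v) + sB (a $ 1) (Y x v))) N M lam"
    by (rule H_rep_lincomb[OF Z Y])
  show "a = 0\<^sub>v 2" if "inner sB B sA A (\<lambda>x v. sB (a $ 0) (Z x v) + sB (a $ 1) (Y x v))"
    using inner_ZY[OF that] a by (intro eq_vecI) (auto simp: less_2_cases_iff)
next
  fix X assume "H_rep sE (E X) N M lam"
  then obtain c d where "inner sB B sA A (\<lambda>x v. X x v - (sB c (Z x v) + sB d (Y x v)))" using span by blast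
  then show "\<exists>a\<in>carrier_vec 2. inner sB B sA A (\<lambda>x v. X x v - (sB (a $ 0) (Z x v) + sB (a $ 1) (Y x v)))"
    by (intro bexI[of _ "vec 2 (\<lambda>i. if i = 0 then c else d)"]) simp_all
qed (simp_all add: W.scale_left_distrib W.scale_right_distrib add_ac)

end

section \<open>The defining relations on vectors\<close>

lemma (in gen_rep) act_var_fun: "act s A (var x) = A x"
  by (simp add: fun_eq_iff act_var)

lemma (in gen_rep) H_rep_iff:
  "H_rep s A N M (l1, l2, l3) \<longleftrightarrow> (\<forall>v.
    A G1 (A G2 v) = A G2 (A G1 v) \<and>
    (A G1 ^^ (2 * N)) v = v \<and> (A G2 ^^ (2 * M)) v = v \<and>
    A G1 (A A1 v) = - A A1 (A G1 v) \<and> A G1 (A A2 v) = - A A2 (A G1 v) \<and>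
    A G2 (A A1 v) = A A1 (A G2 v) \<and> A G2 (A A2 v) = - A A2 (A G2 v) \<and>
    A A1 (A A1 v) = s l1 (v - A G1 (A G1 v)) \<and>
    A A2 (A A2 v) = s l2 (v - A G2 (A G2 v)) \<and>
    A A1 (A A2 (A A1 (A A2 v))) + A A2 (A A1 (A A2 (A A1 v))) =
      s l3 (v - A G1 (A G1 (A G2 (A G2 v)))) -
      s (2 * l1 * l2) ((v - A G1 (A G1 v)) + A G2 (A G2 (v - A G1 (A G1 v)))))"
proof -
  have *: "H_rep s A N M (l1, l2, l3) \<longleftrightarrow> (\<forall>v. \<forall>r\<in>H_rels N M (l1, l2, l3). act s A r v = 0)"
    by (auto simp: H_rep_def H_rep_axioms_def gen_rep_axioms)
  show ?thesis
    unfolding * by (simp add: Let_def act_simps act_var_fun power2_eq_square eq_neg_iff_add_eq_0)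
qed

definition has_type :: "('k \<Rightarrow> 'a \<Rightarrow> 'a) \<Rightarrow> (gen \<Rightarrow> 'a \<Rightarrow> 'a) \<Rightarrow> 'k \<times> 'k \<Rightarrow> 'a \<Rightarrow> bool" where
  "has_type s A \<chi> v \<longleftrightarrow> A G1 v = s (fst \<chi>) v \<and> A G2 v = s (snd \<chi>) v"

lemma fst_chi [simp]:
  "fst (chi_bar \<chi>) = - fst \<chi>" "snd (chi_bar \<chi>) = snd \<chi>"
  "fst (chi_neg \<chi>) = - fst \<chi>" "snd (chi_neg \<chi>) = - snd \<chi>"
  by (cases \<chi>; simp)+

lemma (in gen_rep) has_type_closed:
  "\<lbrakk>has_type s A \<chi> v; has_type s A \<chi> w\<rbrakk> \<Longrightarrow> has_type s A \<chi> (v + w)"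
  "has_type s A \<chi> v \<Longrightarrow> has_type s A \<chi> (s c v)"
  by (simp_all add: has_type_def gen_add gen_scale scale_right_distrib mult.commute)

context H_rep
begin

lemma relations:
  "A G1 (A G2 v) = A G2 (A G1 v)"
  "(A G1 ^^ (2 * N)) v = v" "(A G2 ^^ (2 * M)) v = v"
  "A G1 (A A1 v) = - A A1 (A G1 v)" "A G1 (A A2 v) = - A A2 (A G1 v)"
  "A G2 (A A1 v) = A A1 (A G2 v)" "A G2 (A A2 v) = - A A2 (A G2 v)"
  using H_rep_axioms H_rep_iff[of N M "fst lam" "fst (snd lam)" "snd (snd lam)"] by auto

lemma has_type_A1: "has_type s A \<chi> v \<Longrightarrow> has_type s A (chi_bar \<chi>) (A A1 v)"
  by (simp add: has_type_def relations gen_scale)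

lemma has_type_A2: "has_type s A \<chi> v \<Longrightarrow> has_type s A (chi_neg \<chi>) (A A2 v)"
  by (simp add: has_type_def relations gen_scale)

lemma gen_A1_A1: "has_type s A \<chi> v \<Longrightarrow> A A1 (A A1 v) = s (alpha1 lam \<chi>) v"
  and gen_A2_A2: "has_type s A \<chi> v \<Longrightarrow> A A2 (A A2 v) = s (alpha2 lam \<chi>) v"
  and gen_quartic: "has_type s A \<chi> v \<Longrightarrow>
    A A1 (A A2 (A A1 (A A2 v))) + A A2 (A A1 (A A2 (A A1 v))) = s (alpha3 lam \<chi>) v"
proof -
  obtain l1 l2 l3 where l: "lam = (l1, l2, l3)" by (cases lam) auto
  obtain x1 x2 where \<chi>: "\<chi> = (x1, x2)" by (cases \<chi>)
  note R = H_rep_axioms[unfolded l H_rep_iff, THEN spec, of v]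
  assume v: "has_type s A \<chi> v"
  have G: "A G1 v = s x1 v" "A G2 v = s x2 v" using v by (simp_all add: has_type_def \<chi>)
  have diff: "v - s c v = s (1 - c) v" for c by (simp add: scale_left_diff_distrib)
  show "A A1 (A A1 v) = s (alpha1 lam \<chi>) v"
    using R by (simp add: l \<chi> G gen_scale diff power2_eq_square)
  show "A A2 (A A2 v) = s (alpha2 lam \<chi>) v"
    using R by (simp add: l \<chi> G gen_scale diff power2_eq_square)
  show "A A1 (A A2 (A A1 (A A2 v))) + A A2 (A A1 (A A2 (A A1 v))) = s (alpha3 lam \<chi>) v"
    using R by (simp add: l \<chi> G gen_scale diff)
      (simp add: power2_eq_square algebra_simps flip: scale_left_distrib scale_left_diff_distrib)
qed

end

section \<open>Eigenvectors of operators of finite order\<close>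

context vector_space
begin

text \<open>For \<open>g ^^ n = id\<close> and \<open>c ^ n = 1\<close> this is the averaging
  projector onto the \<open>c\<close>-eigenspace of \<open>g\<close>; the factor
  \<open>1 / n\<close> is where the characteristic enters.\<close>

definition eigen_proj :: "nat \<Rightarrow> ('b \<Rightarrow> 'b) \<Rightarrow> 'a \<Rightarrow> 'b \<Rightarrow> 'b" where
  "eigen_proj n g c v = scale (1 / of_nat n) (\<Sum>i<n. scale (inverse c ^ i) ((g ^^ i) v))"

end

text \<open>Applying \<open>g\<close> shifts the index of summation by one. The two boundary terms
  agree because both \<open>g\<close> and \<open>c\<close> have order dividing
  \<open>n\<close>.\<close>

lemma (in vector_space) eigen_proj_eigen:
  assumes add: "\<And>v w. g (v + w) = g v + g w" and scale: "\<And>a v. g (scale a v) = scale a (g v)"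
    and gn: "(g ^^ n) v = v" and cn: "c ^ n = 1" and n: "n > 0"
  shows "g (eigen_proj n g c v) = scale c (eigen_proj n g c v)"
proof -
  define f where "f i = scale (inverse c ^ i) ((g ^^ i) v)" for i
  have c: "c \<noteq> 0" using cn n by (auto simp: power_0_left)
  have g_sum: "g (\<Sum>i\<in>I. h i) = (\<Sum>i\<in>I. g (h i))" for h and I :: "nat set"
    using scale[of 0 0] by (induct I rule: infinite_finite_induct) (simp_all add: add)
  have "g (\<Sum>i<n. f i) = (\<Sum>i<n. scale c (f (Suc i)))"
    unfolding g_sum by (rule sum.cong) (simp_all add: f_def scale c)
  also have "\<dots> = scale c (\<Sum>i<n. f (Suc i))" by (simp add: scale_sum_right)
  also have "(\<Sum>i<n. f (Suc i)) = (\<Sum>i<n. f i) + f n - f 0"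
    using sum.lessThan_Suc_shift[of f n] by simp
  also have "f n = f 0" by (simp add: f_def gn power_inverse cn)
  finally show ?thesis by (simp add: eigen_proj_def f_def scale mult.commute)
qed

text \<open>An operator commuting with \<open>g\<close> keeps its eigenvectors under the projection,
  so projecting for \<open>g\<^sub>2\<close> does not destroy the eigenvalue of
  \<open>g\<^sub>1\<close>.\<close>

lemma (in vector_space) eigen_proj_preserves:
  assumes h: "\<And>v w. h (v + w) = h v + h w" "\<And>a v. h (scale a v) = scale a (h v)"
    and g: "\<And>a v. g (scale a v) = scale a (g v)"
    and hg: "\<And>w. h (g w) = g (h w)" and hv: "h v = scale d v"
  shows "h (eigen_proj n g c v) = scale d (eigen_proj n g c v)"
proof -
  have h_sum: "h (\<Sum>i\<in>I. k i) = (\<Sum>i\<in>I. h (k i))" for k and I :: "nat set"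
    using h(2)[of 0 0] by (induct I rule: infinite_finite_induct) (simp_all add: h)
  have "h ((g ^^ i) v) = scale d ((g ^^ i) v)" for i
    by (induct i) (simp_all add: hg hv g)
  then show ?thesis by (simp add: eigen_proj_def h h_sum scale_sum_right mult_ac)
qed

section \<open>Lifting vectors with their type; recognizing split extensions\<close>

context H_model_pair
begin

text \<open>The projectors for \<open>g\<^sub>1\<close> and \<open>g\<^sub>2\<close> are applied in
  turn to \<open>(0, v)\<close>.\<close>

lemma lift_type:
  assumes X: "H_rep sE (E X) N M lam" and v: "has_type sA A \<chi> v" and \<chi>: "\<chi> \<in> chars N M"
    and N: "of_nat (2 * N) \<noteq> (0 :: 'k)" and M: "of_nat (2 * M) \<noteq> (0 :: 'k)"
  shows "\<exists>t. has_type sE (E X) \<chi> (t, v)"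
proof -
  interpret X: H_rep sE "E X" N M lam by fact
  \<comment> \<open>On the quotient the vector already has the right eigenvalue, so all
    \<open>n\<close> summands are equal and averaging leaves the second component alone.\<close>
  have snd_proj: "snd (X.eigen_proj n (E X x) c u) = snd u"
    if "A x (snd u) = sA c (snd u)" "of_nat n \<noteq> (0 :: 'k)" "c \<noteq> 0" for n x c u
  proof -
    have "snd ((E X x ^^ i) u) = sA (c ^ i) (snd u)" for i
      by (induct i) (simp_all add: ext_simps V.gen_scale that mult.commute)
    then show ?thesis
      using that by (simp add: snd_sum X.eigen_proj_def ext_simps power_inverse V.sum_constant_scale)
  qed
  have pos: "0 < 2 * N" "0 < 2 * M" using N M by (auto intro!: gr0I)
  have c: "fst \<chi> ^ (2 * N) = 1" "snd \<chi> ^ (2 * M) = 1" using \<chi> by (auto simp: chars_def)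
  then have c0: "fst \<chi> \<noteq> 0" "snd \<chi> \<noteq> 0" using pos by (auto simp: power_0_left)
  define u1 where "u1 = X.eigen_proj (2 * N) (E X G1) (fst \<chi>) (0, v)"
  define u2 where "u2 = X.eigen_proj (2 * M) (E X G2) (snd \<chi>) u1"
  have "E X G1 u1 = sE (fst \<chi>) u1"
    unfolding u1_def by (rule X.eigen_proj_eigen) (simp_all only: X.gen_add X.gen_scale X.relations c pos)
  then have "E X G1 u2 = sE (fst \<chi>) u2"
    unfolding u2_def by (intro X.eigen_proj_preserves) (simp_all only: X.gen_add X.gen_scale X.relations)
  moreover have "E X G2 u2 = sE (snd \<chi>) u2"
    unfolding u2_def by (rule X.eigen_proj_eigen) (simp_all only: X.gen_add X.gen_scale X.relations c pos)
  moreover have "snd u1 = v" unfolding u1_def using snd_proj[of G1 "(0, v)" "fst \<chi>" "2 * N"] v N c0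
    by (simp add: has_type_def)
  then have "snd u2 = v" unfolding u2_def using snd_proj[of G2 u1 "snd \<chi>" "2 * M"] v M c0
    by (simp add: has_type_def)
  ultimately show ?thesis by (metis has_type_def prod.collapse)
qed

text \<open>Lifts of the basis that the generators move by the same matrix as in \<open>V\<close>
  span a submodule mapping isomorphically onto \<open>V\<close>; it is the graph of the required
  \<open>T\<close>.\<close>

lemma innerI:
  assumes X: "gen_rep sE (E X)"
    and u: "\<And>i. i \<in> I \<Longrightarrow> snd (u i) = e i"
      "\<And>x i. i \<in> I \<Longrightarrow> E X x (u i) = (\<Sum>j\<in>I. sE (coord j (A x (e i))) (u j))"
  shows "inner sB B sA A X"
proof -
  interpret X: gen_rep sE "E X" by fact
  define U where "U v = (\<Sum>i\<in>I. sE (coord i v) (u i))" for v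
  define T where "T v = fst (U v)" for v
  have U_add: "U (v + w) = U v + U w" for v w
    by (simp add: U_def coord_add X.scale_left_distrib sum.distrib)
  have U_scale: "U (sA c v) = sE c (U v)" for c v
    by (simp add: U_def coord_scale X.scale_sum_right)
  have "snd (U v) = v" for v
    using coord_sum[of v] by (simp add: U_def snd_sum ext_simps u)
  then have U: "U v = (T v, v)" for v by (simp add: T_def prod_eq_iff)
  have X_sum: "E X x (\<Sum>i\<in>J. k i) = (\<Sum>i\<in>J. E X x (k i))" for x k and J :: "nat set"
    using X.gen_scale[of x 0 0] by (induct J rule: infinite_finite_induct) (simp_all add: X.gen_add)
  have U_sum: "U (\<Sum>i\<in>J. k i) = (\<Sum>i\<in>J. U (k i))" for k and J :: "nat set"
    using U_scale[of 0 0] by (induct J rule: infinite_finite_induct) (simp_all add: U_add)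
  have A_sum: "A x (\<Sum>i\<in>J. k i) = (\<Sum>i\<in>J. A x (k i))" for x k and J :: "nat set"
    using V.gen_scale[of x 0 0] by (induct J rule: infinite_finite_induct) (simp_all add: V.gen_add)
  have "E X x (U v) = U (A x v)" for x v
  proof -
    have "E X x (U v) = (\<Sum>i\<in>I. sE (coord i v) (U (A x (e i))))"
      unfolding U_def[of v] X_sum by (rule sum.cong) (simp_all add: X.gen_scale u U_def)
    also have "\<dots> = U (A x (\<Sum>i\<in>I. sA (coord i v) (e i)))"
      by (simp add: A_sum U_sum V.gen_scale U_scale)
    finally show ?thesis by (simp flip: coord_sum)
  qed
  then have "X x v = T (A x v) - B x (T v)" for x v
    by (simp add: U ext_simps eq_diff_eq add.commute)
  moreover have "T (v + w) = T v + T w" "T (sA c v) = sB c (T v)" for v w c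
    using U_add[of v w] U_scale[of c v] by (simp_all add: U ext_simps)
  ultimately show ?thesis unfolding inner_def by blast
qed

lemma innerE:
  assumes "inner sB B sA A X"
  obtains T where "\<And>x v. E X x (T v, v) = (T (A x v), A x v)" "\<And>v w. T (v + w) = T v + T w"
    "\<And>c v. T (sA c v) = sB c (T v)"
proof -
  obtain T where "\<And>v w. T (v + w) = T v + T w" "\<And>c v. T (sA c v) = sB c (T v)"
    "\<And>x v. X x v = T (A x v) - B x (T v)"
    using assms unfolding inner_def by blast
  then show ?thesis by (intro that[of T]) (simp_all add: ext_simps)
qed

end

section \<open>The simple modules as representations on coordinates\<close>

text \<open>Coefficients are kept in a list parallel to the ordered basis, so that they can be
  matched with the components of a tuple.\<close>

definition comb where
  "comb N M lam V cs vs = foldr (\<lambda>(c, v) y. H_const N M lam c \<odot>\<^bsub>V\<^esub> v \<oplus>\<^bsub>V\<^esub> y) (zip cs vs) \<zero>\<^bsub>V\<^esub>"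

lemma vectorspace_restrict_scalars:
  assumes "left_module (H_alg N M (lam :: 'k::field \<times> 'k \<times> 'k)) V"
  shows "vectorspace class_ring (restrict_scalars (H_const N M lam) V)"
proof -
  let ?U = "restrict_scalars (H_const N M lam) V"
  interpret V: left_module "H_alg N M lam" V by fact
  show ?thesis
  proof (rule vs_criteria)
    show "field (class_ring :: 'k ring)" by (rule class_field)
    show "\<forall>v\<in>carrier ?U. \<exists>w\<in>carrier ?U. v \<oplus>\<^bsub>?U\<^esub> w = \<zero>\<^bsub>?U\<^esub>"
      using V.M.r_neg by (auto simp: restrict_scalars_def)
    show "\<forall>v w. v \<in> carrier ?U \<and> w \<in> carrier ?U \<longrightarrow> v \<oplus>\<^bsub>?U\<^esub> w = w \<oplus>\<^bsub>?U\<^esub> v"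
      using V.M.a_comm by (auto simp: restrict_scalars_def)
    show "\<forall>a b v. a \<in> carrier class_ring \<and> b \<in> carrier class_ring \<and> v \<in> carrier ?U \<longrightarrow>
      (a \<otimes>\<^bsub>class_ring\<^esub> b) \<odot>\<^bsub>?U\<^esub> v = a \<odot>\<^bsub>?U\<^esub> (b \<odot>\<^bsub>?U\<^esub> v)"
      by (simp add: restrict_scalars_def V.smult_assoc flip: H_const_mult)
    show "\<forall>a b v. a \<in> carrier class_ring \<and> b \<in> carrier class_ring \<and> v \<in> carrier ?U \<longrightarrow>
      (a \<oplus>\<^bsub>class_ring\<^esub> b) \<odot>\<^bsub>?U\<^esub> v = a \<odot>\<^bsub>?U\<^esub> v \<oplus>\<^bsub>?U\<^esub> b \<odot>\<^bsub>?U\<^esub> v"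
      by (simp add: restrict_scalars_def V.smult_l_distr flip: H_const_add)
  qed (simp_all add: restrict_scalars_def V.smult_closed V.M.a_assoc V.smult_r_distr V.smult_one H_const_one)
qed

lemma is_H_basis_unique:
  fixes V :: "('k::field free_alg set, 'v) module"
  assumes V: "left_module (H_alg N M lam) V" and b: "is_H_basis N M lam V vs" and x: "x \<in> carrier V"
  shows "\<exists>!cs. length cs = length vs \<and> x = comb N M lam V cs vs"
proof -
  interpret V: left_module "H_alg N M lam" V by fact
  define U where "U = restrict_scalars (H_const N M lam) V"
  interpret U: vectorspace class_ring U unfolding U_def by (rule vectorspace_restrict_scalars[OF V])
  have U: "carrier U = carrier V" "\<zero>\<^bsub>U\<^esub> = \<zero>\<^bsub>V\<^esub>" "v \<oplus>\<^bsub>U\<^esub> w = v \<oplus>\<^bsub>V\<^esub> w" "c \<odot>\<^bsub>U\<^esub> v = H_const N M lam c \<odot>\<^bsub>V\<^esub> v" for v w c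
    by (simp_all add: U_def restrict_scalars_def)
  have vs: "distinct vs" "U.basis (set vs)" using b by (simp_all add: is_H_basis_def U_def)
  then have sub: "set vs \<subseteq> carrier V" by (simp add: U.basis_def U)
  have ex1: "\<exists>!a. a \<in> set vs \<rightarrow>\<^sub>E (UNIV :: 'k set) \<and> U.lincomb a (set vs) = x"
    using U.basis_criterion[of "set vs"] vs(2) sub x by (simp add: U)
  have lc: "U.lincomb a (set us) = comb N M lam V (map a us) us" if "distinct us" "set us \<subseteq> carrier V" for a us
    using that
  proof (induct us)
    case Nil
    then show ?case by (simp add: comb_def U.lincomb_def U)
  next
    case (Cons u us)
    have "set us \<union> {u} = set (u # us)" by auto
    then have "U.lincomb a (set (u # us)) = a u \<odot>\<^bsub>U\<^esub> u \<oplus>\<^bsub>U\<^esub> U.lincomb a (set us)"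
      using U.lincomb_insert[of "set us" a u] Cons.prems by (simp add: U)
    then show ?case using Cons by (simp add: comb_def U)
  qed
  show ?thesis
  proof (rule ex_ex1I)
    show "\<exists>cs. length cs = length vs \<and> x = comb N M lam V cs vs"
      using ex1 lc[OF vs(1) sub] by (metis length_map)
    fix cs ds assume cs: "length cs = length vs \<and> x = comb N M lam V cs vs"
      and ds: "length ds = length vs \<and> x = comb N M lam V ds vs"
    define f where "f cs = restrict (\<lambda>v. the (map_of (zip vs cs) v)) (set vs)" for cs :: "'k list"
    have f: "map (f cs) vs = cs" if "length cs = length vs" for cs
      using that vs(1) by (intro nth_equalityI) (auto simp: f_def map_of_zip_nth)
    have "f cs \<in> set vs \<rightarrow>\<^sub>E UNIV" "U.lincomb (f cs) (set vs) = comb N M lam V cs vs"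
      if "length cs = length vs" for cs
      using lc[OF vs(1) sub, of "f cs"] f[OF that] by (auto simp: f_def)
    then have "f cs = f ds" using ex1 cs ds by metis
    then show "cs = ds" using f cs ds by metis
  qed
qed

sublocale H_model \<subseteq> H_rep s A N M lam
  by unfold_locales (rule rels)

lemma alpha_chi [simp]:
  "alpha1 lam (chi_bar \<chi>) = alpha1 lam \<chi>" "alpha1 lam (chi_neg \<chi>) = alpha1 lam \<chi>"
  "alpha2 lam (chi_bar \<chi>) = alpha2 lam \<chi>" "alpha2 lam (chi_neg \<chi>) = alpha2 lam \<chi>"
  "alpha3 lam (chi_bar \<chi>) = alpha3 lam \<chi>" "alpha3 lam (chi_neg \<chi>) = alpha3 lam \<chi>"
  by (cases lam; cases \<chi>; simp)+

lemma alpha_Omega: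
  assumes "\<phi> \<in> Omega \<chi>"
  shows "alpha1 lam \<phi> = alpha1 lam \<chi>" "alpha2 lam \<phi> = alpha2 lam \<chi>" "alpha3 lam \<phi> = alpha3 lam \<chi>"
  using assms by (auto simp: Omega_def)

lemma chars_Omega: "\<lbrakk>\<phi> \<in> Omega \<chi>; \<chi> \<in> chars N M\<rbrakk> \<Longrightarrow> \<phi> \<in> chars N M"
  by (cases \<chi>) (auto simp: Omega_def chars_def power_mult)

lemma chars_nonzero: "\<lbrakk>\<chi> \<in> chars N M; N \<ge> 2; M \<ge> 2\<rbrakk> \<Longrightarrow> fst \<chi> \<noteq> 0 \<and> snd \<chi> \<noteq> 0"
  by (auto simp: chars_def power_0_left)

text \<open>If \<open>Z\<close> vanishes on the group, the right-hand sides of the last three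
  relations have no upper right entry. The hypotheses are the upper right entries of the left-hand
  sides: the factor \<open>Z\<close> takes every possible place in a word, two places in a square
  and four in each quartic word.\<close>

lemma (in H_model_pair) H_rep_ext_if_derivation:
  assumes add: "\<And>x v w. Z x (v + w) = Z x v + Z x w" and scale: "\<And>x c v. Z x (sA c v) = sB c (Z x v)"
    and G: "\<And>v. Z G1 v = 0" "\<And>v. Z G2 v = 0"
    and com: "\<And>v. B G1 (Z A1 v) = - Z A1 (A G1 v)" "\<And>v. B G1 (Z A2 v) = - Z A2 (A G1 v)"
      "\<And>v. B G2 (Z A1 v) = Z A1 (A G2 v)" "\<And>v. B G2 (Z A2 v) = - Z A2 (A G2 v)"
    and sq: "\<And>v. B A1 (Z A1 v) + Z A1 (A A1 v) = 0" "\<And>v. B A2 (Z A2 v) + Z A2 (A A2 v) = 0"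
    and quart: "\<And>v. B A1 (B A2 (B A1 (Z A2 v))) + B A1 (B A2 (Z A1 (A A2 v)))
        + B A1 (Z A2 (A A1 (A A2 v))) + Z A1 (A A2 (A A1 (A A2 v)))
      + (B A2 (B A1 (B A2 (Z A1 v))) + B A2 (B A1 (Z A2 (A A1 v)))
        + B A2 (Z A1 (A A2 (A A1 v))) + Z A2 (A A1 (A A2 (A A1 v)))) = 0"
  shows "H_rep sE (E Z) N M lam"
proof -
  obtain l1 l2 l3 where l: "lam = (l1, l2, l3)" by (cases lam) auto
  interpret E: gen_rep sE "E Z" by (rule gen_rep_ext) (simp_all add: add scale)
  note RV = V.H_rep_axioms[unfolded l V.H_rep_iff, THEN spec]
  note RW = W.H_rep_axioms[unfolded l W.H_rep_iff, THEN spec]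
  have pow: "(E Z G1 ^^ n) (w, v) = ((B G1 ^^ n) w, (A G1 ^^ n) v)"
    "(E Z G2 ^^ n) (w, v) = ((B G2 ^^ n) w, (A G2 ^^ n) v)" for n w v
    by (induct n) (simp_all add: ext_simps G)
  have sq': "B A1 (Z A1 v) = - Z A1 (A A1 v)" "B A2 (Z A2 v) = - Z A2 (A A2 v)" for v
    using sq by (simp_all add: eq_neg_iff_add_eq_0)
  let ?E = "E Z"
  have E_quart: "?E A1 (?E A2 (?E A1 (?E A2 u))) + ?E A2 (?E A1 (?E A2 (?E A1 u))) =
    (B A1 (B A2 (B A1 (B A2 (fst u)))) + B A2 (B A1 (B A2 (B A1 (fst u)))),
     A A1 (A A2 (A A1 (A A2 (snd u)))) + A A2 (A A1 (A A2 (A A1 (snd u)))))" (is "?l = ?r") for u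
  proof (cases u)
    case (Pair w v)
    let ?q = "B A1 (B A2 (B A1 (Z A2 v))) + B A1 (B A2 (Z A1 (A A2 v)))
        + B A1 (Z A2 (A A1 (A A2 v))) + Z A1 (A A2 (A A1 (A A2 v)))
      + (B A2 (B A1 (B A2 (Z A1 v))) + B A2 (B A1 (Z A2 (A A1 v)))
        + B A2 (Z A1 (A A2 (A A1 v))) + Z A2 (A A1 (A A2 (A A1 v))))"
    have "?l = (fst ?r + ?q, snd ?r)" by (simp add: Pair ext_simps W.gen_add add_ac)
    then show ?thesis using quart[of v] by simp
  qed
  show ?thesis
    unfolding l E.H_rep_iff
  proof (intro allI, goal_cases)
    case (1 u)
    obtain w v where u: "u = (w, v)" by (cases u)
    show ?case
      unfolding E_quart
      using RV[of v] RW[of w]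
      by (simp add: u ext_simps G pow com sq' W.gen_add)
  qed
qed

lemma H_model_if_basis:
  fixes V :: "('k::field free_alg set, 'v) module" and coords :: "'a::ab_group_add \<Rightarrow> 'k list"
  assumes rep: "gen_rep s A" and V: "left_module (H_alg N M lam) V" and vs: "is_H_basis N M lam V vs"
    and bij: "bij_betw coords UNIV {cs. length cs = length vs}"
    and coords_add: "\<And>v w. coords (v + w) = map2 (+) (coords v) (coords w)"
    and coords_scale: "\<And>c v. coords (s c v) = map ((*) c) (coords v)"
    and gens: "\<And>x v. comb N M lam V (coords (A x v)) vs = H_gen N M lam x \<odot>\<^bsub>V\<^esub> comb N M lam V (coords v) vs"
  shows "H_model s A N M lam V (\<lambda>v. comb N M lam V (coords v) vs)"
proof -
  interpret V: left_module "H_alg N M lam" V by fact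
  interpret gen_rep s A by fact
  let ?C = "comb N M lam V"
  have sub: "set vs \<subseteq> carrier V"
  proof -
    interpret U: vectorspace class_ring "restrict_scalars (H_const N M lam) V"
      by (rule vectorspace_restrict_scalars[OF V])
    show ?thesis using vs by (simp add: is_H_basis_def U.basis_def) (simp add: restrict_scalars_def)
  qed
  have closed: "?C cs us \<in> carrier V" if "set us \<subseteq> carrier V" for cs us
    using that
    by (induct cs us rule: list_induct2') (simp_all add: comb_def V.smult_closed)
  have add: "?C (map2 (+) cs ds) us = ?C cs us \<oplus>\<^bsub>V\<^esub> ?C ds us"
    if "length cs = length ds" "length ds = length us" "set us \<subseteq> carrier V" for cs ds us
    using that
  proof (induct cs ds us rule: list_induct3)
    case (Cons c cs d ds u us)
    note cl = closed[of us cs] closed[of us ds]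
    have "H_const N M lam (c + d) \<odot>\<^bsub>V\<^esub> u = H_const N M lam c \<odot>\<^bsub>V\<^esub> u \<oplus>\<^bsub>V\<^esub> H_const N M lam d \<odot>\<^bsub>V\<^esub> u"
      using Cons.prems by (simp add: V.smult_l_distr flip: H_const_add)
    then show ?case using Cons cl by (simp add: comb_def V.smult_closed V.M.a_ac)
  qed (simp add: comb_def)
  have scale: "?C (map ((*) c) cs) us = H_const N M lam c \<odot>\<^bsub>V\<^esub> ?C cs us"
    if "length cs = length us" "set us \<subseteq> carrier V" for c cs us
    using that
  proof (induct cs us rule: list_induct2)
    case (Cons d ds u us)
    note cl = closed[of us ds]
    have "H_const N M lam (c * d) \<odot>\<^bsub>V\<^esub> u = H_const N M lam c \<odot>\<^bsub>V\<^esub> (H_const N M lam d \<odot>\<^bsub>V\<^esub> u)"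
      using Cons.prems by (simp add: V.smult_assoc flip: H_const_mult)
    then show ?case using Cons cl by (simp add: comb_def V.smult_closed V.smult_r_distr)
  qed (simp add: comb_def V.smult_r_null)
  have len: "length (coords v) = length vs" for v using bij by (auto simp: bij_betw_def)
  show ?thesis
  proof (unfold_locales; (rule V)?)
    have "inj (\<lambda>v. ?C (coords v) vs)"
    proof (rule injI)
      fix v w assume "?C (coords v) vs = ?C (coords w) vs"
      then have "coords v = coords w"
        using is_H_basis_unique[OF V vs closed[OF sub, of "coords v"]] len by metis
      then show "v = w" using bij by (auto simp: bij_betw_def inj_on_def)
    qed
    moreover have "\<exists>v. x = ?C (coords v) vs" if x: "x \<in> carrier V" for x
    proof -
      obtain cs where cs: "length cs = length vs" "x = ?C cs vs" using is_H_basis_unique[OF V vs x] by blast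
      then have "cs \<in> range coords" using bij by (simp add: bij_betw_def)
      then show ?thesis using cs by auto
    qed
    ultimately show "bij_betw (\<lambda>v. ?C (coords v) vs) UNIV (carrier V)"
      using closed[OF sub] by (auto simp: bij_betw_def)
  qed (simp_all add: coords_add add len sub coords_scale scale gens)
qed

section \<open>Coordinate models of the simple modules\<close>

fun L1_gen :: "'k::field \<times> 'k \<Rightarrow> gen \<Rightarrow> 'k \<Rightarrow> 'k" where
  "L1_gen \<chi> G1 v = fst \<chi> * v"
| "L1_gen \<chi> G2 v = snd \<chi> * v"
| "L1_gen \<chi> A1 v = 0"
| "L1_gen \<chi> A2 v = 0"

fun scale2 :: "'k::field \<Rightarrow> 'k \<times> 'k \<Rightarrow> 'k \<times> 'k" where
  "scale2 c (v, w) = (c * v, c * w)"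

text \<open>The types of \<open>v\<close> and \<open>a\<^sub>i v\<close> differ by \<open>shift a\<^sub>i\<close>. In the modules \<open>L\<^sub>2\<^sub>,\<^sub>h\<close> and \<open>L\<^sub>2\<^sub>,\<^sub>v\<close> one of
  \<open>a\<^sub>1\<close>, \<open>a\<^sub>2\<close>, called \<open>g\<close>, acts nontrivially.\<close>

definition shift :: "gen \<Rightarrow> 'k::field \<times> 'k \<Rightarrow> 'k \<times> 'k" where
  "shift g = (if g = A1 then chi_bar else chi_neg)"

definition alpha_of :: "gen \<Rightarrow> 'k::field \<times> 'k \<times> 'k \<Rightarrow> 'k \<times> 'k \<Rightarrow> 'k" where
  "alpha_of g = (if g = A1 then alpha1 else alpha2)"

fun L2_gen :: "gen \<Rightarrow> 'k::field \<times> 'k \<times> 'k \<Rightarrow> 'k \<times> 'k \<Rightarrow> gen \<Rightarrow> 'k \<times> 'k \<Rightarrow> 'k \<times> 'k" where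
  "L2_gen g lam \<chi> G1 (v, w) = (fst \<chi> * v, fst (shift g \<chi>) * w)"
| "L2_gen g lam \<chi> G2 (v, w) = (snd \<chi> * v, snd (shift g \<chi>) * w)"
| "L2_gen g lam \<chi> A1 (v, w) = (if g = A1 then (alpha_of g lam \<chi> * w, v) else (0, 0))"
| "L2_gen g lam \<chi> A2 (v, w) = (if g = A2 then (alpha_of g lam \<chi> * w, v) else (0, 0))"

lemma shift_simps [simp]:
  "fst (shift g \<chi>) = - fst \<chi>" "snd (shift g \<chi>) = (if g = A1 then snd \<chi> else - snd \<chi>)"
  by (simp_all add: shift_def)

fun scale4 :: "'k::field \<Rightarrow> 'k \<times> 'k \<times> 'k \<times> 'k \<Rightarrow> 'k \<times> 'k \<times> 'k \<times> 'k" where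
  "scale4 c (v1, v2, v3, v4) = (c * v1, c * v2, c * v3, c * v4)"

fun L4_gen :: "'k::field \<times> 'k \<times> 'k \<Rightarrow> 'k \<times> 'k \<Rightarrow> 'k \<Rightarrow> gen \<Rightarrow>
    'k \<times> 'k \<times> 'k \<times> 'k \<Rightarrow> 'k \<times> 'k \<times> 'k \<times> 'k" where
  "L4_gen lam \<chi> d G1 (v1, v2, v3, v4) = (fst \<chi> * v1, - fst \<chi> * v2, fst \<chi> * v3, - fst \<chi> * v4)"
| "L4_gen lam \<chi> d G2 (v1, v2, v3, v4) = (snd \<chi> * v1, snd \<chi> * v2, - snd \<chi> * v3, - snd \<chi> * v4)"
| "L4_gen lam \<chi> d A1 (v1, v2, v3, v4) = (alpha1 lam \<chi> * v2, v1, alpha1 lam \<chi> * v4, v3)"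
| "L4_gen lam \<chi> d A2 (v1, v2, v3, v4) =
    ((alpha3 lam \<chi> - (alpha1 lam \<chi>)\<^sup>2 * alpha2 lam \<chi> * d) * v4, alpha2 lam \<chi> * v3, v2, d * v1)"

lemma gen_rep_L1: "gen_rep (*) (L1_gen \<chi>)"
proof
  fix x and v w :: 'a
  show "L1_gen \<chi> x (v + w) = L1_gen \<chi> x v + L1_gen \<chi> x w"
    by (cases x) (simp_all add: distrib_left)
  show "L1_gen \<chi> x (c * v) = c * L1_gen \<chi> x v" for c by (cases x) simp_all
qed (simp_all add: algebra_simps)

lemma gen_rep_L2: "gen_rep scale2 (L2_gen g lam \<chi>)"
proof
  fix x and v w :: "'a \<times> 'a" and c
  show "L2_gen g lam \<chi> x (v + w) = L2_gen g lam \<chi> x v + L2_gen g lam \<chi> x w"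
    by (cases x; cases v; cases w) (simp_all add: algebra_simps)
  show "L2_gen g lam \<chi> x (scale2 c v) = scale2 c (L2_gen g lam \<chi> x v)"
    by (cases x; cases v) (simp_all add: algebra_simps)
qed (auto simp: algebra_simps)

lemma gen_rep_L4: "gen_rep scale4 (L4_gen lam \<chi> d)"
proof
  fix x and v w :: "'a \<times> 'a \<times> 'a \<times> 'a" and c
  show "L4_gen lam \<chi> d x (v + w) = L4_gen lam \<chi> d x v + L4_gen lam \<chi> d x w"
    by (cases x; cases v; cases w) (simp_all add: algebra_simps)
  show "L4_gen lam \<chi> d x (scale4 c v) = scale4 c (L4_gen lam \<chi> d x v)"
    by (cases x; cases v) (simp_all add: algebra_simps)
qed (auto simp: algebra_simps)

lemma H_smult_rules:
  fixes V :: "('k::field free_alg set, 'v) module"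
  assumes "left_module (H_alg N M lam) V" and x: "x \<in> carrier V"
  shows "H_const N M lam 0 \<odot>\<^bsub>V\<^esub> x = \<zero>\<^bsub>V\<^esub>"
    and "H_const N M lam a \<odot>\<^bsub>V\<^esub> (H_const N M lam b \<odot>\<^bsub>V\<^esub> x) = H_const N M lam (a * b) \<odot>\<^bsub>V\<^esub> x"
    and "H_gen N M lam g \<odot>\<^bsub>V\<^esub> (H_const N M lam a \<odot>\<^bsub>V\<^esub> x) = H_const N M lam a \<odot>\<^bsub>V\<^esub> (H_gen N M lam g \<odot>\<^bsub>V\<^esub> x)"
    and "H_const N M lam a \<odot>\<^bsub>V\<^esub> x \<in> carrier V"
proof -
  interpret V: left_module "H_alg N M lam" V by fact
  show "H_const N M lam 0 \<odot>\<^bsub>V\<^esub> x = \<zero>\<^bsub>V\<^esub>" using x by (simp add: H_const_zero V.smult_l_null)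
  show "H_const N M lam a \<odot>\<^bsub>V\<^esub> (H_const N M lam b \<odot>\<^bsub>V\<^esub> x) = H_const N M lam (a * b) \<odot>\<^bsub>V\<^esub> x"
    using x by (simp add: V.smult_assoc flip: H_const_mult)
  show "H_gen N M lam g \<odot>\<^bsub>V\<^esub> (H_const N M lam a \<odot>\<^bsub>V\<^esub> x) = H_const N M lam a \<odot>\<^bsub>V\<^esub> (H_gen N M lam g \<odot>\<^bsub>V\<^esub> x)"
    using x by (simp add: H_const_central flip: V.smult_assoc)
  show "H_const N M lam a \<odot>\<^bsub>V\<^esub> x \<in> carrier V" using x by (simp add: V.smult_closed)
qed

lemma H_model_L1:
  fixes V :: "('k::field free_alg set, 'v) module"
  assumes "is_L1 N M lam \<chi> V"
  shows "\<exists>\<iota>. H_model (*) (L1_gen \<chi>) N M lam V \<iota>"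
proof -
  obtain v where V: "left_module (H_alg N M lam) V" and vs: "is_H_basis N M lam V [v]"
    and v: "is_type N M lam V \<chi> v"
    and a: "H_gen N M lam A1 \<odot>\<^bsub>V\<^esub> v = \<zero>\<^bsub>V\<^esub>" "H_gen N M lam A2 \<odot>\<^bsub>V\<^esub> v = \<zero>\<^bsub>V\<^esub>"
    using assms unfolding is_L1_def by blast
  interpret V: left_module "H_alg N M lam" V by fact
  have v': "v \<in> carrier V" using v by (simp add: is_type_def)
  have "H_model (*) (L1_gen \<chi>) N M lam V (\<lambda>c. comb N M lam V [c] [v])"
  proof (rule H_model_if_basis[where coords = "\<lambda>c. [c]", OF gen_rep_L1 V vs])
    show "bij_betw (\<lambda>c. [c]) UNIV {cs. length cs = length [v]}"
      by (auto simp: bij_betw_def inj_on_def length_Suc_conv)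
    show "comb N M lam V [L1_gen \<chi> x c] [v] = H_gen N M lam x \<odot>\<^bsub>V\<^esub> comb N M lam V [c] [v]" for x c
      using v by (cases x) (simp_all add: comb_def is_type_def v' a H_smult_rules[OF V] V.smult_r_null mult.commute)
  qed simp_all
  then show ?thesis by blast
qed

lemma H_model_L2h:
  fixes V :: "('k::field free_alg set, 'v) module"
  assumes "is_L2h N M lam \<chi> V"
  shows "\<exists>\<iota>. H_model scale2 (L2_gen A1 lam \<chi>) N M lam V \<iota>"
proof -
  obtain v w where V: "left_module (H_alg N M lam) V" and vs: "is_H_basis N M lam V [v, w]"
    and v: "is_type N M lam V \<chi> v" "is_type N M lam V (chi_bar \<chi>) w"
    and a: "H_gen N M lam A1 \<odot>\<^bsub>V\<^esub> v = w" "H_gen N M lam A1 \<odot>\<^bsub>V\<^esub> w = H_const N M lam (alpha1 lam \<chi>) \<odot>\<^bsub>V\<^esub> v"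
      "\<forall>x\<in>carrier V. H_gen N M lam A2 \<odot>\<^bsub>V\<^esub> x = \<zero>\<^bsub>V\<^esub>"
    using assms unfolding is_L2h_def by blast
  interpret V: left_module "H_alg N M lam" V by fact
  have v': "v \<in> carrier V" "w \<in> carrier V" using v by (simp_all add: is_type_def)
  let ?coords = "\<lambda>u. [fst u, snd u]"
  have "H_model scale2 (L2_gen A1 lam \<chi>) N M lam V (\<lambda>u. comb N M lam V (?coords u) [v, w])"
  proof (rule H_model_if_basis[where coords = ?coords, OF gen_rep_L2 V vs])
    show "bij_betw ?coords UNIV {cs. length cs = length [v, w]}"
      by (rule bij_betwI[where g = "\<lambda>cs. (cs ! 0, cs ! 1)"]) (auto simp: length_Suc_conv)
    show "comb N M lam V (?coords (L2_gen A1 lam \<chi> x u)) [v, w] = H_gen N M lam x \<odot>\<^bsub>V\<^esub> comb N M lam V (?coords u) [v, w]" for x u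
      using v by (cases x; cases u) (simp_all add: comb_def is_type_def v' a H_smult_rules[OF V]
          V.smult_r_null V.smult_r_distr V.M.a_ac mult.commute alpha_of_def)
    show "?coords (scale2 c u) = map ((*) c) (?coords u)" for c u by (cases u) simp
  qed simp_all
  then show ?thesis by blast
qed

lemma H_model_L2v:
  fixes V :: "('k::field free_alg set, 'v) module"
  assumes "is_L2v N M lam \<chi> V"
  shows "\<exists>\<iota>. H_model scale2 (L2_gen A2 lam \<chi>) N M lam V \<iota>"
proof -
  obtain v w where V: "left_module (H_alg N M lam) V" and vs: "is_H_basis N M lam V [v, w]"
    and v: "is_type N M lam V \<chi> v" "is_type N M lam V (chi_neg \<chi>) w"
    and a: "H_gen N M lam A2 \<odot>\<^bsub>V\<^esub> v = w" "H_gen N M lam A2 \<odot>\<^bsub>V\<^esub> w = H_const N M lam (alpha2 lam \<chi>) \<odot>\<^bsub>V\<^esub> v"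
      "\<forall>x\<in>carrier V. H_gen N M lam A1 \<odot>\<^bsub>V\<^esub> x = \<zero>\<^bsub>V\<^esub>"
    using assms unfolding is_L2v_def by blast
  interpret V: left_module "H_alg N M lam" V by fact
  have v': "v \<in> carrier V" "w \<in> carrier V" using v by (simp_all add: is_type_def)
  let ?coords = "\<lambda>u. [fst u, snd u]"
  have "H_model scale2 (L2_gen A2 lam \<chi>) N M lam V (\<lambda>u. comb N M lam V (?coords u) [v, w])"
  proof (rule H_model_if_basis[where coords = ?coords, OF gen_rep_L2 V vs])
    show "bij_betw ?coords UNIV {cs. length cs = length [v, w]}"
      by (rule bij_betwI[where g = "\<lambda>cs. (cs ! 0, cs ! 1)"]) (auto simp: length_Suc_conv)
    show "comb N M lam V (?coords (L2_gen A2 lam \<chi> x u)) [v, w] = H_gen N M lam x \<odot>\<^bsub>V\<^esub> comb N M lam V (?coords u) [v, w]" for x u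
      using v by (cases x; cases u) (simp_all add: comb_def is_type_def v' a H_smult_rules[OF V]
          V.smult_r_null V.smult_r_distr V.M.a_ac mult.commute alpha_of_def)
    show "?coords (scale2 c u) = map ((*) c) (?coords u)" for c u by (cases u) simp
  qed simp_all
  then show ?thesis by blast
qed

lemma H_model_L4:
  fixes V :: "('k::field free_alg set, 'v) module"
  assumes "is_L4 N M lam \<chi> d V"
  shows "\<exists>\<iota>. H_model scale4 (L4_gen lam \<chi> d) N M lam V \<iota>"
proof -
  obtain v1 v2 v3 v4 where V: "left_module (H_alg N M lam) V" and vs: "is_H_basis N M lam V [v1, v2, v3, v4]"
    and v: "is_type N M lam V \<chi> v1" "is_type N M lam V (chi_bar \<chi>) v2"
      "is_type N M lam V (chi_neg (chi_bar \<chi>)) v3" "is_type N M lam V (chi_neg \<chi>) v4"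
    and a: "H_gen N M lam A1 \<odot>\<^bsub>V\<^esub> v1 = v2"
      "H_gen N M lam A1 \<odot>\<^bsub>V\<^esub> v2 = H_const N M lam (alpha1 lam \<chi>) \<odot>\<^bsub>V\<^esub> v1"
      "H_gen N M lam A1 \<odot>\<^bsub>V\<^esub> v3 = v4"
      "H_gen N M lam A1 \<odot>\<^bsub>V\<^esub> v4 = H_const N M lam (alpha1 lam \<chi>) \<odot>\<^bsub>V\<^esub> v3"
      "H_gen N M lam A2 \<odot>\<^bsub>V\<^esub> v1 = H_const N M lam d \<odot>\<^bsub>V\<^esub> v4"
      "H_gen N M lam A2 \<odot>\<^bsub>V\<^esub> v4 =
        H_const N M lam (alpha3 lam \<chi> - (alpha1 lam \<chi>)\<^sup>2 * alpha2 lam \<chi> * d) \<odot>\<^bsub>V\<^esub> v1"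
      "H_gen N M lam A2 \<odot>\<^bsub>V\<^esub> v2 = v3"
      "H_gen N M lam A2 \<odot>\<^bsub>V\<^esub> v3 = H_const N M lam (alpha2 lam \<chi>) \<odot>\<^bsub>V\<^esub> v2"
    using assms unfolding is_L4_def Let_def by blast
  interpret V: left_module "H_alg N M lam" V by fact
  have v': "v1 \<in> carrier V" "v2 \<in> carrier V" "v3 \<in> carrier V" "v4 \<in> carrier V"
    using v by (simp_all add: is_type_def)
  let ?coords = "\<lambda>u. [fst u, fst (snd u), fst (snd (snd u)), snd (snd (snd u))]"
  let ?vs = "[v1, v2, v3, v4]"
  have "H_model scale4 (L4_gen lam \<chi> d) N M lam V (\<lambda>u. comb N M lam V (?coords u) ?vs)"
  proof (rule H_model_if_basis[where coords = ?coords, OF gen_rep_L4 V vs])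
    show "bij_betw ?coords UNIV {cs. length cs = length ?vs}"
      by (rule bij_betwI[where g = "\<lambda>cs. (cs ! 0, cs ! 1, cs ! 2, cs ! 3)"])
        (auto simp: length_Suc_conv numeral_eq_Suc)
    show "comb N M lam V (?coords (L4_gen lam \<chi> d x u)) ?vs = H_gen N M lam x \<odot>\<^bsub>V\<^esub> comb N M lam V (?coords u) ?vs" for x u
      using v by (cases x; cases u) (simp_all add: comb_def is_type_def v' a H_smult_rules[OF V]
          V.smult_r_null V.smult_r_distr V.M.a_ac mult.commute)
    show "?coords (scale4 c u) = map ((*) c) (?coords u)" for c u by (cases u) simp
  qed simp_all
  then show ?thesis by blast
qed

section \<open>Extensions of the simple modules\<close>

text \<open>A lift of the generator of type \<phi> is sent by \<open>a\<^sub>1\<close> and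
  \<open>a\<^sub>2\<close> to vectors of \<open>W\<close> of types \<open>chi_bar \<phi>\<close> and
  \<open>chi_neg \<phi>\<close>, while \<open>W\<close> has only vectors of type \<chi>. So at most
  one of the two can be nonzero, and it is then the only parameter.\<close>

lemma ext1_L1:
  fixes lam :: "'k::field_char_0 \<times> 'k \<times> 'k"
    and V :: "('k free_alg set, 'v) module" and W :: "('k free_alg set, 'w) module"
  assumes NM: "N \<ge> 2" "M \<ge> 2" and \<chi>: "\<chi> \<in> chars N M" and \<phi>: "\<phi> \<in> Omega \<chi>"
    and V: "is_L1 N M lam \<phi> V" and W: "is_L1 N M lam \<chi> W"
  shows "has_dim (H_ext1 N M lam V W) (if \<phi> \<in> {chi_bar \<chi>, chi_neg \<chi>} then 1 else 0)"
proof -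
  obtain \<iota>V \<iota>W where "H_model (*) (L1_gen \<phi>) N M lam V \<iota>V" "H_model (*) (L1_gen \<chi>) N M lam W \<iota>W"
    using H_model_L1[OF V] H_model_L1[OF W] by blast
  then interpret P: H_model_pair "(*)" "L1_gen \<phi>" "(*)" "L1_gen \<chi>" N M lam V \<iota>V W \<iota>W "{0}" "\<lambda>_. 1" "\<lambda>_ v. v"
    by (intro H_model_pair.intro H_model_pair_axioms.intro) simp_all
  have \<phi>_chars: "\<phi> \<in> chars N M" using chars_Omega[OF \<phi> \<chi>] .
  note nz = chars_nonzero[OF \<phi>_chars NM] chars_nonzero[OF \<chi> NM]
  have lift: "\<exists>t. has_type P.sE (P.E X) \<phi> (t, 1) \<and> P.E X A1 (t, 1) = (X A1 1, 0) \<and> P.E X A2 (t, 1) = (X A2 1, 0)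
      \<and> (X A1 1 \<noteq> 0 \<longrightarrow> \<phi> = chi_bar \<chi>) \<and> (X A2 1 \<noteq> 0 \<longrightarrow> \<phi> = chi_neg \<chi>)"
    if X: "H_rep P.sE (P.E X) N M lam" for X
  proof -
    interpret X: H_rep P.sE "P.E X" N M lam by fact
    have "has_type (*) (L1_gen \<phi>) \<phi> 1" by (simp add: has_type_def)
    then obtain t where t: "has_type P.sE (P.E X) \<phi> (t, 1)"
      using P.lift_type[OF X _ \<phi>_chars] NM by (auto simp flip: of_nat_mult)
    have X0: "X x 0 = 0" for x using P.gen_rep_extD(2)[OF X.gen_rep_axioms, of x 0 1] by simp
    have A: "P.E X A1 (t, 1) = (X A1 1, 0)" "P.E X A2 (t, 1) = (X A2 1, 0)" by (simp_all add: ext_simps)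
    have "has_type P.sE (P.E X) (chi_bar \<phi>) (X A1 1, 0)" "has_type P.sE (P.E X) (chi_neg \<phi>) (X A2 1, 0)"
      using X.has_type_A1[OF t] X.has_type_A2[OF t] by (simp_all add: A)
    then have "fst \<chi> * X A1 1 = - fst \<phi> * X A1 1" "snd \<chi> * X A1 1 = snd \<phi> * X A1 1"
      "fst \<chi> * X A2 1 = - fst \<phi> * X A2 1" "snd \<chi> * X A2 1 = - snd \<phi> * X A2 1"
      by (simp_all add: has_type_def ext_simps X0)
    then have "X A1 1 \<noteq> 0 \<longrightarrow> \<phi> = chi_bar \<chi>" "X A2 1 \<noteq> 0 \<longrightarrow> \<phi> = chi_neg \<chi>"
      unfolding mult_cancel_right by (auto simp: prod_eq_iff)
    then show ?thesis using t A by blast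
  qed
  have inner0: "inner (*) (L1_gen \<chi>) (*) (L1_gen \<phi>) X"
    if X: "H_rep P.sE (P.E X) N M lam" "X A1 1 = 0" "X A2 1 = 0" for X
  proof -
    interpret X: H_rep P.sE "P.E X" N M lam by fact
    obtain t where t: "has_type P.sE (P.E X) \<phi> (t, 1)" "P.E X A1 (t, 1) = (0, 0)" "P.E X A2 (t, 1) = (0, 0)"
      using lift[OF X(1)] X(2,3) by auto
    show ?thesis
    proof (rule P.innerI[OF X.gen_rep_axioms, where u = "\<lambda>_. (t, 1)"])
      show "P.E X x (t, 1) = (\<Sum>j\<in>{0}. P.sE (L1_gen \<phi> x 1) (t, 1))" for x
        using t by (cases x) (simp_all add: has_type_def ext_scale_def)
    qed simp
  qed
  have one: "has_dim (H_ext1 N M lam V W) 1"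
    if g: "g = A1 \<and> g' = A2 \<and> \<phi> = chi_bar \<chi> \<or> g = A2 \<and> g' = A1 \<and> \<phi> = chi_neg \<chi>" for g g'
  proof -
    \<comment> \<open>\<open>g\<close> is the generator that turns type \<phi> into \<chi>; it sends
      the basis vector of \<open>V\<close> to that of \<open>W\<close>.\<close>
    define Z :: "gen \<Rightarrow> 'k \<Rightarrow> 'k" where "Z x v = (if x = g then v else 0)" for x v
    have Z: "H_rep P.sE (P.E Z) N M lam"
      by (rule P.H_rep_ext_if_derivation) (use g in \<open>auto simp: Z_def algebra_simps\<close>)
    show ?thesis
    proof (rule P.has_dim_H_ext1_1[OF Z])
      show "c = 0" if c: "inner (*) (L1_gen \<chi>) (*) (L1_gen \<phi>) (\<lambda>x v. c * Z x v)" for c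
      proof -
        obtain T where "\<And>x v. P.E (\<lambda>x v. c * Z x v) x (T v, v) = (T (L1_gen \<phi> x v), L1_gen \<phi> x v)"
          "\<And>v w. T (v + w) = T v + T w"
          using P.innerE[OF c] by metis
        \<comment> \<open>\<open>g\<close> acts by zero on both modules, so an inner block vanishes
          at \<open>g\<close>.\<close>
        from this(1)[of g 1] this(2)[of 0 0] g show ?thesis by (auto simp: ext_simps Z_def)
      qed
      fix X assume X: "H_rep P.sE (P.E X) N M lam"
      \<comment> \<open>The second components differ by a sign and are nonzero, so the other
        generator \<open>g'\<close> has no room for an obstruction.\<close>
      have "chi_bar \<chi> \<noteq> chi_neg \<chi>" using nz by (cases \<chi>) auto
      then have "X g' 1 = 0" using lift[OF X] g by auto
      then have "inner (*) (L1_gen \<chi>) (*) (L1_gen \<phi>) (\<lambda>x v. 1 * X x v + (- X g 1) * Z x v)"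
        by (intro inner0 P.H_rep_lincomb[OF X Z]) (use g in \<open>auto simp: Z_def\<close>)
      then show "\<exists>c. inner (*) (L1_gen \<chi>) (*) (L1_gen \<phi>) (\<lambda>x v. X x v - c * Z x v)" by auto
    qed
  qed
  show ?thesis
  proof (cases "\<phi> \<in> {chi_bar \<chi>, chi_neg \<chi>}")
    case True
    then show ?thesis using one[of A1 A2] one[of A2 A1] by auto
  next
    case False
    then show ?thesis using lift inner0 by (auto intro!: P.has_dim_H_ext1_0)
  qed
qed

section \<open>Extensions of the two-dimensional modules\<close>

lemma eq_neg_self_iff:
  fixes x :: "'k::field_char_0"
  shows "x = - x \<longleftrightarrow> x = 0" "- x = x \<longleftrightarrow> x = 0"
  by (simp_all add: eq_neg_iff_add_eq_0 neg_eq_iff_add_eq_0 flip: mult_2)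

lemma (in H_rep) has_type_shift:
  assumes "has_type s A \<chi> v" "g = A1 \<or> g = A2"
  shows "has_type s A (shift g \<chi>) (A g v)" "A g (A g v) = s (alpha_of g lam \<chi>) v"
  using assms(2) has_type_A1[OF assms(1)] has_type_A2[OF assms(1)] gen_A1_A1[OF assms(1)] gen_A2_A2[OF assms(1)]
  by (auto simp: shift_def alpha_of_def)

text \<open>Each shift negates the first component of a type, so this component alone tells the two
  basis vectors apart.\<close>

lemma L2_has_type:
  fixes lam :: "'k::field_char_0 \<times> 'k \<times> 'k"
  assumes w: "has_type scale2 (L2_gen g lam \<chi>) \<psi> w" and nz: "fst \<chi> \<noteq> 0" "snd \<chi> \<noteq> 0"
  shows "fst \<psi> = fst \<chi> \<Longrightarrow> \<exists>c. w = scale2 c (1, 0)" "fst \<psi> = - fst \<chi> \<Longrightarrow> \<exists>c. w = scale2 c (0, 1)"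
    "\<lbrakk>\<psi> \<noteq> \<chi>; \<psi> \<noteq> shift g \<chi>\<rbrakk> \<Longrightarrow> w = 0"
proof -
  obtain a b where w': "w = (a, b)" by (cases w)
  have e: "fst \<chi> * a = fst \<psi> * a" "- fst \<chi> * b = fst \<psi> * b" "snd \<chi> * a = snd \<psi> * a"
    "snd (shift g \<chi>) * b = snd \<psi> * b"
    using w by (auto simp: has_type_def w')
  show "\<exists>c. w = scale2 c (1, 0)" if "fst \<psi> = fst \<chi>"
    using e(2) nz by (simp add: w' that eq_neg_self_iff)
  show "\<exists>c. w = scale2 c (0, 1)" if "fst \<psi> = - fst \<chi>"
    using e(1) nz by (simp add: w' that eq_neg_self_iff)
  show "w = 0" if "\<psi> \<noteq> \<chi>" "\<psi> \<noteq> shift g \<chi>"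
    using e that unfolding mult_cancel_right by (auto simp: w' prod_eq_iff)
qed

lemma (in H_model_pair) has_type_ext_left:
  assumes "gen_rep sE (E X)"
  shows "has_type sE (E X) \<chi> (w, 0) \<longleftrightarrow> has_type sB B \<chi> w"
proof -
  have "A x 0 = 0" "X x 0 = 0" for x
    using gen_rep_extD(2)[OF assms, of x 0 0] V.gen_scale[of x 0 0] by simp_all
  then show ?thesis by (simp add: has_type_def ext_simps)
qed

text \<open>Both families are treated at once: \<open>g\<close> acts nontrivially and
  \<open>g'\<close> by zero. With a lift \<open>u\<close> of the generator, the obstructions are the
  vectors \<open>g' u\<close> and \<open>g' (g u)\<close> of \<open>W\<close>. Their types are
  either both absent from \<open>W\<close> or each occur once, which gives dimension 0 or 2.\<close>

lemma ext1_L2: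
  fixes lam :: "'k::field_char_0 \<times> 'k \<times> 'k"
    and V :: "('k free_alg set, 'v) module" and W :: "('k free_alg set, 'w) module"
  assumes NM: "N \<ge> 2" "M \<ge> 2" and \<chi>: "\<chi> \<in> chars N M" and \<phi>: "\<phi> \<in> Omega \<chi>"
    and g: "g = A1 \<and> g' = A2 \<or> g = A2 \<and> g' = A1"
    and V: "H_model scale2 (L2_gen g lam \<phi>) N M lam V \<iota>V" and W: "H_model scale2 (L2_gen g lam \<chi>) N M lam W \<iota>W"
  shows "has_dim (H_ext1 N M lam V W) (if \<phi> \<in> {shift g' (shift g \<chi>), shift g' \<chi>} then 2 else 0)"
proof -
  let ?A = "L2_gen g lam \<phi>" and ?B = "L2_gen g lam \<chi>"
  interpret P: H_model_pair scale2 ?A scale2 ?B N M lam V \<iota>V W \<iota>W "{0, 1}"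
    "\<lambda>i. if i = 0 then (1, 0) else (0, 1)" "\<lambda>i v. if i = 0 then fst v else snd v"
    by (intro H_model_pair.intro H_model_pair_axioms.intro V W) auto
  have \<phi>_chars: "\<phi> \<in> chars N M" using chars_Omega[OF \<phi> \<chi>] .
  note nz = chars_nonzero[OF \<phi>_chars NM] chars_nonzero[OF \<chi> NM]
  have g2: "g = A1 \<or> g = A2" "g' = A1 \<or> g' = A2" using g by auto
  have gens: "?B g' w = 0" "?A g' v = 0" "?A g (1, 0) = (0, 1)" "?A g (0, 1) = (alpha_of g lam \<phi>, 0)" for v w
    using g by (cases v; cases w; auto simp: zero_prod_def)+
  have shift_shift: "shift h (shift h \<psi>) = \<psi>" "shift g (shift g' \<psi>) = shift g' (shift g \<psi>)"
    for h and \<psi> :: "'k \<times> 'k"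
    by (auto simp: prod_eq_iff)
  have ne: "shift g' \<chi> \<noteq> \<chi>" "shift g' \<chi> \<noteq> shift g \<chi>" "shift g' (shift g \<chi>) \<noteq> \<chi>"
    "shift g' (shift g \<chi>) \<noteq> shift g \<chi>" "shift g' (shift g \<chi>) \<noteq> shift g' \<chi>"
    using nz g by (auto simp: prod_eq_iff eq_neg_self_iff)
  have lift: "\<exists>t. has_type P.sE (P.E X) \<phi> (t, 1, 0) \<and> has_type scale2 ?B (shift g' \<phi>) (X g' (1, 0))
      \<and> has_type scale2 ?B (shift g' (shift g \<phi>)) (X g' (0, 1))"
    if X: "H_rep P.sE (P.E X) N M lam" for X
  proof -
    interpret X: H_rep P.sE "P.E X" N M lam by fact
    have "has_type scale2 ?A \<phi> (1, 0)" by (simp add: has_type_def)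
    then have "\<exists>t. has_type P.sE (P.E X) \<phi> (t, 1, 0)"
      using NM by (intro P.lift_type[OF X _ \<phi>_chars]) (simp_all only: of_nat_eq_0_iff)
    then obtain t where t: "has_type P.sE (P.E X) \<phi> (t, 1, 0)" by blast
    have A: "P.E X g' (t, 1, 0) = (X g' (1, 0), 0)" "P.E X g' (P.E X g (t, 1, 0)) = (X g' (0, 1), 0)"
      by (simp_all add: ext_simps gens)
    have "has_type P.sE (P.E X) (shift g' \<phi>) (X g' (1, 0), 0)"
      "has_type P.sE (P.E X) (shift g' (shift g \<phi>)) (X g' (0, 1), 0)"
      using X.has_type_shift(1)[OF t g2(2)] X.has_type_shift(1)[OF X.has_type_shift(1)[OF t g2(1)] g2(2)]
      by (simp_all add: A)
    then show ?thesis using t unfolding P.has_type_ext_left[OF X.gen_rep_axioms] by blast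
  qed
  have inner0: "inner scale2 ?B scale2 ?A X"
    if X: "H_rep P.sE (P.E X) N M lam" and X2: "X g' (1, 0) = 0" "X g' (0, 1) = 0" for X
  proof -
    interpret X: H_rep P.sE "P.E X" N M lam by fact
    obtain t where t: "has_type P.sE (P.E X) \<phi> (t, 1, 0)" using lift[OF X] by blast
    \<comment> \<open>The second basis vector is lifted to \<open>g u\<close>. The square of
      \<open>g\<close> acts on \<open>u\<close> by the same scalar as in \<open>V\<close>, because
      that scalar depends only on the type; so only \<open>g'\<close> has to be checked
      further.\<close>
    define u where "u i = (if i = 0 then (t, 1, 0) else P.E X g (t, 1, 0))" for i :: nat
    have g'_u: "P.E X g' (u i) = 0" for i
      using X2 by (simp add: u_def ext_simps gens zero_prod_def)
    show ?thesis
    proof (rule P.innerI[OF X.gen_rep_axioms, where u = u])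
      show "snd (u i) = (if i = 0 then (1, 0) else (0, 1))" for i
        by (simp add: u_def ext_simps gens)
      show "P.E X x (u i) = (\<Sum>j\<in>{0, 1}. P.sE (if j = 0 then fst (?A x (if i = 0 then (1, 0) else (0, 1)))
          else snd (?A x (if i = 0 then (1, 0) else (0, 1)))) (u j))" if "i \<in> {0, 1}" for x i
        using that g t X.has_type_shift[OF t g2(1)] g'_u[of 0] g'_u[of 1]
        by (cases x) (auto simp: has_type_def u_def)
    qed
  qed
  \<comment> \<open>\<open>Omega \<chi>\<close> is the orbit of \<chi> under the commuting
    involutions \<open>shift g\<close> and \<open>shift g'\<close>; the split is by whether
    \<open>shift g'\<close> is involved.\<close>
  consider (same) "\<phi> = \<chi> \<or> \<phi> = shift g \<chi>" | (opp) "\<phi> = shift g' (shift g \<chi>) \<or> \<phi> = shift g' \<chi>"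
    using \<phi> g by (auto simp: Omega_def shift_def prod_eq_iff)
  then show ?thesis
  proof cases
    case same
    then have types: "shift g' \<phi> = shift g' \<chi> \<or> shift g' \<phi> = shift g' (shift g \<chi>)"
      "shift g' (shift g \<phi>) = shift g' \<chi> \<or> shift g' (shift g \<phi>) = shift g' (shift g \<chi>)"
      by (elim disjE; simp add: shift_shift)+
    have zero: "w = 0"
      if "has_type scale2 ?B \<psi> w" "\<psi> = shift g' \<chi> \<or> \<psi> = shift g' (shift g \<chi>)" for w \<psi>
      using L2_has_type(3)[OF that(1)] nz that(2) ne by (elim disjE) simp_all
    have "inner scale2 ?B scale2 ?A X" if X: "H_rep P.sE (P.E X) N M lam" for X
      using lift[OF X] zero[OF _ types(1)] zero[OF _ types(2)] by (intro inner0[OF X]) blast+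
    moreover have "\<phi> \<notin> {shift g' (shift g \<chi>), shift g' \<chi>}" using same ne by auto
    ultimately show ?thesis by (auto intro: P.has_dim_H_ext1_0)
  next
    case opp
    \<comment> \<open>\<open>b1\<close> and \<open>b2\<close> are the basis vectors of
      \<open>W\<close> having the types of the two obstructions.\<close>
    define b1 :: "'k \<times> 'k" where "b1 = (if \<phi> = shift g' \<chi> then (1, 0) else (0, 1))"
    define b2 :: "'k \<times> 'k" where "b2 = (if \<phi> = shift g' \<chi> then (0, 1) else (1, 0))"
    have span1: "\<exists>c. w = scale2 c b1" if "has_type scale2 ?B (shift g' \<phi>) w" for w
      using L2_has_type[OF that] opp nz ne by (elim disjE) (simp_all add: b1_def)
    have span2: "\<exists>c. w = scale2 c b2" if "has_type scale2 ?B (shift g' (shift g \<phi>)) w" for w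
      using L2_has_type[OF that] opp nz ne by (elim disjE) (simp_all add: b2_def)
    \<comment> \<open>Any \<open>c\<close> and \<open>d\<close> are allowed: each quartic word
      contains \<open>g'\<close> twice, so after \<open>Z\<close> replaces one occurrence the other
      still acts by zero, and likewise in the square of \<open>g'\<close>.\<close>
    define Z where "Z c d x v = (if x = g' then scale2 (c * fst v) b1 + scale2 (d * snd v) b2 else 0)"
      for c d x and v :: "'k \<times> 'k"
    have Z: "H_rep P.sE (P.E (Z c d)) N M lam" for c d
      by (rule P.H_rep_ext_if_derivation)
        (use opp ne g in \<open>auto simp: Z_def b1_def b2_def split_paired_all zero_prod_def algebra_simps\<close>)
    have "has_dim (H_ext1 N M lam V W) 2"
    proof (rule P.has_dim_H_ext1_2[OF Z[of 1 0] Z[of 0 1]])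
      have ZZ: "scale2 c (Z 1 0 x v) + scale2 d (Z 0 1 x v) = Z c d x v" for c d x v
        by (simp add: Z_def b1_def b2_def zero_prod_def)
      show "c = 0 \<and> d = 0" if c: "inner scale2 ?B scale2 ?A (\<lambda>x v. scale2 c (Z 1 0 x v) + scale2 d (Z 0 1 x v))" for c d
      proof -
        obtain T where T: "\<And>x v. P.E (Z c d) x (T v, v) = (T (?A x v), ?A x v)" "\<And>v w. T (v + w) = T v + T w"
          using P.innerE[OF c[unfolded ZZ]] by metis
        have "T 0 = 0" using T(2)[of 0 0] by simp
        \<comment> \<open>Since \<open>g'\<close> acts by zero on both modules, an inner block
          vanishes at \<open>g'\<close>, where \<open>Z\<close> has all its entries.\<close>
        then have "Z c d g' (1, 0) = 0" "Z c d g' (0, 1) = 0"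
          using T(1)[of g' "(1, 0)"] T(1)[of g' "(0, 1)"] by (simp_all add: ext_simps gens)
        then show ?thesis by (auto simp: Z_def b1_def b2_def zero_prod_def split: if_splits)
      qed
      fix X assume X: "H_rep P.sE (P.E X) N M lam"
      obtain c d where cd: "X g' (1, 0) = scale2 c b1" "X g' (0, 1) = scale2 d b2"
        using lift[OF X] span1 span2 by blast
      have neg1: "scale2 1 a + scale2 (- 1) b = a - b" for a b :: "'k \<times> 'k" by (cases a; cases b) simp
      have "inner scale2 ?B scale2 ?A (\<lambda>x v. scale2 1 (X x v) + scale2 (- 1) (Z c d x v))"
        by (intro inner0 P.H_rep_lincomb[OF X Z])
          (simp_all add: neg1 cd, simp_all add: Z_def b1_def b2_def zero_prod_def)
      then show "\<exists>c d. inner scale2 ?B scale2 ?A (\<lambda>x v. X x v - (scale2 c (Z 1 0 x v) + scale2 d (Z 0 1 x v)))"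
        unfolding ZZ neg1 by blast
    qed
    then show ?thesis using opp by simp
  qed
qed

section \<open>Extensions of the four-dimensional modules\<close>

text \<open>Expanding \<open>P (P v)\<close>, the mixed terms are the two quartic words and give
  \<open>alpha3\<close>, while the outer terms reduce by the square relations. The resulting scalar
  is the quadratic defining \<open>e\<close>.\<close>

lemma (in H_rep) L4_operator_square:
  assumes v: "has_type s A \<chi> v" and e: "L4_root lam \<chi> e"
    and w: "w = A A2 v - s e (A A1 (A A2 (A A1 v)))"
  shows "A A2 w - s e (A A1 (A A2 (A A1 w))) = 0"
proof -
  have diff: "A x (a - b) = A x a - A x b" for x a b using act_diff[of "var x" a b] by (simp add: act_var)
  note t1 = has_type_A1[OF v] and t2 = has_type_A2[OF v]
  note t21 = has_type_A2[OF t1]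
  have "A A1 (A A1 (A A2 (A A1 v))) = s (alpha1 lam \<chi>) (A A2 (A A1 v))"
    "A A2 (A A2 (A A1 v)) = s (alpha2 lam \<chi>) (A A1 v)"
    "A A1 (A A1 v) = s (alpha1 lam \<chi>) v" "A A2 (A A2 v) = s (alpha2 lam \<chi>) v"
    using gen_A1_A1[OF t21] gen_A2_A2[OF t1] gen_A1_A1[OF v] gen_A2_A2[OF v] by simp_all
  then have "A A2 w - s e (A A1 (A A2 (A A1 w))) =
      s (alpha2 lam \<chi>) v - s e (A A1 (A A2 (A A1 (A A2 v))) + A A2 (A A1 (A A2 (A A1 v))))
        + s (e * (e * (alpha1 lam \<chi> * (alpha2 lam \<chi> * alpha1 lam \<chi>)))) v"
    by (simp add: w diff gen_scale scale_right_diff_distrib scale_right_distrib algebra_simps)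
  also have "\<dots> = s (alpha2 lam \<chi> - e * alpha3 lam \<chi>
      + e * (e * (alpha1 lam \<chi> * (alpha2 lam \<chi> * alpha1 lam \<chi>)))) v"
    by (simp add: gen_quartic[OF v] scale_left_distrib scale_left_diff_distrib)
  also have "alpha2 lam \<chi> - e * alpha3 lam \<chi>
      + e * (e * (alpha1 lam \<chi> * (alpha2 lam \<chi> * alpha1 lam \<chi>))) = 0"
    using e by (simp add: L4_root_def power2_eq_square algebra_simps)
  finally show ?thesis by simp
qed

text \<open>This is why \<open>P v = 0\<close> is the only relation of the generator: the rest of
  the multiplication table of \<open>L\<^sub>4\<close> follows, and the constant \<open>c\<close> in
  it is forced by the quartic relation.\<close>

lemma (in H_rep) L4_relations:
  assumes v: "has_type s A \<chi> v" and e: "A A2 v = s e (A A1 (A A2 (A A1 v)))"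
  shows "A A1 (A A1 (A A2 (A A1 v))) = s (alpha1 lam \<chi>) (A A2 (A A1 v))"
    and "A A2 (A A2 (A A1 v)) = s (alpha2 lam \<chi>) (A A1 v)"
    and "A A2 (A A1 (A A2 (A A1 v))) = s (alpha3 lam \<chi> - (alpha1 lam \<chi>)\<^sup>2 * alpha2 lam \<chi> * e) v"
proof -
  note t1 = has_type_A1[OF v] and t21 = has_type_A2[OF has_type_A1[OF v]]
  show 1: "A A1 (A A1 (A A2 (A A1 v))) = s (alpha1 lam \<chi>) (A A2 (A A1 v))" using gen_A1_A1[OF t21] by simp
  show 2: "A A2 (A A2 (A A1 v)) = s (alpha2 lam \<chi>) (A A1 v)" using gen_A2_A2[OF t1] by simp
  have "A A1 (A A2 (A A1 (A A2 v))) = s ((alpha1 lam \<chi>)\<^sup>2 * alpha2 lam \<chi> * e) v"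
    by (simp add: e gen_scale 1 2 gen_A1_A1[OF v] power2_eq_square mult_ac)
  then show "A A2 (A A1 (A A2 (A A1 v))) = s (alpha3 lam \<chi> - (alpha1 lam \<chi>)\<^sup>2 * alpha2 lam \<chi> * e) v"
    using gen_quartic[OF v] by (simp add: scale_left_diff_distrib eq_diff_eq add.commute)
qed

text \<open>The quantities are the entries of \<open>P\<close> between opposite types, grouped by
  the pairs \<chi>, -\<chi> and their images under \<open>chi_bar\<close>. With nonzero discriminant
  no pair has both entries zero. With zero discriminant the root is double and \<open>a1 * e\<close>
  is 1 or -1.\<close>

lemma L4_root_facts:
  fixes a1 a2 a3 d e :: "'k::field_char_0"
  assumes d: "a1\<^sup>2 * a2 * d\<^sup>2 - a3 * d + a2 = 0" and e: "a1\<^sup>2 * a2 * e\<^sup>2 - a3 * e + a2 = 0"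
    and ne: "a3 \<noteq> 0 \<or> (a1 \<noteq> 0 \<and> a2 \<noteq> 0)"
  defines "c \<equiv> a3 - a1\<^sup>2 * a2 * d"
  shows "a3\<^sup>2 - 4 * a1\<^sup>2 * a2\<^sup>2 \<noteq> 0 \<Longrightarrow> d = e \<Longrightarrow> c - e * a1\<^sup>2 * a2 \<noteq> 0"
    and "a3\<^sup>2 - 4 * a1\<^sup>2 * a2\<^sup>2 \<noteq> 0 \<Longrightarrow> 1 - e * d * a1\<^sup>2 = 0 \<Longrightarrow> a2 - e * c \<noteq> 0"
    and "a3\<^sup>2 - 4 * a1\<^sup>2 * a2\<^sup>2 = 0 \<Longrightarrow>
      a1 \<noteq> 0 \<and> a2 \<noteq> 0 \<and> e \<noteq> 0 \<and> d = e \<and> a3 = 2 * a2 / e \<and> (a1 = 1 / e \<or> a1 = - 1 / e)"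
proof -
  \<comment> \<open>Completing the square: the square of the derivative is the discriminant plus
    four times the leading coefficient times the value, so at a root it is the discriminant.\<close>
  have sq: "(2 * a1\<^sup>2 * a2 * x - a3)\<^sup>2 = a3\<^sup>2 - 4 * a1\<^sup>2 * a2\<^sup>2 + 4 * a1\<^sup>2 * a2 * (a1\<^sup>2 * a2 * x\<^sup>2 - a3 * x + a2)" for x
    by (simp add: power2_eq_square algebra_simps)
  show "c - e * a1\<^sup>2 * a2 \<noteq> 0" if "a3\<^sup>2 - 4 * a1\<^sup>2 * a2\<^sup>2 \<noteq> 0" "d = e"
  proof
    assume "c - e * a1\<^sup>2 * a2 = 0"
    then have "2 * a1\<^sup>2 * a2 * d - a3 = 0" using that(2) by (simp add: c_def algebra_simps)
    then have "a3\<^sup>2 - 4 * a1\<^sup>2 * a2\<^sup>2 = 0" using sq[of d] d by simp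
    then show False using that(1) by simp
  qed
  show "a2 - e * c \<noteq> 0" if D: "a3\<^sup>2 - 4 * a1\<^sup>2 * a2\<^sup>2 \<noteq> 0" and r: "1 - e * d * a1\<^sup>2 = 0"
  proof
    assume "a2 - e * c = 0"
    then have "a2 - e * a3 + (e * d * a1\<^sup>2) * a2 = 0" by (simp add: c_def algebra_simps)
    then have a: "e * a3 = 2 * a2" using r by (simp add: algebra_simps)
    have e0: "e \<noteq> 0" using r by auto
    have "a1\<^sup>2 * a2 * e\<^sup>2 = a2" using e a by (simp add: algebra_simps)
    then have "4 * a2 * (a1\<^sup>2 * a2 * e\<^sup>2) = (e * a3)\<^sup>2" by (simp add: a power2_eq_square)
    moreover have "e\<^sup>2 * (a3\<^sup>2 - 4 * a1\<^sup>2 * a2\<^sup>2) = (e * a3)\<^sup>2 - 4 * a2 * (a1\<^sup>2 * a2 * e\<^sup>2)"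
      by (simp add: power2_eq_square right_diff_distrib mult_ac)
    ultimately have "e\<^sup>2 * (a3\<^sup>2 - 4 * a1\<^sup>2 * a2\<^sup>2) = 0" by simp
    then show False using D e0 by simp
  qed
  assume D: "a3\<^sup>2 - 4 * a1\<^sup>2 * a2\<^sup>2 = 0"
  then have nz: "a1 \<noteq> 0" "a2 \<noteq> 0" using ne by auto
  have *: "2 * a1\<^sup>2 * a2 * d - a3 = 0" "2 * a1\<^sup>2 * a2 * e - a3 = 0" using sq[of d] sq[of e] d e D by simp_all
  then have "2 * a1\<^sup>2 * a2 * (d - e) = 0" by (simp add: algebra_simps)
  then have de: "d = e" using nz by simp
  have a3: "a3 = 2 * a1\<^sup>2 * a2 * e" using * by simp
  have "a2 * (1 - (a1 * e)\<^sup>2) = 0" using e unfolding a3 by (simp add: power2_eq_square algebra_simps)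
  then have r: "(a1 * e)\<^sup>2 = 1" using nz by simp
  then have e0: "e \<noteq> 0" by auto
  have "a1 * e = 1 \<or> a1 * e = - 1" using r by (simp add: power2_eq_1_iff)
  then have "a1 = 1 / e \<or> a1 = - 1 / e" using e0 by (auto simp: field_simps)
  moreover have "a3 = 2 * a2 / e" using r e0 unfolding a3 by (simp add: field_simps power2_eq_square)
  ultimately show "a1 \<noteq> 0 \<and> a2 \<noteq> 0 \<and> e \<noteq> 0 \<and> d = e \<and> a3 = 2 * a2 / e \<and> (a1 = 1 / e \<or> a1 = - 1 / e)"
    using nz de e0 by blast
qed

definition L4_basis :: "nat \<Rightarrow> 'k::field \<times> 'k \<times> 'k \<times> 'k" where
  "L4_basis i = (if i = 0 then (1, 0, 0, 0) else if i = 1 then (0, 1, 0, 0)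
    else if i = 2 then (0, 0, 1, 0) else (0, 0, 0, 1))"

definition L4_coord :: "nat \<Rightarrow> 'k \<times> 'k \<times> 'k \<times> 'k \<Rightarrow> 'k" where
  "L4_coord i = (\<lambda>(v1, v2, v3, v4). if i = 0 then v1 else if i = 1 then v2 else if i = 2 then v3 else v4)"

text \<open>The basis vector of \<open>L\<^sub>4\<^sup>\<chi>\<close> of type \<open>- \<phi>\<close>, for \<open>\<phi> \<in> \<Omega>(\<chi>)\<close>.\<close>

definition L4_opposite :: "'k::field \<times> 'k \<Rightarrow> 'k \<times> 'k \<Rightarrow> 'k \<times> 'k \<times> 'k \<times> 'k" where
  "L4_opposite \<chi> \<phi> = (if \<phi> = \<chi> then (0, 0, 0, 1) else if \<phi> = chi_bar \<chi> then (0, 0, 1, 0)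
    else if \<phi> = chi_neg (chi_bar \<chi>) then (0, 1, 0, 0) else (1, 0, 0, 0))"

lemma L4_has_type:
  fixes lam :: "'k::field_char_0 \<times> 'k \<times> 'k"
  assumes nz: "fst \<chi> \<noteq> 0" "snd \<chi> \<noteq> 0"
  shows "has_type scale4 (L4_gen lam \<chi> d) \<chi> (v1, v2, v3, v4) \<longleftrightarrow> v2 = 0 \<and> v3 = 0 \<and> v4 = 0"
    "has_type scale4 (L4_gen lam \<chi> d) (chi_bar \<chi>) (v1, v2, v3, v4) \<longleftrightarrow> v1 = 0 \<and> v3 = 0 \<and> v4 = 0"
    "has_type scale4 (L4_gen lam \<chi> d) (chi_neg (chi_bar \<chi>)) (v1, v2, v3, v4) \<longleftrightarrow> v1 = 0 \<and> v2 = 0 \<and> v4 = 0"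
    "has_type scale4 (L4_gen lam \<chi> d) (chi_neg \<chi>) (v1, v2, v3, v4) \<longleftrightarrow> v1 = 0 \<and> v2 = 0 \<and> v3 = 0"
  using nz by (simp_all add: has_type_def eq_neg_self_iff) blast+

text \<open>\<open>P\<close> exchanges opposite types, so it is antidiagonal in this basis, and its
  homology is computed separately on the outer and on the inner pair of coordinates.\<close>

lemma L4_operator:
  fixes lam :: "'k::field_char_0 \<times> 'k \<times> 'k"
  shows "L4_gen lam \<chi> d A2 (v1, v2, v3, v4)
      - scale4 e (L4_gen lam \<chi> d A1 (L4_gen lam \<chi> d A2 (L4_gen lam \<chi> d A1 (v1, v2, v3, v4)))) =
    (((alpha3 lam \<chi> - (alpha1 lam \<chi>)\<^sup>2 * alpha2 lam \<chi> * d) - e * (alpha1 lam \<chi>)\<^sup>2 * alpha2 lam \<chi>) * v4,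
     (alpha2 lam \<chi> - e * (alpha3 lam \<chi> - (alpha1 lam \<chi>)\<^sup>2 * alpha2 lam \<chi> * d)) * v3,
     (1 - e * d * (alpha1 lam \<chi>)\<^sup>2) * v2, (d - e) * v1)"
  by (simp add: power2_eq_square algebra_simps)

text \<open>The obstruction of a lift is a vector of \<open>W\<close> of type -\<phi> killed by
  \<open>P\<close>, and changing the lift by \<open>s\<close> of type \<phi> changes it by
  \<open>P s\<close>. Nonzero discriminant makes the two entries of \<open>P\<close> on this pair of
  types exact; zero discriminant makes \<open>P\<close> vanish on \<open>W\<close>, so the
  obstruction is an arbitrary multiple of one vector.\<close>

lemma ext1_L4:
  fixes lam :: "'k::field_char_0 \<times> 'k \<times> 'k"
    and V :: "('k free_alg set, 'v) module" and W :: "('k free_alg set, 'w) module"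
  assumes NM: "N \<ge> 2" "M \<ge> 2" and \<chi>4: "\<chi> \<in> chars4 N M lam" and \<phi>: "\<phi> \<in> Omega \<chi>"
    and d: "L4_root lam \<chi> d" and e: "L4_root lam \<chi> e"
    and V: "is_L4 N M lam \<phi> e V" and W: "is_L4 N M lam \<chi> d W"
  shows "has_dim (H_ext1 N M lam V W) (if Disc lam \<chi> = 0 then 1 else 0)"
proof -
  let ?A = "L4_gen lam \<phi> e" and ?B = "L4_gen lam \<chi> d"
  obtain \<iota>V \<iota>W where "H_model scale4 ?A N M lam V \<iota>V" "H_model scale4 ?B N M lam W \<iota>W"
    using H_model_L4[OF V] H_model_L4[OF W] by blast
  then interpret P: H_model_pair scale4 ?A scale4 ?B N M lam V \<iota>V W \<iota>W "{0, 1, 2, 3}" L4_basis L4_coord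
    by (intro H_model_pair.intro H_model_pair_axioms.intro) (auto simp: L4_basis_def L4_coord_def)
  have \<chi>: "\<chi> \<in> chars N M" using \<chi>4 by (simp add: chars4_def)
  have \<phi>_chars: "\<phi> \<in> chars N M" using chars_Omega[OF \<phi> \<chi>] .
  note alpha = alpha_Omega[OF \<phi>, of lam]
  have e': "L4_root lam \<phi> e" using e by (simp add: L4_root_def alpha)
  define a1 where "a1 = alpha1 lam \<chi>"
  define a2 where "a2 = alpha2 lam \<chi>"
  define a3 where "a3 = alpha3 lam \<chi>"
  define c where "c = a3 - a1\<^sup>2 * a2 * d"
  note a = a1_def[symmetric] a2_def[symmetric] a3_def[symmetric]
  have nzA: "a3 \<noteq> 0 \<or> (a1 \<noteq> 0 \<and> a2 \<noteq> 0)"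
    using \<chi>4 by (auto simp: chars4_def chars1_def chars2_def a)
  note root = L4_root_facts[OF d[unfolded L4_root_def a] e[unfolded L4_root_def a] nzA, folded c_def]
  have Disc: "Disc lam \<chi> = a3\<^sup>2 - 4 * a1\<^sup>2 * a2\<^sup>2" by (simp add: Disc_def a)
  note nz = chars_nonzero[OF \<chi> NM]
  note types = L4_has_type[OF conjunct1[OF nz] conjunct2[OF nz], of lam d]
  note oper = L4_operator[where lam = lam and \<chi> = \<chi> and d = d and e = e, unfolded a, folded c_def]
  have ne: "\<chi> \<noteq> chi_bar \<chi>" "\<chi> \<noteq> chi_neg \<chi>" "chi_bar \<chi> \<noteq> chi_neg (chi_bar \<chi>)" "\<chi> \<noteq> chi_neg (chi_bar \<chi>)"
      "chi_bar \<chi> \<noteq> chi_neg \<chi>" "chi_neg (chi_bar \<chi>) \<noteq> chi_neg \<chi>"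
    using nz by (auto simp: prod_eq_iff eq_neg_self_iff)
  have neg: "chi_neg (chi_bar (chi_bar \<chi>)) = chi_neg \<chi>" "chi_neg (chi_neg (chi_bar \<chi>)) = chi_bar \<chi>"
      "chi_neg (chi_neg \<chi>) = \<chi>"
    by (simp_all add: prod_eq_iff)
  have \<phi>_cases: "\<phi> = \<chi> \<or> \<phi> = chi_bar \<chi> \<or> \<phi> = chi_neg (chi_bar \<chi>) \<or> \<phi> = chi_neg \<chi>"
    using \<phi> by (auto simp: Omega_def)
  let ?e0 = "(1, 0, 0, 0) :: 'k \<times> 'k \<times> 'k \<times> 'k"
  \<comment> \<open>This is \<open>P\<close> applied to the lift \<open>(t, ?e0)\<close>; it lies in
    \<open>W\<close> because \<open>P\<close> kills the generator of \<open>V\<close>.\<close>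
  define obst where "obst X t = P.E X A2 (t, ?e0) - P.sE e (P.E X A1 (P.E X A2 (P.E X A1 (t, ?e0))))" for X t
  have A_e: "?A A1 ?e0 = (0, 1, 0, 0)" "?A A2 (0, 1, 0, 0) = (0, 0, 1, 0)" "?A A1 (0, 0, 1, 0) = (0, 0, 0, 1)"
    "?A A2 ?e0 = (0, 0, 0, e)" by simp_all
  have snd_obst: "snd (obst X t) = 0" for X t
    by (simp add: obst_def ext_simps zero_prod_def)
  have lift: "\<exists>t p. has_type P.sE (P.E X) \<phi> (t, ?e0) \<and> obst X t = (p, 0)
      \<and> has_type scale4 ?B (chi_neg \<phi>) p \<and> ?B A2 p - scale4 e (?B A1 (?B A2 (?B A1 p))) = 0"
    if X: "H_rep P.sE (P.E X) N M lam" for X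
  proof -
    interpret X: H_rep P.sE "P.E X" N M lam by fact
    have "has_type scale4 ?A \<phi> ?e0" by (simp add: has_type_def)
    then have "\<exists>t. has_type P.sE (P.E X) \<phi> (t, ?e0)"
      using NM by (intro P.lift_type[OF X _ \<phi>_chars]) (simp_all only: of_nat_eq_0_iff)
    then obtain t where t: "has_type P.sE (P.E X) \<phi> (t, ?e0)" by blast
    obtain p where p: "obst X t = (p, 0)" using snd_obst[of X t] by (metis prod.collapse)
    \<comment> \<open>The two shifts by \<open>chi_bar\<close> cancel, so both terms of
      \<open>P\<close> turn type \<phi> into -\<phi>.\<close>
    have "has_type P.sE (P.E X) (chi_neg \<phi>) (P.E X A1 (P.E X A2 (P.E X A1 (t, ?e0))))"
    proof -
      have "chi_bar (chi_neg (chi_bar \<phi>)) = chi_neg \<phi>" by (simp add: prod_eq_iff)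
      then show ?thesis using X.has_type_A1[OF X.has_type_A2[OF X.has_type_A1[OF t]]] by simp
    qed
    then have "has_type P.sE (P.E X) (chi_neg \<phi>) (obst X t)"
      using X.has_type_closed(1)[OF X.has_type_A2[OF t] X.has_type_closed(2)[of _ _ "- e"]]
      by (simp add: obst_def)
    then have p1: "has_type scale4 ?B (chi_neg \<phi>) p" by (simp add: p P.has_type_ext_left X.gen_rep_axioms)
    have X0: "X x 0 = 0" "?A x 0 = 0" for x
      using P.gen_rep_extD(2)[OF X.gen_rep_axioms, of x 0 0] P.V.gen_scale[of x 0 0] by simp_all
    have "P.E X A2 (obst X t) - P.sE e (P.E X A1 (P.E X A2 (P.E X A1 (obst X t)))) = 0"
      by (rule X.L4_operator_square[OF t e']) (simp add: obst_def)
    then have "?B A2 p - scale4 e (?B A1 (?B A2 (?B A1 p))) = 0"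
      by (simp add: p ext_simps X0 prod_eq_iff)
    then show ?thesis using t p p1 by blast
  qed
  have inner0: "inner scale4 ?B scale4 ?A X"
    if X: "H_rep P.sE (P.E X) N M lam" and t: "has_type P.sE (P.E X) \<phi> (t, ?e0)" and ob: "obst X t = 0" for X t
  proof -
    interpret X: H_rep P.sE "P.E X" N M lam by fact
    \<comment> \<open>The lifts of the four basis vectors are generated from the first along
      \<open>a\<^sub>1\<close>, \<open>a\<^sub>2\<close>, \<open>a\<^sub>1\<close>, as in
      \<open>V\<close>.\<close>
    define u where "u i = (if i = 0 then (t, ?e0) else if i = 1 then P.E X A1 (t, ?e0)
      else if i = 2 then P.E X A2 (P.E X A1 (t, ?e0)) else P.E X A1 (P.E X A2 (P.E X A1 (t, ?e0))))" for i :: nat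
    have A2t: "P.E X A2 (t, ?e0) = P.sE e (P.E X A1 (P.E X A2 (P.E X A1 (t, ?e0))))"
      using ob by (simp add: obst_def)
    note t1 = X.has_type_A1[OF t]
    note t2 = X.has_type_A2[OF t1]
    note t3 = X.has_type_A1[OF t2]
    note rel = X.L4_relations[OF t A2t] X.gen_A1_A1[OF t]
    show ?thesis
    proof (rule P.innerI[OF X.gen_rep_axioms, where u = u])
      show "snd (u i) = L4_basis i" if "i \<in> {0, 1, 2, 3}" for i
        using that by (auto simp: u_def L4_basis_def ext_simps)
      show "P.E X x (u i) = (\<Sum>j\<in>{0, 1, 2, 3}. P.sE (L4_coord j (?A x (L4_basis i))) (u j))"
        if "i \<in> {0, 1, 2, 3}" for x i
      proof -
        consider "i = 0" | "i = 1" | "i = 2" | "i = 3" using \<open>i \<in> _\<close> by auto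
        then show ?thesis
          using t t1 t2 t3 rel A2t
          by cases (cases x; simp add: u_def L4_basis_def L4_coord_def has_type_def)+
      qed
    qed
  qed
  show ?thesis
  proof (cases "Disc lam \<chi> = 0")
    case False
    have "inner scale4 ?B scale4 ?A X" if X: "H_rep P.sE (P.E X) N M lam" for X
    proof -
      interpret X: H_rep P.sE "P.E X" N M lam by fact
      obtain t p where t: "has_type P.sE (P.E X) \<phi> (t, ?e0)" "obst X t = (p, 0)"
        and p: "has_type scale4 ?B (chi_neg \<phi>) p" "?B A2 p - scale4 e (?B A1 (?B A2 (?B A1 p))) = 0"
        using lift[OF X] by blast
      obtain p1 p2 p3 p4 where pp: "p = (p1, p2, p3, p4)" by (cases p) auto
      have "\<exists>s. has_type scale4 ?B \<phi> s \<and> ?B A2 s - scale4 e (?B A1 (?B A2 (?B A1 s))) = p"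
      proof -
        \<comment> \<open>Exactness for maps \<open>k\<close> and then \<open>k'\<close> between
          lines: a vector killed by \<open>k'\<close> is in the image of \<open>k\<close>, since
          either \<open>k\<close> is invertible or \<open>k'\<close> is and the vector is
          zero.\<close>
        have solve: "\<exists>x. k * x = q" if "k' * q = 0" "k = 0 \<Longrightarrow> k' \<noteq> 0" for k k' q :: 'k
          using that by (cases "k = 0") (auto intro: exI[of _ "q / k"])
        have D: "a3\<^sup>2 - 4 * a1\<^sup>2 * a2\<^sup>2 \<noteq> 0" using False by (simp add: Disc)
        have k14: "d - e = 0 \<Longrightarrow> c - e * a1\<^sup>2 * a2 \<noteq> 0" "c - e * a1\<^sup>2 * a2 = 0 \<Longrightarrow> d - e \<noteq> 0"
          using root(1)[OF D] by auto
        have k23: "1 - e * d * a1\<^sup>2 = 0 \<Longrightarrow> a2 - e * c \<noteq> 0" "a2 - e * c = 0 \<Longrightarrow> 1 - e * d * a1\<^sup>2 \<noteq> 0"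
          using root(2)[OF D] by auto
        have p0: "(c - e * a1\<^sup>2 * a2) * p4 = 0" "(a2 - e * c) * p3 = 0" "(1 - e * d * a1\<^sup>2) * p2 = 0" "(d - e) * p1 = 0"
          using p(2) unfolding pp oper zero_prod_def prod.inject by blast+
        obtain x1 where x1: "(d - e) * x1 = p4" using solve[OF p0(1) k14(1)] ..
        obtain x2 where x2: "(1 - e * d * a1\<^sup>2) * x2 = p3" using solve[OF p0(2) k23(1)] ..
        obtain x3 where x3: "(a2 - e * c) * x3 = p2" using solve[OF p0(3) k23(2)] ..
        obtain x4 where x4: "(c - e * a1\<^sup>2 * a2) * x4 = p1" using solve[OF p0(4) k14(2)] ..
        note simps = neg types pp oper x1 x2 x3 x4 mult_zero_right simp_thms
        from \<phi>_cases show ?thesis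
        proof (elim disjE)
          assume \<phi>: "\<phi> = \<chi>"
          show ?thesis using p(1) by (intro exI[of _ "(x1, 0, 0, 0)"]) (simp only: \<phi> simps)
        next
          assume \<phi>: "\<phi> = chi_bar \<chi>"
          show ?thesis using p(1) by (intro exI[of _ "(0, x2, 0, 0)"]) (simp only: \<phi> simps)
        next
          assume \<phi>: "\<phi> = chi_neg (chi_bar \<chi>)"
          show ?thesis using p(1) by (intro exI[of _ "(0, 0, x3, 0)"]) (simp only: \<phi> simps)
        next
          assume \<phi>: "\<phi> = chi_neg \<chi>"
          show ?thesis using p(1) by (intro exI[of _ "(0, 0, 0, x4)"]) (simp only: \<phi> simps)
        qed
      qed
      then obtain s where s: "has_type scale4 ?B \<phi> s" "?B A2 s - scale4 e (?B A1 (?B A2 (?B A1 s))) = p"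
        by blast
      have X0: "X x 0 = 0" "?A x 0 = 0" for x
        using P.gen_rep_extD(2)[OF X.gen_rep_axioms, of x 0 0] P.V.gen_scale[of x 0 0] by simp_all
      have diff: "P.E X x (v - w) = P.E X x v - P.E X x w" for x v w
        using X.act_diff[of "var x" v w] by (simp add: X.act_var)
      have ts: "(t - s, ?e0) = (t, ?e0) - (s, 0)" by simp
      have "obst X (t - s) = obst X t - (P.E X A2 (s, 0) - P.sE e (P.E X A1 (P.E X A2 (P.E X A1 (s, 0)))))"
        unfolding obst_def ts diff by (simp add: X.scale_right_diff_distrib)
      also have "\<dots> = 0" by (simp add: t(2) ext_simps X0 s(2))
      finally have "obst X (t - s) = 0" .
      moreover have "has_type P.sE (P.E X) \<phi> ((t, ?e0) + P.sE (- 1) (s, 0))"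
        using t(1) s(1) by (intro X.has_type_closed) (simp_all add: P.has_type_ext_left X.gen_rep_axioms)
      then have "has_type P.sE (P.E X) \<phi> (t - s, ?e0)" by (simp add: ts del: diff_Pair)
      ultimately show ?thesis using inner0[OF X] by blast
    qed
    then show ?thesis using False P.has_dim_H_ext1_0 by simp
  next
    case True
    then have val: "d = e" "e \<noteq> 0" "a2 \<noteq> 0" "a3 = 2 * a2 / e" "a1 = 1 / e \<or> a1 = - 1 / e"
      using root(3) by (simp_all add: Disc)
    \<comment> \<open>Both signs of \<open>a1 * e\<close> are covered by this one equation.\<close>
    have a1_e: "a1 * (a1 * (e * e)) = 1" using val(2,5) by auto
    have coeffs: "c - e * a1\<^sup>2 * a2 = 0" "a2 - e * c = 0" "1 - e * d * a1\<^sup>2 = 0" "d - e = 0"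
      using val(1,2) by (simp_all add: c_def val(4) power2_eq_square field_simps a1_e)
    have oper0: "?B A2 w - scale4 e (?B A1 (?B A2 (?B A1 w))) = 0" for w
      by (cases w) (simp only: oper coeffs mult_zero_left zero_prod_def)
    define b where "b = L4_opposite \<chi> \<phi>"
    have b_type: "has_type scale4 ?B (chi_neg \<phi>) b"
      using \<phi>_cases ne by (elim disjE) (simp_all add: b_def L4_opposite_def neg types)
    have b_span: "\<exists>k. w = scale4 k b" if "has_type scale4 ?B (chi_neg \<phi>) w" for w
      using that \<phi>_cases ne by (cases w, elim disjE) (simp_all add: b_def L4_opposite_def neg types)
    have b0: "scale4 k b = 0 \<Longrightarrow> k = 0" for k
      by (simp add: b_def L4_opposite_def zero_prod_def split: if_splits)
    \<comment> \<open>The first basis vector goes to \<open>b\<close>, so that the obstruction is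
      \<open>b\<close>. The relation for \<open>a\<^sub>2\<close> squared then forces the value on
      the fourth: from \<open>a\<^sub>2 v\<^sub>1 = e v\<^sub>4\<close> it must be
      \<open>a\<^sub>2 b\<close> divided by \<open>-e\<close>.\<close>
    define Z where "Z x v = (if x = A2 then scale4 (fst v) b - scale4 (snd (snd (snd v)) / e) (?B A2 b) else 0)"
      for x and v :: "'k \<times> 'k \<times> 'k \<times> 'k"
    have Z: "H_rep P.sE (P.E Z) N M lam"
    proof -
      have alphas: "alpha1 lam \<phi> = a1" "alpha2 lam \<phi> = a2" "alpha3 lam \<phi> = 2 * a2 / e"
        "alpha1 lam \<chi> = a1" "alpha2 lam \<chi> = a2" "alpha3 lam \<chi> = 2 * a2 / e" "d = e"
        using val by (simp_all add: alpha a)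
      show ?thesis
      proof (rule P.H_rep_ext_if_derivation, goal_cases)
        case (1 x v w)
        show ?case by (simp add: Z_def P.V.scale_left_distrib add_divide_distrib)
      next
        case (2 x k v)
        have "fst (scale4 k v) = k * fst v" "snd (snd (snd (scale4 k v))) = k * snd (snd (snd v))"
          by (cases v; simp)+
        then show ?case by (simp add: Z_def P.V.scale_right_diff_distrib)
      qed (use \<phi>_cases ne val(2) in \<open>auto simp: Z_def b_def L4_opposite_def alphas
         split_paired_all zero_prod_def field_simps power2_eq_square a1_e\<close>)
    qed
    have "has_dim (H_ext1 N M lam V W) 1"
    proof (rule P.has_dim_H_ext1_1[OF Z])
      show "k = 0" if k: "inner scale4 ?B scale4 ?A (\<lambda>x v. scale4 k (Z x v))" for k
      proof -
        let ?Z = "\<lambda>x v. scale4 k (Z x v)"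
        obtain T where T: "\<And>x v. P.E ?Z x (T v, v) = (T (?A x v), ?A x v)" "\<And>c v. T (scale4 c v) = scale4 c (T v)"
          using P.innerE[OF k] by metis
        let ?t = "T ?e0"
        have "P.E ?Z A1 (P.E ?Z A2 (P.E ?Z A1 (?t, ?e0))) = (T (0, 0, 0, 1), 0, 0, 0, 1)"
          by (simp only: T(1) A_e)
        moreover have "P.E ?Z A2 (?t, ?e0) = (T (0, 0, 0, e), 0, 0, 0, e)" by (simp only: T(1) A_e)
        moreover have "T (0, 0, 0, e) = scale4 e (T (0, 0, 0, 1))" using T(2)[of e "(0, 0, 0, 1)"] by simp
        ultimately have "obst ?Z ?t = 0" by (simp add: obst_def ext_simps zero_prod_def)
        then have "fst (obst ?Z ?t) = 0" by simp
        \<comment> \<open>In a split extension the lift on the graph of \<open>T\<close> has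
          obstruction zero. Computed directly, that obstruction is \<open>P ?t + k b\<close>, and
          \<open>P\<close> is zero on \<open>W\<close>.\<close>
        then have "?B A2 ?t + scale4 k b - scale4 e (?B A1 (?B A2 (?B A1 ?t))) = 0"
          by (simp add: obst_def ext_simps A_e Z_def P.V.scale_right_diff_distrib del: L4_gen.simps)
        then have "scale4 k b = 0" using oper0[of ?t] by (simp add: algebra_simps)
        then show "k = 0" by (rule b0)
      qed
      fix X assume X: "H_rep P.sE (P.E X) N M lam"
      obtain t p where t: "has_type P.sE (P.E X) \<phi> (t, ?e0)" "obst X t = (p, 0)"
        and p: "has_type scale4 ?B (chi_neg \<phi>) p"
        using lift[OF X] by blast
      obtain k where k: "p = scale4 k b" using b_span[OF p] by blast
      let ?X = "\<lambda>x v. scale4 1 (X x v) + scale4 (- k) (Z x v)"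
      have X': "H_rep P.sE (P.E ?X) N M lam" by (rule P.H_rep_lincomb[OF X Z])
      have "has_type P.sE (P.E ?X) \<phi> (t, ?e0)" using t(1)
        by (simp add: has_type_def ext_simps Z_def)
      \<comment> \<open>Of the vectors to which \<open>a\<^sub>2\<close> is applied in
        \<open>P\<close>, only the generator has a nonzero image under \<open>Z\<close>, so
        subtracting \<open>k Z\<close> removes exactly \<open>k b\<close>.\<close>
      moreover have "obst ?X t = obst X t - (scale4 k b, 0)"
        by (simp add: obst_def ext_simps Z_def)
      then have "obst ?X t = 0" by (simp add: t(2) k zero_prod_def)
      ultimately have "inner scale4 ?B scale4 ?A ?X" by (rule inner0[OF X'])
      then show "\<exists>k. inner scale4 ?B scale4 ?A (\<lambda>x v. X x v - scale4 k (Z x v))" by auto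
    qed
    then show ?thesis using True by simp
  qed
qed

theorem proposition5p2:
  fixes N M :: nat
    and lam :: "'k::{alg_closed_field, field_char_0} \<times> 'k \<times> 'k"
    and \<chi> \<phi> :: "'k \<times> 'k"
  assumes "N \<ge> 2" and "M \<ge> 2"
    and "\<chi> \<in> chars N M"
    and "\<phi> \<in> Omega \<chi>"
  shows
    "(\<chi> \<in> chars1 N M lam \<longrightarrow>
       (\<forall>(V :: ('k free_alg set, 'v) module) (W :: ('k free_alg set, 'w) module).
          is_L1 N M lam \<phi> V \<and> is_L1 N M lam \<chi> W \<longrightarrow>
          has_dim (H_ext1 N M lam V W) (if \<phi> \<in> {chi_bar \<chi>, chi_neg \<chi>} then 1 else 0)))
     \<and>
     (\<chi> \<in> chars2 N M lam \<and> alpha1 lam \<chi> \<noteq> 0 \<longrightarrow>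
       (\<forall>(V :: ('k free_alg set, 'v) module) (W :: ('k free_alg set, 'w) module).
          is_L2h N M lam \<phi> V \<and> is_L2h N M lam \<chi> W \<longrightarrow>
          has_dim (H_ext1 N M lam V W) (if \<phi> \<in> {chi_neg (chi_bar \<chi>), chi_neg \<chi>} then 2 else 0)))
     \<and>
     (\<chi> \<in> chars2 N M lam \<and> alpha2 lam \<chi> \<noteq> 0 \<longrightarrow>
       (\<forall>(V :: ('k free_alg set, 'v) module) (W :: ('k free_alg set, 'w) module).
          is_L2v N M lam \<phi> V \<and> is_L2v N M lam \<chi> W \<longrightarrow>
          has_dim (H_ext1 N M lam V W) (if \<phi> \<in> {chi_neg (chi_bar \<chi>), chi_bar \<chi>} then 2 else 0)))
     \<and>
     (\<chi> \<in> chars4 N M lam \<and> Disc lam \<chi> \<noteq> 0 \<longrightarrow>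
       (\<forall>d e (V :: ('k free_alg set, 'v) module) (W :: ('k free_alg set, 'w) module).
          L4_root lam \<chi> d \<and> L4_root lam \<chi> e \<and>
          is_L4 N M lam \<phi> e V \<and> is_L4 N M lam \<chi> d W \<longrightarrow>
          has_dim (H_ext1 N M lam V W) 0))
     \<and>
     (\<chi> \<in> chars4 N M lam \<and> Disc lam \<chi> = 0 \<longrightarrow>
       (\<forall>d e (V :: ('k free_alg set, 'v) module) (W :: ('k free_alg set, 'w) module).
          L4_root lam \<chi> d \<and> L4_root lam \<chi> e \<and>
          is_L4 N M lam \<phi> e V \<and> is_L4 N M lam \<chi> d W \<longrightarrow>
          has_dim (H_ext1 N M lam V W) 1))"
proof (intro conjI impI allI; (elim conjE)?)
  note NM = assms(1,2)
  show "has_dim (H_ext1 N M lam V W) (if \<phi> \<in> {chi_bar \<chi>, chi_neg \<chi>} then 1 else 0)"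
    if "is_L1 N M lam \<phi> V" "is_L1 N M lam \<chi> W"
    for V :: "('k free_alg set, 'v) module" and W :: "('k free_alg set, 'w) module"
    by (rule ext1_L1[OF NM assms(3,4) that])
  show "has_dim (H_ext1 N M lam V W) (if \<phi> \<in> {chi_neg (chi_bar \<chi>), chi_neg \<chi>} then 2 else 0)"
    if V: "is_L2h N M lam \<phi> V" and W: "is_L2h N M lam \<chi> W"
    for V :: "('k free_alg set, 'v) module" and W :: "('k free_alg set, 'w) module"
  proof -
    obtain \<iota>V \<iota>W where "H_model scale2 (L2_gen A1 lam \<phi>) N M lam V \<iota>V"
      "H_model scale2 (L2_gen A1 lam \<chi>) N M lam W \<iota>W"
      using H_model_L2h[OF V] H_model_L2h[OF W] by blast
    from ext1_L2[OF NM assms(3,4) _ this, of A2] show ?thesis by (simp add: shift_def)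
  qed
  show "has_dim (H_ext1 N M lam V W) (if \<phi> \<in> {chi_neg (chi_bar \<chi>), chi_bar \<chi>} then 2 else 0)"
    if V: "is_L2v N M lam \<phi> V" and W: "is_L2v N M lam \<chi> W"
    for V :: "('k free_alg set, 'v) module" and W :: "('k free_alg set, 'w) module"
  proof -
    obtain \<iota>V \<iota>W where "H_model scale2 (L2_gen A2 lam \<phi>) N M lam V \<iota>V"
      "H_model scale2 (L2_gen A2 lam \<chi>) N M lam W \<iota>W"
      using H_model_L2v[OF V] H_model_L2v[OF W] by blast
    from ext1_L2[OF NM assms(3,4) _ this, of A1]
    have "has_dim (H_ext1 N M lam V W) (if \<phi> \<in> {chi_bar (chi_neg \<chi>), chi_bar \<chi>} then 2 else 0)"
      by (simp add: shift_def)
    moreover have "chi_bar (chi_neg \<chi>) = chi_neg (chi_bar \<chi>)" by (simp add: prod_eq_iff)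
    ultimately show ?thesis by simp
  qed
  have L4: "has_dim (H_ext1 N M lam V W) (if Disc lam \<chi> = 0 then 1 else 0)"
    if "\<chi> \<in> chars4 N M lam" "L4_root lam \<chi> d" "L4_root lam \<chi> e" "is_L4 N M lam \<phi> e V" "is_L4 N M lam \<chi> d W"
    for d e and V :: "('k free_alg set, 'v) module" and W :: "('k free_alg set, 'w) module"
    by (rule ext1_L4[OF NM that(1) assms(4) that(2-5)])
  show "has_dim (H_ext1 N M lam V W) 0"
    if "\<chi> \<in> chars4 N M lam" "Disc lam \<chi> \<noteq> 0" "L4_root lam \<chi> d" "L4_root lam \<chi> e"
      "is_L4 N M lam \<phi> e V" "is_L4 N M lam \<chi> d W"
    for d e and V :: "('k free_alg set, 'v) module" and W :: "('k free_alg set, 'w) module"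
    using L4[OF that(1,3-6)] that(2) by simp
  show "has_dim (H_ext1 N M lam V W) 1"
    if "\<chi> \<in> chars4 N M lam" "Disc lam \<chi> = 0" "L4_root lam \<chi> d" "L4_root lam \<chi> e"
      "is_L4 N M lam \<phi> e V" "is_L4 N M lam \<chi> d W"
    for d e and V :: "('k free_alg set, 'v) module" and W :: "('k free_alg set, 'w) module"
    using L4[OF that(1,3-6)] that(2) by simp
qed

end
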